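(* Let $P$ be a tree poset of height $k$, and let $p=p(n)$ satisfy $pn\to\infty$. Let $\mathcal{P}(n,p)$ be the random subfamily of $\mathcal{B}_n$ in which each set of $\mathcal{B}_n$ is included independently with probability $p$. Then with probability tending to $1$ as $n\to\infty$, the largest subfamily of $\mathcal{P}(n,p)$ containing no induced copy of $P$ has size $(k-1+o(1))\,p\binom{n}{\lfloor n/2\rfloor}$.
   Context: $\mathcal{B}_n$ is the family of all subsets of $[n]$ ordered by inclusion. A tree poset is a finite poset whose Hasse diagram (as an undirected graph) is a tree; its height is the largest number of elements in a chain. An induced copy of $P$ in a family $\mathcal{F}$ is the image of an injective map $f:P\to\mathcal{F}$ with $f(x)\subsetneq f(y)$ if and only if $x<_P y$. *)

theory Defs
  imports Complex_Main
begin

definition is_poset :: "'a set \<Rightarrow> ('a \<Rightarrow> 'a \<Rightarrow> bool) \<Rightarrow> bool" where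
  "is_poset X le \<longleftrightarrow> finite X \<and> (\<forall>x\<in>X. le x x)
     \<and> (\<forall>x\<in>X. \<forall>y\<in>X. le x y \<and> le y x \<longrightarrow> x = y)
     \<and> (\<forall>x\<in>X. \<forall>y\<in>X. \<forall>z\<in>X. le x y \<and> le y z \<longrightarrow> le x z)"

definition covers :: "'a set \<Rightarrow> ('a \<Rightarrow> 'a \<Rightarrow> bool) \<Rightarrow> 'a \<Rightarrow> 'a \<Rightarrow> bool" where
  "covers X le x y \<longleftrightarrow> x \<in> X \<and> y \<in> X \<and> le x y \<and> x \<noteq> y
     \<and> \<not> (\<exists>z\<in>X. le x z \<and> le z y \<and> z \<noteq> x \<and> z \<noteq> y)"

definition hasse_adj :: "'a set \<Rightarrow> ('a \<Rightarrow> 'a \<Rightarrow> bool) \<Rightarrow> 'a \<Rightarrow> 'a \<Rightarrow> bool" where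
  "hasse_adj X le x y \<longleftrightarrow> covers X le x y \<or> covers X le y x"

definition hasse_edges :: "'a set \<Rightarrow> ('a \<Rightarrow> 'a \<Rightarrow> bool) \<Rightarrow> 'a set set" where
  "hasse_edges X le = {{x, y} | x y. covers X le x y}"

definition is_tree_poset :: "'a set \<Rightarrow> ('a \<Rightarrow> 'a \<Rightarrow> bool) \<Rightarrow> bool" where
  "is_tree_poset X le \<longleftrightarrow> is_poset X le \<and> X \<noteq> {}
     \<and> (\<forall>x\<in>X. \<forall>y\<in>X. (hasse_adj X le)\<^sup>*\<^sup>* x y)
     \<and> card (hasse_edges X le) = card X - 1"

definition is_chain :: "'a set \<Rightarrow> ('a \<Rightarrow> 'a \<Rightarrow> bool) \<Rightarrow> 'a set \<Rightarrow> bool" where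
  "is_chain X le C \<longleftrightarrow> C \<subseteq> X \<and> (\<forall>x\<in>C. \<forall>y\<in>C. le x y \<or> le y x)"

definition height :: "'a set \<Rightarrow> ('a \<Rightarrow> 'a \<Rightarrow> bool) \<Rightarrow> nat" where
  "height X le = Max (card ` {C. is_chain X le C})"

definition induced_copy :: "'a set \<Rightarrow> ('a \<Rightarrow> 'a \<Rightarrow> bool) \<Rightarrow> nat set set \<Rightarrow> ('a \<Rightarrow> nat set) \<Rightarrow> bool" where
  "induced_copy X le F f \<longleftrightarrow> inj_on f X \<and> f ` X \<subseteq> F
     \<and> (\<forall>x\<in>X. \<forall>y\<in>X. f x \<subset> f y \<longleftrightarrow> (le x y \<and> x \<noteq> y))"

definition contains_induced :: "'a set \<Rightarrow> ('a \<Rightarrow> 'a \<Rightarrow> bool) \<Rightarrow> nat set set \<Rightarrow> bool" where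
  "contains_induced X le F \<longleftrightarrow> (\<exists>f. induced_copy X le F f)"

definition max_free :: "'a set \<Rightarrow> ('a \<Rightarrow> 'a \<Rightarrow> bool) \<Rightarrow> nat set set \<Rightarrow> nat" where
  "max_free X le F = Max {card G | G. G \<subseteq> F \<and> \<not> contains_induced X le G}"

definition boolean_lattice :: "nat \<Rightarrow> nat set set" where
  "boolean_lattice n = Pow {..<n}"

text \<open>Probability that the random family P(n,p) (each set of B_n kept independently
  with probability p) satisfies the event E.\<close>
definition prob_Pnp :: "nat \<Rightarrow> real \<Rightarrow> (nat set set \<Rightarrow> bool) \<Rightarrow> real" where
  "prob_Pnp n p E = (\<Sum>F \<in> Pow (boolean_lattice n).
      if E F then p ^ card F * (1 - p) ^ card (boolean_lattice n - F) else 0)"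

end

theory Submission
  imports Defs "HOL-Library.FuncSet" "HOL-Combinatorics.Permutations" "HOL-Real_Asymp.Real_Asymp"
begin

text \<open>
  Write \<open>C = n choose (n div 2)\<close>. The upper bound is a container argument with two ingredients.

  Supersaturation: let \<open>F\<close> have at least \<open>(k - 1 + e) C\<close> members near the middle level. Maximal chains,
  truncated at both ends so that every set lies on equally many of them, meet \<open>F\<close> in more than \<open>k - 1\<close>
  sets on average, so there are many windows of \<open>k\<close> consecutive members of \<open>F\<close> on a chain. After
  discarding the rarely used (position, set) pairs, mapping a root of \<open>P\<close> at random and resampling a
  window along each Hasse edge gives a tree-indexed Markov chain of order-preserving maps from \<open>P\<close>
  to \<open>F\<close>. It is an induced copy with probability at least \<open>2 ^ - |P|\<close>, and it contains \<open>j\<close> given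
  sets with probability at most of order \<open>n ^ -(j - 1) / |F|\<close>.

  Transference: let \<open>Q\<close> be a down-closed collection of \<open>P\<close>-free subfamilies of \<open>F\<close>, and let \<open>R\<close> be a
  \<open>q\<close>-random subfamily conditioned on \<open>R \<in> Q\<close>. If \<open>q\<close> is a large multiple of \<open>1 / n\<close>, a second-moment
  estimate against the measure above yields a \<open>v \<in> F\<close> with \<open>Pr (v \<in> R) < (1 - \<delta>) q\<close>. Asking repeatedly
  whether such a \<open>v\<close> belongs to a given free family, each positive answer decreases the probability of
  the current collection by the factor \<open>1 - \<delta>\<close>; hence there are only \<open>O(q |F|)\<close> positive answers, and
  they determine a container with fewer than \<open>(k - 1 + e) C\<close> members.

  The lower bound comes from \<open>k - 1\<close> consecutive middle levels.
\<close>

section \<open>Containers from low conditional marginals\<close>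

text \<open>Two exponents have to be balanced. For a fixed container the event that the random
  family has \<open>e p C\<close> members too many in it has probability
  \<open>exp (- \<Omega> (p C))\<close>, and the union bound over containers must not destroy this.
  A fingerprint lies inside the random family, so each one contributes a factor
  \<open>p ^ |S|\<close>; summing over all sets of at most \<open>\<kappa> p C\<close> members then
  costs only \<open>exp (O (\<kappa> log (1 / \<kappa>)) p C)\<close>. This is affordable for a
  small constant \<open>\<kappa>\<close>, but it leaves no room for a logarithmic factor in the size
  of the fingerprints, which is why the bound \<open>O (q |F|)\<close> on the number of positive
  answers is essential. Taking \<open>q = \<kappa> p\<close> requires \<open>\<kappa> p\<close> to
  exceed a constant multiple of \<open>1 / n\<close>, and this is where
  \<open>p n \<rightarrow> \<infinity>\<close> enters. The order \<open>1 / n\<close> itself is the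
  chance that a random chain through a given set near the middle continues through a given set one
  level away.\<close>

definition wt :: "real \<Rightarrow> 'v set \<Rightarrow> 'v set \<Rightarrow> real" where
  "wt q V J = q ^ card J * (1 - q) ^ card (V - J)"

lemma wt_nonneg: "0 \<le> q \<Longrightarrow> q \<le> 1 \<Longrightarrow> 0 \<le> wt q V J"
  by (simp add: wt_def)

text \<open>Independence as a generating function: \<open>u x\<close> is the factor of a chosen
  element and \<open>v x\<close> that of an omitted one. Constant factors give total mass one; the
  exponential moments of the random family are the other use.\<close>

lemma sum_wt_prod:
  assumes "finite V"
  shows "(\<Sum>J\<in>Pow V. wt q V J * ((\<Prod>x\<in>J. u x) * (\<Prod>x\<in>V - J. v x)))
    = (\<Prod>x\<in>V. q * u x + (1 - q) * v x)"
proof -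
  have "(\<Prod>x\<in>V. q * u x + (1 - q) * v x)
    = (\<Sum>J\<in>Pow V. (\<Prod>x\<in>J. q * u x) * (\<Prod>x\<in>V - J. (1 - q) * v x))"
    by (rule prod_add[OF assms])
  also have "\<dots> = (\<Sum>J\<in>Pow V. wt q V J * ((\<Prod>x\<in>J. u x) * (\<Prod>x\<in>V - J. v x)))"
    by (intro sum.cong) (auto simp: wt_def prod.distrib)
  finally show ?thesis by simp
qed

lemma sum_wt: "finite V \<Longrightarrow> (\<Sum>J\<in>Pow V. wt q V J) = 1"
  using sum_wt_prod[of V q "\<lambda>_. 1" "\<lambda>_. 1"] by simp

text \<open>Adding \<open>U\<close> to a random set gives the law of a random set conditioned on
  containing \<open>U\<close>. The proof groups the sets \<open>J\<close> with the same union
  \<open>J \<union> U\<close> by the part \<open>W = U - J\<close> that was missing.\<close>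

lemma sum_wt_shift:
  assumes V: "finite V" and T: "T \<subseteq> Pow V" and U: "U \<subseteq> V"
  shows "q ^ card U * (\<Sum>J\<in>{J\<in>Pow V. J \<union> U \<in> T}. wt q V J) = (\<Sum>J\<in>{J\<in>T. U \<subseteq> J}. wt q V J)"
proof -
  have fU: "finite U" using V U finite_subset by blast
  have fT: "finite T" using T V finite_subset by blast
  have "(\<Sum>J\<in>{J\<in>Pow V. J \<union> U \<in> T}. wt q V J)
    = (\<Sum>(J, W)\<in>Sigma {J\<in>T. U \<subseteq> J} (\<lambda>_. Pow U). wt q V (J - W))"
  proof (rule sum.reindex_bij_witness[where i = "\<lambda>(J, W). J - W" and j = "\<lambda>J. (J \<union> U, U - J)"])
    fix J assume "J \<in> {J\<in>Pow V. J \<union> U \<in> T}"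
    moreover have "J \<union> U - (U - J) = J" by blast
    ultimately show "(case (J \<union> U, U - J) of (J, W) \<Rightarrow> J - W) = J"
      "(J \<union> U, U - J) \<in> Sigma {J\<in>T. U \<subseteq> J} (\<lambda>_. Pow U)"
      "(case (J \<union> U, U - J) of (J, W) \<Rightarrow> wt q V (J - W)) = wt q V J" by auto
  next
    fix JW assume "JW \<in> Sigma {J\<in>T. U \<subseteq> J} (\<lambda>_. Pow U)"
    then obtain J W where JW: "JW = (J, W)" "J \<in> T" "U \<subseteq> J" "W \<subseteq> U" by blast
    have "J - W \<union> U = J" "U - (J - W) = W" "J - W \<subseteq> V" using JW T by blast+
    then show "(\<lambda>J. (J \<union> U, U - J)) (case JW of (J, W) \<Rightarrow> J - W) = JW"
      "(case JW of (J, W) \<Rightarrow> J - W) \<in> {J\<in>Pow V. J \<union> U \<in> T}" using JW by auto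
  qed
  also have "\<dots> = (\<Sum>J\<in>{J\<in>T. U \<subseteq> J}. \<Sum>W\<in>Pow U. wt q V (J - W))"
    using fT fU by (subst sum.Sigma) auto
  finally have eq: "(\<Sum>J\<in>{J\<in>Pow V. J \<union> U \<in> T}. wt q V J)
    = (\<Sum>J\<in>{J\<in>T. U \<subseteq> J}. \<Sum>W\<in>Pow U. wt q V (J - W))" .
  have "q ^ card U * (\<Sum>W\<in>Pow U. wt q V (J - W)) = wt q V J" if J: "J \<in> T" "U \<subseteq> J" for J
  proof -
    have fJ: "finite J" and JV: "J \<subseteq> V" using J T V finite_subset by blast+
    \<comment> \<open>Each element of \<open>W\<close> trades a factor \<open>q\<close> for
      \<open>1 - q\<close>; what remains of \<open>q ^ card U\<close> is the weight of
      \<open>W\<close> as a \<open>(1 - q)\<close>-random subset of \<open>U\<close>, and these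
      weights sum to one.\<close>
    have "q ^ card U * wt q V (J - W) = wt q V J * wt (1 - q) U W" if W: "W \<subseteq> U" for W
    proof -
      have fW: "finite W" using W fU finite_subset by blast
      have c1: "card (J - W) = card J - card W" "card W \<le> card J"
        using W J fJ fW by (auto intro!: card_Diff_subset card_mono)
      have c2: "card (V - (J - W)) = card (V - J) + card W"
      proof -
        have "V - (J - W) = (V - J) \<union> W" using W J JV by auto
        moreover have "(V - J) \<inter> W = {}" using W J by blast
        ultimately show ?thesis using V fW by (simp add: card_Un_disjoint)
      qed
      have c3: "card (U - W) = card U - card W" "card W \<le> card U"
        using W fU fW by (auto intro!: card_Diff_subset card_mono)
      have "card U + (card J - card W) = card J + (card U - card W)" using c1 c3 by simp
      then have "q ^ card U * q ^ (card J - card W) = q ^ card J * q ^ (card U - card W)"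
        by (metis power_add)
      then show ?thesis by (simp add: wt_def c1 c2 c3 power_add)
    qed
    then have "q ^ card U * (\<Sum>W\<in>Pow U. wt q V (J - W)) = wt q V J * (\<Sum>W\<in>Pow U. wt (1 - q) U W)"
      by (simp add: sum_distrib_left)
    then show ?thesis using sum_wt[OF fU] by simp
  qed
  then show ?thesis unfolding eq by (simp add: sum_distrib_left)
qed

text \<open>If all marginals were at least \<open>(1 - \<delta>) q\<close>, then for most \<open>v\<close> adding \<open>v\<close> to a random member of \<open>Q\<close>
  would stay in \<open>Q\<close>. But adding the vertices of a random edge one by one must leave \<open>Q\<close> at some step;
  the probability of this is bounded by Cauchy--Schwarz in the form of AM-GM, using \<open>spread\<close>.\<close>
lemma low_marginal:
  fixes e :: "'f \<Rightarrow> 'v set" and w :: "'f \<Rightarrow> real" and q \<delta> K :: real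
  assumes V: "finite V" and A: "A \<subseteq> V" and \<Phi>: "finite \<Phi>"
    and e: "\<And>f. f \<in> \<Phi> \<Longrightarrow> e f \<subseteq> A" "\<And>f. f \<in> \<Phi> \<Longrightarrow> card (e f) \<le> r"
    and w: "\<And>f. f \<in> \<Phi> \<Longrightarrow> 0 \<le> w f" "(\<Sum>f\<in>\<Phi>. w f) = 1"
    and spread: "\<And>E. E \<subseteq> A \<Longrightarrow> E \<noteq> {} \<Longrightarrow>
      (\<Sum>f\<in>{f\<in>\<Phi>. E \<subseteq> e f}. w f) \<le> K / card A * q ^ (card E - 1)"
    and Q: "Q \<subseteq> Pow V" "{} \<in> Q" "\<And>J J'. J \<in> Q \<Longrightarrow> J' \<subseteq> J \<Longrightarrow> J' \<in> Q"
    and noedge: "\<And>f J. f \<in> \<Phi> \<Longrightarrow> J \<in> Q \<Longrightarrow> \<not> e f \<subseteq> J"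
    and q: "0 < q" "q < 1" and K: "0 < K" and \<delta>: "\<delta> * 8 ^ r * K\<^sup>2 < 1"
  shows "\<exists>v\<in>V. (\<Sum>J\<in>{J\<in>Q. v \<in> J}. wt q V J) < (1 - \<delta>) * q * (\<Sum>J\<in>Q. wt q V J)"
proof (rule ccontr)
  assume "\<not> ?thesis"
  then have contra: "(1 - \<delta>) * q * (\<Sum>J\<in>Q. wt q V J) \<le> (\<Sum>J\<in>{J\<in>Q. v \<in> J}. wt q V J)" if "v \<in> V" for v
    using that by force
  have fQ: "finite Q" using Q(1) V finite_subset by blast
  have fA: "finite A" using A V finite_subset by blast
  have wt0: "0 \<le> wt q V J" for J using q by (simp add: wt_nonneg)
  define Z where "Z = (\<Sum>J\<in>Q. wt q V J)"
  have "0 < wt q V {}" using q by (simp add: wt_def)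
  then have Z: "0 < Z" unfolding Z_def using Q(2) fQ wt0 by (meson sum_pos2)
  have "\<Phi> \<noteq> {}" using w(2) by auto
  then obtain f0 where f0: "f0 \<in> \<Phi>" by auto
  then have "A \<noteq> {}" using e(1)[OF f0] noedge[OF f0 Q(2)] by auto
  define N where "N = real (card A)"
  have N: "N > 0" unfolding N_def using \<open>A \<noteq> {}\<close> fA by (simp add: card_gt_0_iff)
  \<comment> \<open>The members of \<open>Q\<close> from which adding \<open>v\<close> leaves the
    collection. A marginal of at least \<open>(1 - \<delta>) * q\<close> keeps their share of the
    mass of \<open>Q\<close> below \<open>\<delta>\<close>.\<close>
  define B where "B = (\<lambda>v. {J\<in>Q. insert v J \<notin> Q})"
  have BQ: "B v \<subseteq> Q" for v unfolding B_def by auto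
  have h1: "(\<Sum>J\<in>B v. wt q V J) \<le> \<delta> * Z" if v: "v \<in> V" for v
  proof -
    have "{J \<in> Pow V. J \<union> {v} \<in> Q} = Q - B v" unfolding B_def using Q by (auto intro: Q(3))
    then have "q * (\<Sum>J\<in>Q - B v. wt q V J) = (\<Sum>J\<in>{J\<in>Q. v \<in> J}. wt q V J)"
      using sum_wt_shift[OF V Q(1), of "{v}" q] v by simp
    then have "q * ((1 - \<delta>) * Z) \<le> q * (\<Sum>J\<in>Q - B v. wt q V J)"
      using contra[OF v] by (simp add: Z_def mult_ac)
    then have "(1 - \<delta>) * Z \<le> (\<Sum>J\<in>Q - B v. wt q V J)" using q by simp
    moreover have "(\<Sum>J\<in>Q - B v. wt q V J) = Z - (\<Sum>J\<in>B v. wt q V J)"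
      unfolding Z_def using BQ fQ by (simp add: sum_diff)
    ultimately show ?thesis by (simp add: algebra_simps)
  qed
  \<comment> \<open>Since \<open>Q\<close> is down-closed, \<open>J \<union> S \<in> Q\<close>
    forces \<open>J \<in> Q\<close>: conditioning on \<open>Q\<close> cannot make containing
    \<open>S\<close> more likely than \<open>q ^ card S\<close>.\<close>
  have h2: "(\<Sum>J\<in>{J\<in>Q. S \<subseteq> J}. wt q V J) \<le> q ^ card S * Z" if S: "S \<subseteq> V" for S
  proof -
    have "(\<Sum>J\<in>{J\<in>Q. S \<subseteq> J}. wt q V J) = q ^ card S * (\<Sum>J\<in>{J\<in>Pow V. J \<union> S \<in> Q}. wt q V J)"
      using sum_wt_shift[OF V Q(1) S] by simp
    also have "\<dots> \<le> q ^ card S * Z"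
      unfolding Z_def using q fQ wt0 Q by (intro mult_left_mono sum_mono2) (auto intro: Q(3))
    finally show ?thesis .
  qed
  define P where "P = (\<lambda>v. Sigma {f\<in>\<Phi>. v \<in> e f} (\<lambda>f. Pow (e f - {v})))"
  have fe: "finite (e f)" if "f \<in> \<Phi>" for f using e(1)[OF that] fA finite_subset by blast
  have fP: "finite (P v)" for v unfolding P_def using \<Phi> fe by auto
  \<comment> \<open>\<open>Y v J\<close> collects the ways to arrive at \<open>J\<close> just before
    the fatal vertex \<open>v\<close>: an edge through \<open>v\<close> and a set \<open>U\<close>
    of its vertices already added. The factor \<open>(1 / q) ^ card U\<close> is the price of
    \<open>sum_wt_shift\<close>.\<close>
  define Y where "Y = (\<lambda>v J. \<Sum>(f, U)\<in>P v. w f * (1 / q) ^ card U * of_bool (U \<subseteq> J))"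
  \<comment> \<open>The spread bound is applied to \<open>insert v I\<close> for every possible part
    \<open>I\<close> of \<open>U\<close> inside the second edge; its power \<open>q ^ card I\<close>
    cancels the weight. One factor \<open>2 ^ r\<close> counts the sets \<open>U'\<close>, the other
    the sets \<open>I\<close>.\<close>
  have h5: "(\<Sum>(f, U')\<in>P v. w f * (1 / q) ^ card (U \<inter> U')) \<le> 4 ^ r * (K / N)"
    if v: "v \<in> A" and U: "U \<subseteq> A" "v \<notin> U" "card U \<le> r" for v U
  proof -
    have fU: "finite U" using U fA finite_subset by blast
    have "(\<Sum>(f, U')\<in>P v. w f * (1 / q) ^ card (U \<inter> U'))
      = (\<Sum>f\<in>{f\<in>\<Phi>. v \<in> e f}. \<Sum>U'\<in>Pow (e f - {v}). w f * (1 / q) ^ card (U \<inter> U'))"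
      unfolding P_def using \<Phi> fe by (subst sum.Sigma) auto
    also have "\<dots> \<le> (\<Sum>f\<in>{f\<in>\<Phi>. v \<in> e f}. 2 ^ r * (\<Sum>I\<in>Pow U. w f * of_bool (I \<subseteq> e f) * (1 / q) ^ card I))"
    proof (intro sum_mono)
      fix f assume f: "f \<in> {f\<in>\<Phi>. v \<in> e f}"
      have "(1 / q) ^ card (U \<inter> U') \<le> (1 / q) ^ card (U \<inter> e f)" if "U' \<in> Pow (e f - {v})" for U'
        using that q fU by (intro power_increasing card_mono) auto
      then have "(\<Sum>U'\<in>Pow (e f - {v}). w f * (1 / q) ^ card (U \<inter> U'))
        \<le> (\<Sum>U'\<in>Pow (e f - {v}). w f * (1 / q) ^ card (U \<inter> e f))"
        using w f by (intro sum_mono mult_left_mono) auto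
      also have "\<dots> = 2 ^ card (e f - {v}) * (w f * (1 / q) ^ card (U \<inter> e f))"
        using f fe by (simp add: card_Pow)
      also have "\<dots> \<le> 2 ^ r * (w f * (1 / q) ^ card (U \<inter> e f))"
      proof -
        have "card (e f - {v}) \<le> r" using e(2)[of f] f by (metis (lifting) card_Diff1_le le_trans mem_Collect_eq)
        then show ?thesis using w(1)[of f] f q by (intro mult_right_mono power_increasing) auto
      qed
      also have "w f * (1 / q) ^ card (U \<inter> e f) \<le> (\<Sum>I\<in>Pow U. w f * of_bool (I \<subseteq> e f) * (1 / q) ^ card I)"
      proof -
        have "(\<Sum>I\<in>{U \<inter> e f}. w f * of_bool (I \<subseteq> e f) * (1 / q) ^ card I)
          \<le> (\<Sum>I\<in>Pow U. w f * of_bool (I \<subseteq> e f) * (1 / q) ^ card I)"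
          using w(1)[of f] f q fU by (intro sum_mono2) auto
        then show ?thesis by simp
      qed
      finally show "(\<Sum>U'\<in>Pow (e f - {v}). w f * (1 / q) ^ card (U \<inter> U'))
         \<le> 2 ^ r * (\<Sum>I\<in>Pow U. w f * of_bool (I \<subseteq> e f) * (1 / q) ^ card I)" by simp
    qed
    also have "\<dots> = 2 ^ r * (\<Sum>I\<in>Pow U. (1 / q) ^ card I * (\<Sum>f\<in>{f\<in>\<Phi>. v \<in> e f}. w f * of_bool (I \<subseteq> e f)))"
      unfolding sum_distrib_left[symmetric]
      by (subst sum.swap) (simp add: sum_distrib_left mult_ac)
    also have "\<dots> \<le> 2 ^ r * (\<Sum>I\<in>Pow U. K / N)"
    proof (intro mult_left_mono sum_mono)
      fix I assume I: "I \<in> Pow U"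
      have fI: "finite I" using I fU finite_subset by blast
      have "(\<Sum>f\<in>{f\<in>\<Phi>. v \<in> e f}. w f * of_bool (I \<subseteq> e f)) = (\<Sum>f\<in>{f\<in>\<Phi>. insert v I \<subseteq> e f}. w f)"
        using \<Phi> by (intro sum.mono_neutral_cong_right) auto
      also have "\<dots> \<le> K / N * q ^ (card (insert v I) - 1)"
        unfolding N_def using v U I by (intro spread) auto
      also have "card (insert v I) - 1 = card I" using fI U I by (subst card_insert_disjoint) auto
      finally have "(1 / q) ^ card I * (\<Sum>f\<in>{f\<in>\<Phi>. v \<in> e f}. w f * of_bool (I \<subseteq> e f))
        \<le> (1 / q) ^ card I * (K / N * q ^ card I)" using q by (intro mult_left_mono) auto
      also have "\<dots> = K / N" using q by (simp add: power_divide)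
      finally show "(1 / q) ^ card I * (\<Sum>f\<in>{f\<in>\<Phi>. v \<in> e f}. w f * of_bool (I \<subseteq> e f)) \<le> K / N" .
    qed simp
    also have "\<dots> = 2 ^ r * 2 ^ card U * (K / N)" using fU by (simp add: card_Pow)
    also have "\<dots> \<le> 2 ^ r * 2 ^ r * (K / N)"
      using U K N by (intro mult_right_mono mult_left_mono power_increasing) auto
    also have "\<dots> = 4 ^ r * (K / N)" by (simp flip: power_mult_distrib)
    finally show ?thesis .
  qed
  \<comment> \<open>\<open>U \<union> U' \<subseteq> J\<close> has conditional probability at most
    \<open>q ^ card (U \<union> U')\<close>, so of the two weights only
    \<open>(1 / q) ^ card (U \<inter> U')\<close> survives, and \<open>h5\<close> controls its sum.
    The third factor \<open>2 ^ r\<close> counts the sets \<open>U\<close>.\<close>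
  have h4: "(\<Sum>J\<in>Q. wt q V J * (Y v J)\<^sup>2) \<le> Z * 8 ^ r * (K / N)\<^sup>2" if v: "v \<in> A" for v
  proof -
    have sub: "U \<subseteq> A" "v \<notin> U" "card U \<le> r" "finite U" "0 \<le> w f" if "(f, U) \<in> P v" for f U
    proof -
      have *: "f \<in> \<Phi>" "U \<subseteq> e f" "v \<notin> U" using that by (auto simp: P_def)
      then show "U \<subseteq> A" "v \<notin> U" "finite U" "0 \<le> w f" using e fe w finite_subset by blast+
      show "card U \<le> r" using * fe e(2) card_mono le_trans by blast
    qed
    have "(\<Sum>J\<in>Q. wt q V J * (Y v J)\<^sup>2)
      = (\<Sum>J\<in>Q. \<Sum>(f, U)\<in>P v. \<Sum>(f', U')\<in>P v. wt q V J *
          ((w f * (1 / q) ^ card U * of_bool (U \<subseteq> J)) * (w f' * (1 / q) ^ card U' * of_bool (U' \<subseteq> J))))"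
      unfolding Y_def power2_eq_square sum_product
      by (simp add: sum_distrib_left case_prod_unfold)
    also have "\<dots> = (\<Sum>(f, U)\<in>P v. \<Sum>(f', U')\<in>P v. \<Sum>J\<in>Q. wt q V J *
          ((w f * (1 / q) ^ card U * of_bool (U \<subseteq> J)) * (w f' * (1 / q) ^ card U' * of_bool (U' \<subseteq> J))))"
      unfolding case_prod_unfold
      by (subst sum.swap) (intro sum.cong refl, subst sum.swap, rule refl)
    also have "\<dots> \<le> (\<Sum>(f, U)\<in>P v. \<Sum>(f', U')\<in>P v. Z * w f * (w f' * (1 / q) ^ card (U \<inter> U')))"
    proof (intro sum_mono, clarify, intro sum_mono, clarify)
      fix f U f' U' assume a: "(f, U) \<in> P v" "(f', U') \<in> P v"
      have "(\<Sum>J\<in>Q. wt q V J * ((w f * (1 / q) ^ card U * of_bool (U \<subseteq> J)) * (w f' * (1 / q) ^ card U' * of_bool (U' \<subseteq> J))))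
        = (\<Sum>J\<in>Q. (w f * w f' * (1 / q) ^ (card U + card U')) * (wt q V J * of_bool (U \<union> U' \<subseteq> J)))"
        by (intro sum.cong) (auto simp: power_add)
      also have "\<dots> = (w f * w f' * (1 / q) ^ (card U + card U')) * (\<Sum>J\<in>{J\<in>Q. U \<union> U' \<subseteq> J}. wt q V J)"
        unfolding sum_distrib_left[symmetric] using fQ
        by (intro arg_cong2[where f = "(*)"] sum.mono_neutral_cong_right) auto
      also have "\<dots> \<le> (w f * w f' * (1 / q) ^ (card U + card U')) * (q ^ card (U \<union> U') * Z)"
        using sub[OF a(1)] sub[OF a(2)] A q by (intro mult_left_mono h2) auto
      also have "\<dots> = Z * w f * (w f' * (1 / q) ^ card (U \<inter> U'))"
      proof -
        have "card U + card U' = card (U \<union> U') + card (U \<inter> U')"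
          using sub[OF a(1)] sub[OF a(2)] by (intro card_Un_Int) auto
        then have "(1 / q) ^ (card U + card U') * q ^ card (U \<union> U') = (1 / q) ^ card (U \<inter> U')"
          using q by (simp add: power_add power_divide)
        then show ?thesis by (simp add: algebra_simps)
      qed
      finally show "(\<Sum>J\<in>Q. wt q V J * ((w f * (1 / q) ^ card U * of_bool (U \<subseteq> J)) * (w f' * (1 / q) ^ card U' * of_bool (U' \<subseteq> J))))
        \<le> Z * w f * (w f' * (1 / q) ^ card (U \<inter> U'))" .
    qed
    also have "\<dots> = (\<Sum>(f, U)\<in>P v. Z * w f * (\<Sum>(f', U')\<in>P v. (w f' * (1 / q) ^ card (U \<inter> U'))))"
      by (simp add: case_prod_unfold sum_distrib_left)
    also have "\<dots> \<le> (\<Sum>(f, U)\<in>P v. Z * w f * (4 ^ r * (K / N)))"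
    proof (intro sum_mono, clarify)
      fix f U assume a: "(f, U) \<in> P v"
      show "Z * w f * (\<Sum>(f', U')\<in>P v. (w f' * (1 / q) ^ card (U \<inter> U'))) \<le> Z * w f * (4 ^ r * (K / N))"
        using sub[OF a] Z v by (intro mult_left_mono h5) auto
    qed
    also have "\<dots> = (\<Sum>f\<in>{f\<in>\<Phi>. v \<in> e f}. 2 ^ card (e f - {v}) * (Z * w f * (4 ^ r * (K / N))))"
      unfolding P_def using \<Phi> fe by (subst sum.Sigma[symmetric]) (auto simp: card_Pow)
    also have "\<dots> \<le> (\<Sum>f\<in>{f\<in>\<Phi>. v \<in> e f}. 2 ^ r * (Z * w f * (4 ^ r * (K / N))))"
    proof (intro sum_mono mult_right_mono power_increasing)
      fix f assume f: "f \<in> {f\<in>\<Phi>. v \<in> e f}"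
      show "card (e f - {v}) \<le> r" using e(2)[of f] f by (metis (lifting) card_Diff1_le le_trans mem_Collect_eq)
      show "0 \<le> Z * w f * (4 ^ r * (K / N))" using Z K N w f by auto
    qed auto
    also have "\<dots> = Z * 8 ^ r * (K / N) * (\<Sum>f\<in>{f\<in>\<Phi>. {v} \<subseteq> e f}. w f)"
    proof -
      have "(8::real) ^ r = 2 ^ r * 4 ^ r" by (simp flip: power_mult_distrib)
      then show ?thesis by (simp add: sum_distrib_left sum_divide_distrib mult_ac)
    qed
    also have "\<dots> \<le> Z * 8 ^ r * (K / N) * (K / N * q ^ (card {v} - 1))"
      unfolding N_def using Z K N v by (intro mult_left_mono spread) (auto simp: N_def)
    finally show ?thesis by (simp add: power2_eq_square mult_ac)
  qed
  have h3: "\<exists>U v. U \<subseteq> e f - {v} \<and> v \<in> e f \<and> J \<union> U \<in> B v" if J: "J \<in> Q" and f: "f \<in> \<Phi>" for J f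
  proof -
    \<comment> \<open>A maximal part of the edge that can be added without leaving \<open>Q\<close>
      is not the whole edge, since members of \<open>Q\<close> contain no edge; any further vertex
      of the edge is then fatal.\<close>
    let ?\<U> = "{U\<in>Pow (e f). J \<union> U \<in> Q}"
    have "finite ?\<U>" "{} \<in> ?\<U>" using J fe[OF f] by auto
    then have "\<exists>U\<in>?\<U>. \<forall>U'\<in>?\<U>. U \<le> U' \<longrightarrow> U = U'"
      by (intro finite_has_maximal) blast+
    then obtain U where U: "U \<in> ?\<U>" "\<And>U'. U' \<in> ?\<U> \<Longrightarrow> U \<subseteq> U' \<Longrightarrow> U = U'"
      by (elim bexE) simp
    have "U \<noteq> e f" using U(1) noedge[OF f] by auto
    then obtain v where v: "v \<in> e f" "v \<notin> U" using U(1) by auto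
    have "insert v (J \<union> U) \<notin> Q"
    proof
      assume "insert v (J \<union> U) \<in> Q"
      then have "insert v U \<in> ?\<U>" using U(1) v by auto
      then show False using U(2)[of "insert v U"] v by auto
    qed
    then show ?thesis using U(1) v unfolding B_def by (intro exI[of _ U] exI[of _ v]) auto
  qed
  have "Z = (\<Sum>J\<in>Q. \<Sum>f\<in>\<Phi>. wt q V J * w f)"
    unfolding Z_def using w(2) by (simp flip: sum_distrib_left)
  also have "\<dots> \<le> (\<Sum>J\<in>Q. \<Sum>f\<in>\<Phi>. wt q V J * w f * (\<Sum>v\<in>e f. \<Sum>U\<in>Pow (e f - {v}). of_bool (J \<union> U \<in> B v)))"
  proof (intro sum_mono)
    fix J f assume J: "J \<in> Q" and f: "f \<in> \<Phi>"
    obtain U v where uv: "U \<subseteq> e f - {v}" "v \<in> e f" "J \<union> U \<in> B v" using h3[OF J f] by auto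
    have "(1::real) = (\<Sum>v\<in>{v}. \<Sum>U\<in>{U}. of_bool (J \<union> U \<in> B v))" using uv by simp
    also have "\<dots> \<le> (\<Sum>v\<in>{v}. \<Sum>U\<in>Pow (e f - {v}). of_bool (J \<union> U \<in> B v))"
      using uv fe[OF f] by (intro sum_mono sum_mono2) auto
    also have "\<dots> \<le> (\<Sum>v\<in>e f. \<Sum>U\<in>Pow (e f - {v}). of_bool (J \<union> U \<in> B v))"
      using uv fe[OF f] by (intro sum_mono2) (auto intro!: sum_nonneg)
    finally have "wt q V J * w f * 1 \<le> wt q V J * w f * (\<Sum>v\<in>e f. \<Sum>U\<in>Pow (e f - {v}). of_bool (J \<union> U \<in> B v))"
      using w(1)[OF f] wt0[of J] by (intro mult_left_mono mult_nonneg_nonneg)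
    then show "wt q V J * w f \<le> wt q V J * w f * (\<Sum>v\<in>e f. \<Sum>U\<in>Pow (e f - {v}). of_bool (J \<union> U \<in> B v))"
      by (simp only: mult_1_right)
  qed
  also have "\<dots> = (\<Sum>f\<in>\<Phi>. \<Sum>v\<in>e f. \<Sum>U\<in>Pow (e f - {v}). w f * (\<Sum>J\<in>Q. wt q V J * of_bool (J \<union> U \<in> B v)))"
    apply (rule trans[OF sum.swap])
    apply (simp only: sum_distrib_left)
    apply (rule sum.cong[OF refl])
    apply (rule trans[OF sum.swap])
    apply (rule sum.cong[OF refl])
    apply (rule trans[OF sum.swap])
    apply (intro sum.cong refl)
    apply (simp only: mult_ac)
    done
  also have "\<dots> = (\<Sum>f\<in>\<Phi>. \<Sum>v\<in>e f. \<Sum>U\<in>Pow (e f - {v}). w f * (1 / q) ^ card U * (\<Sum>J\<in>B v. wt q V J * of_bool (U \<subseteq> J)))"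
  proof (intro sum.cong refl)
    fix f v U assume a: "f \<in> \<Phi>" "v \<in> e f" "U \<in> Pow (e f - {v})"
    have UV: "U \<subseteq> V" using a e A by blast
    have "{J\<in>Pow V. J \<union> U \<in> B v} = {J\<in>Q. J \<union> U \<in> B v}"
      using BQ Q(1) Q(3)[of "_ \<union> U"] by blast
    then have "(\<Sum>J\<in>Q. wt q V J * of_bool (J \<union> U \<in> B v)) = (\<Sum>J\<in>{J\<in>Pow V. J \<union> U \<in> B v}. wt q V J)"
      using fQ by (simp only:) (intro sum.mono_neutral_cong_right, auto)
    moreover have "q ^ card U * (\<Sum>J\<in>{J\<in>Pow V. J \<union> U \<in> B v}. wt q V J) = (\<Sum>J\<in>{J\<in>B v. U \<subseteq> J}. wt q V J)"
      using BQ Q(1) by (intro sum_wt_shift[OF V _ UV]) blast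
    moreover have "(\<Sum>J\<in>{J\<in>B v. U \<subseteq> J}. wt q V J) = (\<Sum>J\<in>B v. wt q V J * of_bool (U \<subseteq> J))"
      using finite_subset[OF BQ fQ] by (intro sum.mono_neutral_cong_left) auto
    ultimately have "q ^ card U * (\<Sum>J\<in>Q. wt q V J * of_bool (J \<union> U \<in> B v)) = (\<Sum>J\<in>B v. wt q V J * of_bool (U \<subseteq> J))"
      by simp
    then show "w f * (\<Sum>J\<in>Q. wt q V J * of_bool (J \<union> U \<in> B v)) = w f * (1 / q) ^ card U * (\<Sum>J\<in>B v. wt q V J * of_bool (U \<subseteq> J))"
      using q by (simp add: power_divide field_simps)
  qed
  also have "\<dots> = (\<Sum>v\<in>A. \<Sum>f\<in>{f\<in>\<Phi>. v \<in> e f}. \<Sum>U\<in>Pow (e f - {v}). w f * (1 / q) ^ card U * (\<Sum>J\<in>B v. wt q V J * of_bool (U \<subseteq> J)))"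
  proof -
    have "{v\<in>A. v \<in> e f} = e f" if "f \<in> \<Phi>" for f using e(1)[OF that] by blast
    then show ?thesis
      using sum.swap_restrict[OF \<Phi> fA, of "\<lambda>f v. \<Sum>U\<in>Pow (e f - {v}). w f * (1 / q) ^ card U * (\<Sum>J\<in>B v. wt q V J * of_bool (U \<subseteq> J))" "\<lambda>f v. v \<in> e f"]
      by (simp cong: sum.cong)
  qed
  also have "\<dots> = (\<Sum>v\<in>A. \<Sum>J\<in>B v. wt q V J * Y v J)"
  proof (intro sum.cong refl)
    fix v assume "v \<in> A"
    have "(\<Sum>f\<in>{f\<in>\<Phi>. v \<in> e f}. \<Sum>U\<in>Pow (e f - {v}). w f * (1 / q) ^ card U * (\<Sum>J\<in>B v. wt q V J * of_bool (U \<subseteq> J)))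
      = (\<Sum>(f, U)\<in>P v. w f * (1 / q) ^ card U * (\<Sum>J\<in>B v. wt q V J * of_bool (U \<subseteq> J)))"
      unfolding P_def using \<Phi> fe by (subst sum.Sigma) auto
    also have "\<dots> = (\<Sum>(f, U)\<in>P v. \<Sum>J\<in>B v. wt q V J * (w f * (1 / q) ^ card U * of_bool (U \<subseteq> J)))"
      unfolding sum_distrib_left by (simp add: mult_ac)
    also have "\<dots> = (\<Sum>J\<in>B v. wt q V J * Y v J)"
      unfolding Y_def sum_distrib_left case_prod_unfold by (subst sum.swap) simp
    finally show "(\<Sum>f\<in>{f\<in>\<Phi>. v \<in> e f}. \<Sum>U\<in>Pow (e f - {v}). w f * (1 / q) ^ card U * (\<Sum>J\<in>B v. wt q V J * of_bool (U \<subseteq> J)))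
      = (\<Sum>J\<in>B v. wt q V J * Y v J)" .
  qed
  finally have main: "Z \<le> (\<Sum>v\<in>A. \<Sum>J\<in>B v. wt q V J * Y v J)" .
  \<comment> \<open>\<open>L / N\<close> is the value of \<open>Y v J\<close> at which the two terms
    of the AM-GM inequality balance. Summed over \<open>A\<close>, the quadratic term gives at most
    \<open>Z / 2\<close> and the constant term at most \<open>\<delta> * L * Z / 2\<close>, together
    less than \<open>Z\<close>.\<close>
  define L where "L = 8 ^ r * K\<^sup>2"
  have L: "L > 0" "\<delta> * L < 1" unfolding L_def using K \<delta> by (simp_all add: mult_ac)
  have amgm: "y \<le> (N / L * y\<^sup>2 + L / N) / 2" for y :: real
  proof -
    have "0 \<le> N / L * (y - L / N)\<^sup>2" using N L by simp
    also have "\<dots> = N / L * y\<^sup>2 + L / N - 2 * y"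
      using N L by (simp add: power2_eq_square field_simps)
    finally show ?thesis by simp
  qed
  have "(\<Sum>J\<in>B v. wt q V J * Y v J) \<le> (Z / N + \<delta> * L * Z / N) / 2" if v: "v \<in> A" for v
  proof -
    have "(\<Sum>J\<in>B v. wt q V J * Y v J) \<le> (\<Sum>J\<in>B v. wt q V J * ((N / L * (Y v J)\<^sup>2 + L / N) / 2))"
      using amgm wt0 by (intro sum_mono mult_left_mono) auto
    also have "\<dots> = (N / L * (\<Sum>J\<in>B v. wt q V J * (Y v J)\<^sup>2) + L / N * (\<Sum>J\<in>B v. wt q V J)) / 2"
      by (simp add: sum_distrib_left sum_divide_distrib sum.distrib algebra_simps add_divide_distrib)
    also have "\<dots> \<le> (N / L * (Z * 8 ^ r * (K / N)\<^sup>2) + L / N * (\<delta> * Z)) / 2"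
    proof -
      have "(\<Sum>J\<in>B v. wt q V J * (Y v J)\<^sup>2) \<le> (\<Sum>J\<in>Q. wt q V J * (Y v J)\<^sup>2)"
        using fQ BQ wt0 by (intro sum_mono2) auto
      then have "(\<Sum>J\<in>B v. wt q V J * (Y v J)\<^sup>2) \<le> Z * 8 ^ r * (K / N)\<^sup>2" using h4[OF v] by simp
      moreover have "(\<Sum>J\<in>B v. wt q V J) \<le> \<delta> * Z" using h1 v A by blast
      ultimately show ?thesis using N L
        by (intro divide_right_mono add_mono mult_left_mono) auto
    qed
    also have "Z * 8 ^ r * (K / N)\<^sup>2 = Z * L / N\<^sup>2" by (simp add: L_def power_divide)
    also have "N / L * (Z * L / N\<^sup>2) = Z / N" using L N by (simp add: power2_eq_square)
    finally show ?thesis by (simp add: mult_ac)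
  qed
  then have "(\<Sum>v\<in>A. \<Sum>J\<in>B v. wt q V J * Y v J) \<le> (\<Sum>v\<in>A. (Z / N + \<delta> * L * Z / N) / 2)"
    by (intro sum_mono) auto
  also have "\<dots> = (Z + \<delta> * L * Z) / 2" using N by (simp add: N_def field_simps)
  also have "\<dots> < Z" using L Z by simp
  finally show False using main by simp
qed

text \<open>The invariant bounds the number of positive answers: the sum on the right is the probability of the
  current collection, at least \<open>(1 - q) ^ card C\<close> because the collection contains the empty family.\<close>
lemma containers:
  fixes \<F> :: "'v set set" and q \<delta> b :: real
  assumes q: "0 < q" "q < 1" and \<delta>: "\<delta> < 1" and b: "0 < b"
    and marg: "\<And>C Q. C \<subseteq> V \<Longrightarrow> b \<le> real (card C) \<Longrightarrow> Q \<subseteq> Pow C \<Longrightarrow> Q \<subseteq> \<F> \<Longrightarrow> {} \<in> Q \<Longrightarrow>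
      (\<And>J J'. J \<in> Q \<Longrightarrow> J' \<subseteq> J \<Longrightarrow> J' \<in> Q) \<Longrightarrow>
      \<exists>v\<in>C. (\<Sum>J\<in>{J\<in>Q. v \<in> J}. wt q C J) < (1 - \<delta>) * q * (\<Sum>J\<in>Q. wt q C J)"
    and down: "\<And>I J. I \<in> \<F> \<Longrightarrow> J \<subseteq> I \<Longrightarrow> J \<in> \<F>"
    and "finite C" "C \<subseteq> V"
  shows "\<exists>cont. (\<forall>I. I \<subseteq> C \<longrightarrow> S\<^sub>0 \<union> I \<in> \<F> \<longrightarrow> (\<exists>S\<subseteq>I. I \<subseteq> S \<union> cont S \<and>
    (1 - q) ^ card C \<le> (1 - \<delta>) ^ card S * (\<Sum>J\<in>{J\<in>Pow C. S\<^sub>0 \<union> J \<in> \<F>}. wt q C J))) \<and>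
    (\<forall>S. cont S \<subseteq> C \<and> card (cont S) < b)"
  using \<open>finite C\<close> \<open>C \<subseteq> V\<close>
proof (induction C arbitrary: S\<^sub>0 rule: finite_psubset_induct)
  case (psubset C)
  define Q where "Q = (\<lambda>C S\<^sub>0. {J\<in>Pow C. S\<^sub>0 \<union> J \<in> \<F>})"
  define Z where "Z = (\<lambda>C S\<^sub>0. \<Sum>J\<in>Q C S\<^sub>0. wt q C J)"
  have wt0: "0 \<le> wt q V J" for V J :: "'v set" using q by (simp add: wt_nonneg)
  have fQ: "finite (Q C S\<^sub>0)" for S\<^sub>0 unfolding Q_def using psubset.hyps by auto
  consider "S\<^sub>0 \<notin> \<F>" | "S\<^sub>0 \<in> \<F>" "card C < b" | "S\<^sub>0 \<in> \<F>" "b \<le> card C" by linarith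
  then show ?case
  proof cases
    case 1
    then have "S\<^sub>0 \<union> I \<notin> \<F>" for I using down[of "S\<^sub>0 \<union> I" "S\<^sub>0"] by auto
    \<comment> \<open>No member of \<open>\<F>\<close> contains \<open>S\<^sub>0\<close>, so the
      claim about \<open>I\<close> is vacuous; the empty container only has to meet the size
      bound.\<close>
    then show ?thesis using b by (intro exI[of _ "\<lambda>_. {}"]) auto
  next
    case 2
    have "(\<Sum>J\<in>{{}}. wt q C J) \<le> Z C S\<^sub>0"
      unfolding Z_def using wt0 fQ 2 by (intro sum_mono2) (auto simp: Q_def)
    then have "(1 - q) ^ card C \<le> Z C S\<^sub>0" by (simp add: wt_def)
    then show ?thesis using 2 by (intro exI[of _ "\<lambda>_. C"]) (auto simp: Z_def Q_def intro!: exI[of _ "{}"])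
  next
    case 3
    have "\<exists>v\<in>C. (\<Sum>J\<in>{J\<in>Q C S\<^sub>0. v \<in> J}. wt q C J) < (1 - \<delta>) * q * (\<Sum>J\<in>Q C S\<^sub>0. wt q C J)"
    proof (rule marg)
      show "Q C S\<^sub>0 \<subseteq> \<F>" unfolding Q_def using down by blast
      show "J' \<in> Q C S\<^sub>0" if "J \<in> Q C S\<^sub>0" "J' \<subseteq> J" for J J'
        using that down[of "S\<^sub>0 \<union> J" "S\<^sub>0 \<union> J'"] unfolding Q_def by auto
    qed (use 3 psubset.prems in \<open>auto simp: Q_def\<close>)
    then obtain v where v: "v \<in> C" and low: "(\<Sum>J\<in>{J\<in>Q C S\<^sub>0. v \<in> J}. wt q C J) < (1 - \<delta>) * q * Z C S\<^sub>0"
      unfolding Z_def by auto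
    let ?C = "C - {v}"
    have card: "card C = Suc (card ?C)" using v psubset.hyps by (metis card.remove)
    have fC: "finite J" if "J \<subseteq> C" for J using that psubset.hyps finite_subset by blast
    have "(\<Sum>J\<in>{J\<in>Q C S\<^sub>0. v \<in> J}. wt q C J) = (\<Sum>J\<in>Q ?C (insert v S\<^sub>0). q * wt q ?C J)"
    proof (rule sum.reindex_bij_witness[where i = "insert v" and j = "\<lambda>J. J - {v}"])
      fix J assume J: "J \<in> {J\<in>Q C S\<^sub>0. v \<in> J}"
      then have "S\<^sub>0 \<union> J = insert v S\<^sub>0 \<union> (J - {v})" by auto
      then show "J - {v} \<in> Q ?C (insert v S\<^sub>0)" using J by (auto simp: Q_def)
      have "card J = Suc (card (J - {v}))" using J fC by (intro card.remove) (auto simp: Q_def)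
      moreover have "C - {v} - (J - {v}) = C - J" using J by auto
      ultimately show "q * wt q ?C (J - {v}) = wt q C J" by (simp add: wt_def)
    next
      fix J assume J: "J \<in> Q ?C (insert v S\<^sub>0)"
      then show "insert v J - {v} = J" "insert v J \<in> {J\<in>Q C S\<^sub>0. v \<in> J}" using v by (auto simp: Q_def)
    qed auto
    then have "q * Z ?C (insert v S\<^sub>0) = (\<Sum>J\<in>{J\<in>Q C S\<^sub>0. v \<in> J}. wt q C J)"
      by (simp add: Z_def sum_distrib_left)
    with low have "q * Z ?C (insert v S\<^sub>0) < q * ((1 - \<delta>) * Z C S\<^sub>0)" by (simp add: mult_ac)
    \<comment> \<open>A positive answer: the marginal divided by \<open>q\<close> is the mass of the
      collection that survives on \<open>C - {v}\<close>, hence the factor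
      \<open>1 - \<delta>\<close>.\<close>
    then have Z1: "Z ?C (insert v S\<^sub>0) \<le> (1 - \<delta>) * Z C S\<^sub>0" using q by simp
    have "(1 - q) * Z ?C S\<^sub>0 = (\<Sum>J\<in>Q ?C S\<^sub>0. wt q C J)"
      unfolding Z_def sum_distrib_left
    proof (intro sum.cong refl)
      fix J assume J: "J \<in> Q ?C S\<^sub>0"
      then have "C - J = insert v (?C - J)" using v by (auto simp: Q_def)
      then have "card (C - J) = Suc (card (?C - J))" using psubset.hyps(1) by (simp only:) (subst card_insert_disjoint, auto)
      then show "(1 - q) * wt q ?C J = wt q C J" by (simp add: wt_def)
    qed
    also have "\<dots> \<le> Z C S\<^sub>0" unfolding Z_def using wt0 fQ by (intro sum_mono2) (auto simp: Q_def)
    \<comment> \<open>A negative answer can increase the mass by at most \<open>1 / (1 - q)\<close>,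
      and this is paid for by the exponent \<open>card C\<close> dropping by one.\<close>
    finally have Z0: "(1 - q) * Z ?C S\<^sub>0 \<le> Z C S\<^sub>0" .
    have "\<exists>cont. (\<forall>I. I \<subseteq> ?C \<longrightarrow> insert v S\<^sub>0 \<union> I \<in> \<F> \<longrightarrow> (\<exists>S\<subseteq>I. I \<subseteq> S \<union> cont S \<and>
        (1 - q) ^ card ?C \<le> (1 - \<delta>) ^ card S * Z ?C (insert v S\<^sub>0))) \<and> (\<forall>S. cont S \<subseteq> ?C \<and> card (cont S) < b)"
      unfolding Z_def Q_def by (rule psubset.IH) (use v psubset.prems in auto)
    then obtain c1 where c1: "\<forall>I. I \<subseteq> ?C \<longrightarrow> insert v S\<^sub>0 \<union> I \<in> \<F> \<longrightarrow> (\<exists>S\<subseteq>I. I \<subseteq> S \<union> c1 S \<and>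
        (1 - q) ^ card ?C \<le> (1 - \<delta>) ^ card S * Z ?C (insert v S\<^sub>0))"
      "\<forall>S. c1 S \<subseteq> ?C \<and> card (c1 S) < b"
      by (elim exE conjE)
    have "\<exists>cont. (\<forall>I. I \<subseteq> ?C \<longrightarrow> S\<^sub>0 \<union> I \<in> \<F> \<longrightarrow> (\<exists>S\<subseteq>I. I \<subseteq> S \<union> cont S \<and>
        (1 - q) ^ card ?C \<le> (1 - \<delta>) ^ card S * Z ?C (S\<^sub>0))) \<and> (\<forall>S. cont S \<subseteq> ?C \<and> card (cont S) < b)"
      unfolding Z_def Q_def by (rule psubset.IH) (use v psubset.prems in auto)
    then obtain c0 where c0: "\<forall>I. I \<subseteq> ?C \<longrightarrow> S\<^sub>0 \<union> I \<in> \<F> \<longrightarrow> (\<exists>S\<subseteq>I. I \<subseteq> S \<union> c0 S \<and>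
        (1 - q) ^ card ?C \<le> (1 - \<delta>) ^ card S * Z ?C (S\<^sub>0))"
      "\<forall>S. c0 S \<subseteq> ?C \<and> card (c0 S) < b"
      by (elim exE conjE)
    \<comment> \<open>The answer to the query about \<open>v\<close> can be read off from the
      fingerprint itself, so the container is a function of \<open>S\<close> alone.\<close>
    let ?cont = "\<lambda>S. if v \<in> S then c1 (S - {v}) else c0 S"
    have "\<exists>S\<subseteq>I. I \<subseteq> S \<union> ?cont S \<and> (1 - q) ^ card C \<le> (1 - \<delta>) ^ card S * Z C S\<^sub>0"
      if I: "I \<subseteq> C" "S\<^sub>0 \<union> I \<in> \<F>" for I
    proof (cases "v \<in> I")
      case True
      have "insert v S\<^sub>0 \<union> (I - {v}) = S\<^sub>0 \<union> I" using True by auto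
      then obtain S where S: "S \<subseteq> I - {v}" "I - {v} \<subseteq> S \<union> c1 S"
        "(1 - q) ^ card ?C \<le> (1 - \<delta>) ^ card S * Z ?C (insert v S\<^sub>0)"
        using c1(1)[rule_format, of "I - {v}"] I by auto
      have vS: "v \<notin> S" "S \<subseteq> C" "finite S" using S(1) I fC[of S] by auto
      have "(1 - q) ^ card C \<le> (1 - q) ^ card ?C" using card q by (intro power_decreasing) auto
      also have "\<dots> \<le> (1 - \<delta>) ^ card S * ((1 - \<delta>) * Z C S\<^sub>0)"
        using S(3) by (rule order_trans) (use Z1 \<delta> in \<open>intro mult_left_mono; simp\<close>)
      also have "\<dots> = (1 - \<delta>) ^ card (insert v S) * Z C S\<^sub>0" using vS by simp
      finally show ?thesis using S True vS by (intro exI[of _ "insert v S"]) auto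
    next
      case False
      then obtain S where S: "S \<subseteq> I" "I \<subseteq> S \<union> c0 S"
        "(1 - q) ^ card ?C \<le> (1 - \<delta>) ^ card S * Z ?C S\<^sub>0"
        using c0(1)[rule_format, of I] I by auto
      have "(1 - q) ^ card C \<le> (1 - q) * ((1 - \<delta>) ^ card S * Z ?C S\<^sub>0)"
        unfolding card using S(3) q by (simp add: mult_left_mono)
      also have "\<dots> = (1 - \<delta>) ^ card S * ((1 - q) * Z ?C S\<^sub>0)" by simp
      also have "\<dots> \<le> (1 - \<delta>) ^ card S * Z C S\<^sub>0" using Z0 \<delta> by (intro mult_left_mono) auto
      finally show ?thesis using S False by (intro exI[of _ S]) auto
    qed
    moreover have "?cont S \<subseteq> C" "card (?cont S) < b" for S
      using c0(2) c1(2) by auto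
    ultimately show ?thesis unfolding Z_def Q_def by (intro exI[of _ ?cont] conjI allI impI)
  qed
qed

text \<open>The initial collection has mass at most one, so
  \<open>(1 - q) ^ card V \<le> (1 - \<delta>) ^ card S\<close>. Comparing exponents, with
  \<open>exp (- 2 * q) \<le> 1 - q\<close> for \<open>q \<le> 1 / 2\<close>, bounds
  \<open>card S\<close> linearly in \<open>q * card V\<close>.\<close>

lemma containers_card:
  fixes \<F> :: "'v set set" and q \<delta> b :: real
  assumes q: "0 < q" "q \<le> 1 / 2" and \<delta>: "0 < \<delta>" "\<delta> < 1" and b: "0 < b"
    and marg: "\<And>C Q. C \<subseteq> V \<Longrightarrow> b \<le> real (card C) \<Longrightarrow> Q \<subseteq> Pow C \<Longrightarrow> Q \<subseteq> \<F> \<Longrightarrow> {} \<in> Q \<Longrightarrow>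
      (\<And>J J'. J \<in> Q \<Longrightarrow> J' \<subseteq> J \<Longrightarrow> J' \<in> Q) \<Longrightarrow>
      \<exists>v\<in>C. (\<Sum>J\<in>{J\<in>Q. v \<in> J}. wt q C J) < (1 - \<delta>) * q * (\<Sum>J\<in>Q. wt q C J)"
    and down: "\<And>I J. I \<in> \<F> \<Longrightarrow> J \<subseteq> I \<Longrightarrow> J \<in> \<F>"
    and V: "finite V"
  shows "\<exists>cont. (\<forall>I. I \<subseteq> V \<longrightarrow> I \<in> \<F> \<longrightarrow> (\<exists>S\<subseteq>I. I \<subseteq> S \<union> cont S \<and> real (card S) \<le> 2 * q * card V / \<delta>)) \<and>
    (\<forall>S. cont S \<subseteq> V \<and> card (cont S) < b)"
proof -
  have size: "real s \<le> 2 * q * card V / \<delta>" if "(1 - q) ^ card V \<le> (1 - \<delta>) ^ s" for s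
  proof -
    have "0 \<le> q * (1 - 2 * q)" using q by simp
    moreover have "(1 + 2 * q) * (1 - q) = 1 + q * (1 - 2 * q)" by (simp add: algebra_simps)
    ultimately have "1 \<le> (1 + 2 * q) * (1 - q)" by linarith
    also have "\<dots> \<le> exp (2 * q) * (1 - q)" using q exp_ge_add_one_self[of "2 * q"] by (intro mult_right_mono) auto
    finally have "exp (- 2 * q) \<le> 1 - q" by (simp add: exp_minus field_simps)
    then have "exp (- 2 * q) ^ card V \<le> (1 - q) ^ card V" by (intro power_mono) auto
    also note that
    also have "(1 - \<delta>) ^ s \<le> exp (- \<delta>) ^ s" using \<delta> exp_ge_add_one_self[of "- \<delta>"] by (intro power_mono) auto
    finally have "exp (- 2 * q * card V) \<le> exp (- \<delta> * s)" by (simp flip: exp_of_nat_mult add: mult_ac)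
    then show ?thesis using \<delta> by (simp add: field_simps)
  qed
  have bound: "real (card S) \<le> 2 * q * card V / \<delta>"
    if "(1 - q) ^ card V \<le> (1 - \<delta>) ^ card S * (\<Sum>J\<in>{J\<in>Pow V. {} \<union> J \<in> \<F>}. wt q V J)" for S :: "'v set"
  proof (rule size)
    have "(\<Sum>J\<in>{J\<in>Pow V. {} \<union> J \<in> \<F>}. wt q V J) \<le> (\<Sum>J\<in>Pow V. wt q V J)"
      using V q by (intro sum_mono2) (auto simp: wt_nonneg)
    then have "(\<Sum>J\<in>{J\<in>Pow V. {} \<union> J \<in> \<F>}. wt q V J) \<le> 1" using V by (simp add: sum_wt)
    then show "(1 - q) ^ card V \<le> (1 - \<delta>) ^ card S"
      by (intro order_trans[OF that] mult_left_le) (use \<delta> in auto)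
  qed
  have "\<exists>cont. (\<forall>I. I \<subseteq> V \<longrightarrow> {} \<union> I \<in> \<F> \<longrightarrow> (\<exists>S\<subseteq>I. I \<subseteq> S \<union> cont S \<and>
    (1 - q) ^ card V \<le> (1 - \<delta>) ^ card S * (\<Sum>J\<in>{J\<in>Pow V. {} \<union> J \<in> \<F>}. wt q V J))) \<and>
    (\<forall>S. cont S \<subseteq> V \<and> card (cont S) < b)"
    by (rule containers[where V = V, OF _ _ _ _ marg]) (use q \<delta> b V in \<open>auto intro: down\<close>)
  then obtain cont where cont: "\<And>I. I \<subseteq> V \<Longrightarrow> I \<in> \<F> \<Longrightarrow> \<exists>S\<subseteq>I. I \<subseteq> S \<union> cont S \<and>
    (1 - q) ^ card V \<le> (1 - \<delta>) ^ card S * (\<Sum>J\<in>{J\<in>Pow V. {} \<union> J \<in> \<F>}. wt q V J)"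
    "\<And>S. cont S \<subseteq> V \<and> card (cont S) < b"
    by auto
  show ?thesis
  proof (intro exI[of _ cont] conjI allI impI)
    fix I assume I: "I \<subseteq> V" "I \<in> \<F>"
    obtain S where "S \<subseteq> I" "I \<subseteq> S \<union> cont S"
      "(1 - q) ^ card V \<le> (1 - \<delta>) ^ card S * (\<Sum>J\<in>{J\<in>Pow V. {} \<union> J \<in> \<F>}. wt q V J)"
      using cont(1)[OF I] by blast
    then show "\<exists>S\<subseteq>I. I \<subseteq> S \<union> cont S \<and> real (card S) \<le> 2 * q * card V / \<delta>" using bound by auto
  qed (use cont(2) in auto)
qed

section \<open>Maximal chains through given sets\<close>

text \<open>A permutation stands for the maximal chain formed by its images of the initial segments
  \<open>{..<i}\<close>; \<open>fiber n x\<close> encodes the maximal chains through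
  \<open>x\<close>.\<close>

definition fiber :: "nat \<Rightarrow> nat set \<Rightarrow> (nat \<Rightarrow> nat) set" where
  "fiber n x = {\<pi>. \<pi> permutes {..<n} \<and> \<pi> ` {..<card x} = x}"

lemma permutes_moving_subset:
  assumes "finite S" "A \<subseteq> S" "A' \<subseteq> S" "card A = card A'"
  shows "\<exists>\<sigma>. \<sigma> permutes S \<and> \<sigma> ` A = A'"
proof -
  have fin: "finite A" "finite A'" using assms finite_subset by blast+
  obtain f where f: "bij_betw f A A'" using finite_same_card_bij[OF fin assms(4)] by blast
  have "card (S - A) = card (S - A')" using assms fin by (simp add: card_Diff_subset)
  then obtain g where g: "bij_betw g (S - A) (S - A')"
    using finite_same_card_bij[of "S - A" "S - A'"] assms(1) by blast
  define \<sigma> where "\<sigma> x = (if x \<in> A then f x else if x \<in> S then g x else x)" for x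
  have "bij_betw \<sigma> A A'" using f by (rule bij_betw_cong[THEN iffD1, rotated]) (simp add: \<sigma>_def)
  moreover have "bij_betw \<sigma> (S - A) (S - A')"
    using g by (rule bij_betw_cong[THEN iffD1, rotated]) (simp add: \<sigma>_def)
  ultimately have "bij_betw \<sigma> (A \<union> (S - A)) (A' \<union> (S - A'))" by (rule bij_betw_combine) auto
  then have "bij_betw \<sigma> S S" using assms(2,3) by (simp add: Un_absorb1)
  then have "\<sigma> permutes S" by (rule bij_imp_permutes) (use assms(2) in \<open>auto simp: \<sigma>_def\<close>)
  then show ?thesis using \<open>bij_betw \<sigma> A A'\<close> bij_betw_imp_surj_on by blast
qed

text \<open>Composition with \<open>\<sigma>\<close> is a bijection on the permutations of
  \<open>S\<close>. The chain counts below rest on this symmetry together with a double count, in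
  place of explicit factorial formulas.\<close>

lemma card_permutes_comp:
  assumes \<sigma>: "\<sigma> permutes S" and R: "\<And>\<pi>. \<pi> permutes S \<Longrightarrow> R \<pi> \<longleftrightarrow> R' (\<sigma> \<circ> \<pi>)"
  shows "card {\<pi>. \<pi> permutes S \<and> R \<pi>} = card {\<pi>. \<pi> permutes S \<and> R' \<pi>}"
proof (rule bij_betw_same_card)
  have inv: "\<sigma> \<circ> (inv \<sigma> \<circ> \<pi>) = \<pi>" "inv \<sigma> \<circ> (\<sigma> \<circ> \<pi>) = \<pi>" for \<pi>
    using permutes_surj[OF \<sigma>] permutes_inj[OF \<sigma>] by (auto simp: fun_eq_iff surj_f_inv_f)
  show "bij_betw (\<lambda>\<pi>. \<sigma> \<circ> \<pi>) {\<pi>. \<pi> permutes S \<and> R \<pi>} {\<pi>. \<pi> permutes S \<and> R' \<pi>}"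
    using R permutes_compose[OF _ \<sigma>] permutes_compose[OF _ permutes_inv[OF \<sigma>]]
    by (intro bij_betwI[where g = "\<lambda>\<pi>. inv \<sigma> \<circ> \<pi>"]) (auto simp: inv)
qed

lemma finite_fiber [simp]: "finite (fiber n x)"
  unfolding fiber_def by (rule finite_subset[OF _ finite_permutations[of "{..<n}"]]) auto

lemma card_image_permutes: "\<pi> permutes S \<Longrightarrow> card (\<pi> ` T) = card T"
  using permutes_inj_on card_image by blast

lemma image_permutes_subset: "\<pi> permutes {..<n::nat} \<Longrightarrow> i \<le> n \<Longrightarrow> \<pi> ` {..<i} \<subseteq> {..<n}"
  by (rule subset_trans[OF image_mono[of _ "{..<n}"]]) (simp_all add: permutes_image)

lemma permutes_comp_image_eq_iff:
  assumes "\<sigma> permutes S" "\<sigma> ` z = y"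
  shows "(\<sigma> \<circ> \<pi>) ` T = y \<longleftrightarrow> \<pi> ` T = z"
  using inj_image_eq_iff[OF permutes_inj[OF assms(1)], of "\<pi> ` T" z] assms(2)
  by (simp only: image_comp[symmetric])

lemma permutes_comp_mem_image_iff:
  assumes "\<sigma> permutes S" "\<sigma> b = a"
  shows "a \<in> (\<sigma> \<circ> \<pi>) ` T \<longleftrightarrow> b \<in> \<pi> ` T"
  using inj_image_mem_iff[OF permutes_inj[OF assms(1)], of b "\<pi> ` T"] assms(2)
  by (simp only: image_comp[symmetric])

text \<open>A maximal chain has exactly one set of each size, and the fibers over the sets of size
  \<open>card x\<close> are equally large by symmetry.\<close>

lemma card_fiber:
  assumes x: "x \<subseteq> {..<n}"
  shows "card (fiber n x) * (n choose card x) = fact n"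
proof -
  let ?X = "{y. y \<subseteq> {..<n} \<and> card y = card x}"
  have cx: "card x \<le> n" using x by (metis card_lessThan card_mono finite_lessThan)
  have eq: "card (fiber n y) = card (fiber n x)" if y: "y \<in> ?X" for y
  proof -
    obtain \<sigma> where \<sigma>: "\<sigma> permutes {..<n}" "\<sigma> ` y = x"
      using permutes_moving_subset[of "{..<n}" y x] y x by auto
    show ?thesis unfolding fiber_def
    proof (rule card_permutes_comp[OF \<sigma>(1)])
      fix \<pi> assume "\<pi> permutes {..<n}"
      show "(\<pi> ` {..<card y} = y) = ((\<sigma> \<circ> \<pi>) ` {..<card x} = x)"
        using y by (simp only: permutes_comp_image_eq_iff[OF \<sigma>] mem_Collect_eq)
    qed
  qed
  have "{\<pi>. \<pi> permutes {..<n}} = (\<Union>y\<in>?X. fiber n y)"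
    using cx permutes_in_image[of _ "{..<n}"] by (auto simp: fiber_def card_image_permutes)
  then have "fact n = card (\<Union>y\<in>?X. fiber n y)"
    using card_permutations[of "{..<n}" n] by simp
  also have "\<dots> = (\<Sum>y\<in>?X. card (fiber n y))"
    by (rule card_UN_disjoint) (simp_all, auto simp: fiber_def)
  also have "\<dots> = card ?X * card (fiber n x)"
    by (subst sum.cong[OF refl eq]) simp_all
  also have "card ?X = n choose card x" using n_subsets[of "{..<n}" "card x"] by simp
  finally show ?thesis by simp
qed

text \<open>By symmetry, a random maximal chain through \<open>x\<close> is equally likely to pass
  through each superset of size \<open>card y\<close>. These events are disjoint, so each has
  probability at most the reciprocal of their number.\<close>

lemma card_fiber_pair:
  assumes x: "x \<subseteq> y" and y: "y \<subseteq> {..<n}"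
  shows "card (fiber n x \<inter> fiber n y) * ((n - card x) choose (card y - card x)) \<le> card (fiber n x)"
proof -
  let ?X = "{z. z \<subseteq> {..<n} - x \<and> card z = card (y - x)}"
  have fy: "finite y" using finite_subset[OF y] by simp
  then have fx: "finite x" using finite_subset[OF x] by simp
  have cz: "card (x \<union> z) = card y" if "z \<in> ?X" for z
  proof -
    have "finite z" using that finite_subset[of z "{..<n} - x"] by simp
    moreover have "x \<inter> z = {}" using that by blast
    ultimately show ?thesis using that fy fx x by (simp add: card_Un_disjoint card_Diff_subset card_mono)
  qed
  have eq: "card (fiber n x \<inter> fiber n (x \<union> z)) = card (fiber n x \<inter> fiber n y)" if z: "z \<in> ?X" for z
  proof -
    obtain \<sigma> where \<sigma>: "\<sigma> permutes ({..<n} - x)" "\<sigma> ` z = y - x"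
      using permutes_moving_subset[of "{..<n} - x" z "y - x"] z y by auto
    have \<sigma>': "\<sigma> permutes {..<n}" using \<sigma>(1) permutes_subset by blast
    have "\<sigma> a = a" if "a \<in> x" for a using \<sigma>(1) that by (auto simp: permutes_def)
    then have \<sigma>x: "\<sigma> ` x = x" by force
    then have \<sigma>y: "\<sigma> ` (x \<union> z) = y" using \<sigma>(2) x by (auto simp: image_Un)
    have "card {\<pi>. \<pi> permutes {..<n} \<and> \<pi> ` {..<card x} = x \<and> \<pi> ` {..<card y} = x \<union> z}
      = card {\<pi>. \<pi> permutes {..<n} \<and> \<pi> ` {..<card x} = x \<and> \<pi> ` {..<card y} = y}"
    proof (rule card_permutes_comp[OF \<sigma>'])
      fix \<pi> assume "\<pi> permutes {..<n}"
      show "(\<pi> ` {..<card x} = x \<and> \<pi> ` {..<card y} = x \<union> z)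
        = ((\<sigma> \<circ> \<pi>) ` {..<card x} = x \<and> (\<sigma> \<circ> \<pi>) ` {..<card y} = y)"
        by (simp only: permutes_comp_image_eq_iff[OF \<sigma>' \<sigma>x] permutes_comp_image_eq_iff[OF \<sigma>' \<sigma>y])
    qed
    then show ?thesis using cz[OF z] by (simp add: fiber_def Int_def conj_ac cong: conj_cong)
  qed
  have "card (fiber n x) \<ge> card (\<Union>z\<in>?X. fiber n x \<inter> fiber n (x \<union> z))"
    by (rule card_mono) auto
  also have "card (\<Union>z\<in>?X. fiber n x \<inter> fiber n (x \<union> z)) = (\<Sum>z\<in>?X. card (fiber n x \<inter> fiber n (x \<union> z)))"
  proof (rule card_UN_disjoint)
    show "\<forall>z\<in>?X. \<forall>z'\<in>?X. z \<noteq> z' \<longrightarrow> (fiber n x \<inter> fiber n (x \<union> z)) \<inter> (fiber n x \<inter> fiber n (x \<union> z')) = {}"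
    proof (intro ballI impI, rule ccontr)
      fix z z' assume z: "z \<in> ?X" "z' \<in> ?X" "z \<noteq> z'"
        and "(fiber n x \<inter> fiber n (x \<union> z)) \<inter> (fiber n x \<inter> fiber n (x \<union> z')) \<noteq> {}"
      then have "x \<union> z = x \<union> z'" using cz by (auto simp: fiber_def)
      then show False using z by blast
    qed
  qed auto
  also have "\<dots> = card ?X * card (fiber n x \<inter> fiber n y)"
    by (subst sum.cong[OF refl eq]) simp_all
  also have "card ?X = (n - card x) choose (card y - card x)"
    using n_subsets[of "{..<n} - x" "card (y - x)"] fx x y by (simp add: card_Diff_subset Diff_mono)
  finally show ?thesis by (simp add: mult.commute)
qed

text \<open>At level \<open>h\<close> a chain through \<open>x\<close> has acquired
  \<open>h - card x\<close> of the \<open>n - card x\<close> outside elements, each of them equally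
  often by symmetry.\<close>

lemma card_fiber_above:
  assumes x: "x \<subseteq> {..<n}" and a: "a < n" "a \<notin> x" and h: "card x \<le> h" "h \<le> n"
  shows "card {\<pi>\<in>fiber n x. a \<in> \<pi> ` {..<h}} * (n - card x) = (h - card x) * card (fiber n x)"
proof -
  let ?A = "{..<n} - x"
  have fx: "finite x" using x finite_subset by blast
  have eq: "card {\<pi>\<in>fiber n x. b \<in> \<pi> ` {..<h}} = card {\<pi>\<in>fiber n x. a \<in> \<pi> ` {..<h}}" if b: "b \<in> ?A" for b
  proof -
    obtain \<sigma> where \<sigma>: "\<sigma> permutes ?A" "\<sigma> ` {b} = {a}"
      using permutes_moving_subset[of ?A "{b}" "{a}"] b a by auto
    have \<sigma>': "\<sigma> permutes {..<n}" using \<sigma>(1) permutes_subset by blast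
    have "\<sigma> c = c" if "c \<in> x" for c using \<sigma>(1) that by (auto simp: permutes_def)
    then have \<sigma>x: "\<sigma> ` x = x" by force
    have "card {\<pi>. \<pi> permutes {..<n} \<and> \<pi> ` {..<card x} = x \<and> b \<in> \<pi> ` {..<h}}
      = card {\<pi>. \<pi> permutes {..<n} \<and> \<pi> ` {..<card x} = x \<and> a \<in> \<pi> ` {..<h}}"
    proof (rule card_permutes_comp[OF \<sigma>'])
      fix \<pi> assume "\<pi> permutes {..<n}"
      have "a \<in> (\<sigma> \<circ> \<pi>) ` {..<h} \<longleftrightarrow> b \<in> \<pi> ` {..<h}"
        using \<sigma>(2) by (intro permutes_comp_mem_image_iff[OF \<sigma>']) simp
      moreover have "(\<sigma> \<circ> \<pi>) ` {..<card x} = x \<longleftrightarrow> \<pi> ` {..<card x} = x"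
        by (rule permutes_comp_image_eq_iff[OF \<sigma>' \<sigma>x])
      ultimately show "(\<pi> ` {..<card x} = x \<and> b \<in> \<pi> ` {..<h})
        = ((\<sigma> \<circ> \<pi>) ` {..<card x} = x \<and> a \<in> (\<sigma> \<circ> \<pi>) ` {..<h})" by simp
    qed
    then show ?thesis by (simp add: fiber_def conj_assoc)
  qed
  have cnt: "card {b\<in>?A. b \<in> \<pi> ` {..<h}} = h - card x" if \<pi>: "\<pi> \<in> fiber n x" for \<pi>
  proof -
    have p: "\<pi> permutes {..<n}" "\<pi> ` {..<card x} = x" using \<pi> by (auto simp: fiber_def)
    have "x \<subseteq> \<pi> ` {..<h}" using p(2) h image_mono[of "{..<card x}" "{..<h}" \<pi>] by (simp only: lessThan_subset_iff)
    moreover have "{b\<in>?A. b \<in> \<pi> ` {..<h}} = \<pi> ` {..<h} - x"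
      using image_permutes_subset[OF p(1) h(2)] by auto
    ultimately show ?thesis using fx by (simp add: card_Diff_subset card_image_permutes[OF p(1)])
  qed
  have "(\<Sum>b\<in>?A. card {\<pi>\<in>fiber n x. b \<in> \<pi> ` {..<h}}) = (\<Sum>\<pi>\<in>fiber n x. card {b\<in>?A. b \<in> \<pi> ` {..<h}})"
    using sum.swap_restrict[of ?A "fiber n x" "\<lambda>_ _. 1::nat" "\<lambda>b \<pi>. b \<in> \<pi> ` {..<h}"] by simp
  also have "\<dots> = (h - card x) * card (fiber n x)" using cnt by simp
  also have "(\<Sum>b\<in>?A. card {\<pi>\<in>fiber n x. b \<in> \<pi> ` {..<h}}) = card {\<pi>\<in>fiber n x. a \<in> \<pi> ` {..<h}} * (n - card x)"
    using fx x by (subst sum.cong[OF refl eq]) (simp_all add: card_Diff_subset mult.commute)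
  finally show ?thesis .
qed

text \<open>The dual count: between level \<open>l\<close> and \<open>y\<close> a chain acquires
  \<open>card y - l\<close> of the elements of \<open>y\<close>, each equally often.\<close>

lemma card_fiber_below:
  assumes y: "y \<subseteq> {..<n}" and a: "a \<in> y" and l: "l \<le> card y"
  shows "card {\<pi>\<in>fiber n y. a \<notin> \<pi> ` {..<l}} * card y = (card y - l) * card (fiber n y)"
proof -
  have fy: "finite y" using y finite_subset by blast
  have cy: "card y \<le> n" using y by (metis card_lessThan card_mono finite_lessThan)
  have eq: "card {\<pi>\<in>fiber n y. b \<notin> \<pi> ` {..<l}} = card {\<pi>\<in>fiber n y. a \<notin> \<pi> ` {..<l}}" if b: "b \<in> y" for b
  proof -
    obtain \<sigma> where \<sigma>: "\<sigma> permutes y" "\<sigma> ` {b} = {a}"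
      using permutes_moving_subset[of y "{b}" "{a}"] b a fy by auto
    have \<sigma>': "\<sigma> permutes {..<n}" using \<sigma>(1) y permutes_subset by blast
    have \<sigma>y: "\<sigma> ` y = y" using permutes_image[OF \<sigma>(1)] .
    have "card {\<pi>. \<pi> permutes {..<n} \<and> \<pi> ` {..<card y} = y \<and> b \<notin> \<pi> ` {..<l}}
      = card {\<pi>. \<pi> permutes {..<n} \<and> \<pi> ` {..<card y} = y \<and> a \<notin> \<pi> ` {..<l}}"
    proof (rule card_permutes_comp[OF \<sigma>'])
      fix \<pi> assume "\<pi> permutes {..<n}"
      have "a \<in> (\<sigma> \<circ> \<pi>) ` {..<l} \<longleftrightarrow> b \<in> \<pi> ` {..<l}"
        using \<sigma>(2) by (intro permutes_comp_mem_image_iff[OF \<sigma>']) simp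
      moreover have "(\<sigma> \<circ> \<pi>) ` {..<card y} = y \<longleftrightarrow> \<pi> ` {..<card y} = y"
        by (rule permutes_comp_image_eq_iff[OF \<sigma>' \<sigma>y])
      ultimately show "(\<pi> ` {..<card y} = y \<and> b \<notin> \<pi> ` {..<l})
        = ((\<sigma> \<circ> \<pi>) ` {..<card y} = y \<and> a \<notin> (\<sigma> \<circ> \<pi>) ` {..<l})" by simp
    qed
    then show ?thesis by (simp add: fiber_def conj_assoc)
  qed
  have cnt: "card {b\<in>y. b \<notin> \<pi> ` {..<l}} = card y - l" if \<pi>: "\<pi> \<in> fiber n y" for \<pi>
  proof -
    have p: "\<pi> permutes {..<n}" "\<pi> ` {..<card y} = y" using \<pi> by (auto simp: fiber_def)
    have "\<pi> ` {..<l} \<subseteq> y" using p(2) l image_mono[of "{..<l}" "{..<card y}" \<pi>] by (simp only: lessThan_subset_iff)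
    moreover have "{b\<in>y. b \<notin> \<pi> ` {..<l}} = y - \<pi> ` {..<l}" by auto
    ultimately show ?thesis using fy by (simp add: card_Diff_subset card_image_permutes[OF p(1)])
  qed
  have "(\<Sum>b\<in>y. card {\<pi>\<in>fiber n y. b \<notin> \<pi> ` {..<l}}) = (\<Sum>\<pi>\<in>fiber n y. card {b\<in>y. b \<notin> \<pi> ` {..<l}})"
    using sum.swap_restrict[of y "fiber n y" "\<lambda>_ _. 1::nat" "\<lambda>b \<pi>. b \<notin> \<pi> ` {..<l}"] fy by simp
  also have "\<dots> = (card y - l) * card (fiber n y)" using cnt by simp
  also have "(\<Sum>b\<in>y. card {\<pi>\<in>fiber n y. b \<notin> \<pi> ` {..<l}}) = card {\<pi>\<in>fiber n y. a \<notin> \<pi> ` {..<l}} * card y"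
    by (subst sum.cong[OF refl eq]) (simp_all add: mult.commute)
  finally show ?thesis .
qed

section \<open>Tree posets\<close>

lemma is_poset_dual: "is_poset X le \<Longrightarrow> is_poset X (\<lambda>x y. le y x)"
  unfolding is_poset_def by blast

lemma is_poset_subset: "is_poset X le \<Longrightarrow> Y \<subseteq> X \<Longrightarrow> is_poset Y le"
  unfolding is_poset_def by (meson finite_subset subsetD)

lemma covers_dual: "covers X (\<lambda>x y. le y x) x y \<longleftrightarrow> covers X le y x"
  unfolding covers_def by blast

text \<open>Among the elements above \<open>x\<close> and strictly below \<open>y\<close>, take one
  with the most elements under it; anything strictly between it and \<open>y\<close> would have
  more.\<close>

lemma lower_cover_exists:
  assumes po: "is_poset X le" and xy: "x \<in> X" "y \<in> X" "le x y" "x \<noteq> y"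
  shows "\<exists>z. covers X le z y \<and> le x z"
proof -
  have fin: "finite X" and refl: "\<And>x. x \<in> X \<Longrightarrow> le x x"
    and antisym: "\<And>x y. x \<in> X \<Longrightarrow> y \<in> X \<Longrightarrow> le x y \<Longrightarrow> le y x \<Longrightarrow> x = y"
    and trans: "\<And>x y z. x \<in> X \<Longrightarrow> y \<in> X \<Longrightarrow> z \<in> X \<Longrightarrow> le x y \<Longrightarrow> le y z \<Longrightarrow> le x z"
    using po unfolding is_poset_def by blast+
  let ?B = "{z\<in>X. le x z \<and> le z y \<and> z \<noteq> y}"
  let ?d = "\<lambda>z. card {w\<in>X. le w z}"
  have "finite ?B" "x \<in> ?B" using fin xy refl by auto
  then have B: "finite (?d ` ?B)" "?d ` ?B \<noteq> {}" by blast+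
  from Max_in[OF B] obtain z where max: "Max (?d ` ?B) = ?d z" and z1: "z \<in> ?B" by (rule imageE)
  have z2: "?d w \<le> ?d z" if "w \<in> ?B" for w
    using Max_ge[OF B(1) imageI[OF that]] unfolding max .
  note z = z1 z2
  have "\<not> (\<exists>w\<in>X. le z w \<and> le w y \<and> w \<noteq> z \<and> w \<noteq> y)"
  proof
    assume "\<exists>w\<in>X. le z w \<and> le w y \<and> w \<noteq> z \<and> w \<noteq> y"
    then obtain w where w: "w \<in> X" "le z w" "le w y" "w \<noteq> z" "w \<noteq> y" by blast
    have zX: "z \<in> X" "le x z" using z(1) by auto
    have "w \<in> ?B" using w zX trans[of x z w] xy by auto
    moreover have "{u\<in>X. le u z} \<subset> {u\<in>X. le u w}"
    proof
      show "{u\<in>X. le u z} \<subseteq> {u\<in>X. le u w}" using w zX trans by blast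
      have "w \<notin> {u\<in>X. le u z}" using antisym[of w z] w zX by auto
      then show "{u\<in>X. le u z} \<noteq> {u\<in>X. le u w}" using refl[OF w(1)] w(1) by blast
    qed
    then have "?d z < ?d w" using fin by (intro psubset_card_mono) auto
    ultimately show False using z(2)[of w] by simp
  qed
  then have "covers X le z y" unfolding covers_def using z(1) xy by blast
  then show ?thesis using z(1) by blast
qed

lemma upper_cover_exists:
  assumes "is_poset X le" "x \<in> X" "y \<in> X" "le x y" "x \<noteq> y"
  shows "\<exists>z. covers X le x z \<and> le z y"
proof -
  have "\<exists>z. covers X (\<lambda>x y. le y x) z x \<and> le z y"
    by (rule lower_cover_exists[OF is_poset_dual[OF assms(1)] assms(3,2)]) (use assms(4,5) in auto)
  then show ?thesis unfolding covers_dual[of X le] .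
qed

text \<open>Handshaking: degrees of at least two everywhere would give a degree sum of at least
  \<open>2 * card X\<close>, but it equals \<open>2 * (card X - 1)\<close>. Connectedness excludes
  degree zero.\<close>

lemma tree_poset_leaf:
  assumes tree: "is_tree_poset X le" and card: "2 \<le> card X"
  shows "\<exists>v b. v \<in> X \<and> b \<in> X \<and> hasse_adj X le v b \<and> (\<forall>u. hasse_adj X le v u \<longrightarrow> u = b)"
proof -
  let ?E = "hasse_edges X le"
  have po: "is_poset X le" and conn: "\<And>x y. x \<in> X \<Longrightarrow> y \<in> X \<Longrightarrow> (hasse_adj X le)\<^sup>*\<^sup>* x y"
    and cE: "card ?E = card X - 1"
    using tree unfolding is_tree_poset_def by blast+
  have fin: "finite X" using po unfolding is_poset_def by blast
  have "?E \<subseteq> Pow X" unfolding hasse_edges_def covers_def by auto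
  then have fE: "finite ?E" using fin by (simp add: finite_subset)
  have c2: "card e = 2" "e \<subseteq> X" if "e \<in> ?E" for e
    using that unfolding hasse_edges_def covers_def by auto
  have adj_edge: "hasse_adj X le v u \<longleftrightarrow> {v, u} \<in> ?E" for v u
    unfolding hasse_adj_def hasse_edges_def by (auto simp: doubleton_eq_iff)
  have pos: "1 \<le> card {e\<in>?E. v \<in> e}" if v: "v \<in> X" for v
  proof -
    have "X \<noteq> {v}" using card by auto
    then obtain y where y: "y \<in> X" "y \<noteq> v" using v by auto
    from conn[OF v y(1)] obtain u where "hasse_adj X le v u"
      using y(2) by (metis converse_rtranclpE)
    then have "{v, u} \<in> {e\<in>?E. v \<in> e}" using adj_edge by auto
    then have "{e\<in>?E. v \<in> e} \<noteq> {}" by blast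
    then show ?thesis using fE by (simp add: Suc_le_eq card_gt_0_iff)
  qed
  have "\<exists>v\<in>X. card {e\<in>?E. v \<in> e} < 2"
  proof (rule ccontr)
    assume "\<not> ?thesis"
    then have "(\<Sum>v\<in>X. 2) \<le> (\<Sum>v\<in>X. card {e\<in>?E. v \<in> e})" by (intro sum_mono) force
    also have "\<dots> = (\<Sum>e\<in>?E. card {v\<in>X. v \<in> e})"
      using sum.swap_restrict[OF fin fE, of "\<lambda>_ _. 1::nat" "\<lambda>v e. v \<in> e"] by simp
    also have "\<dots> = (\<Sum>e\<in>?E. 2)"
    proof (rule sum.cong[OF refl])
      fix e assume "e \<in> ?E"
      moreover from this have "{v\<in>X. v \<in> e} = e" using c2(2) by blast
      ultimately show "card {v\<in>X. v \<in> e} = 2" using c2(1) by simp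
    qed
    also have "\<dots> = 2 * (card X - 1)" using cE by simp
    finally show False using card by simp
  qed
  then obtain v where v: "v \<in> X" "card {e\<in>?E. v \<in> e} = 1" using pos by force
  then obtain e where e: "{e\<in>?E. v \<in> e} = {e}" by (auto simp: card_1_singleton_iff)
  have ve: "e \<in> ?E" "v \<in> e" using e by auto
  then obtain b where b: "e = {v, b}" "b \<noteq> v" using c2(1)[of e] unfolding card_2_iff by auto
  have "u = b" if "hasse_adj X le v u" for u
  proof -
    have "{v, u} \<in> {e\<in>?E. v \<in> e}" using that adj_edge by auto
    then have "{v, u} = {v, b}" using e b by auto
    then show ?thesis using b(2) by (auto simp: doubleton_eq_iff)
  qed
  moreover have "hasse_adj X le v b" "b \<in> X" using ve b adj_edge c2(2)[OF ve(1)] by auto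
  ultimately show ?thesis using v(1) by blast
qed

text \<open>The disjunction says that a leaf \<open>v\<close> is comparable to the rest only through
  its neighbour \<open>b\<close>, and only on the side of \<open>b\<close>. This is what later
  allows the image of \<open>v\<close> to be chosen from the image of \<open>b\<close>
  alone.\<close>

lemma tree_poset_remove_leaf:
  assumes tree: "is_tree_poset X le" and card: "2 \<le> card X"
  shows "\<exists>v b. v \<in> X \<and> b \<in> X \<and> b \<noteq> v \<and> is_tree_poset (X - {v}) le \<and>
    ((le b v \<and> (\<forall>u\<in>X - {v}. (le u v \<longrightarrow> le u b) \<and> \<not> le v u)) \<or>
     (le v b \<and> (\<forall>u\<in>X - {v}. (le v u \<longrightarrow> le b u) \<and> \<not> le u v)))"
proof -
  obtain v b where vb: "v \<in> X" "b \<in> X" "hasse_adj X le v b" "\<And>u. hasse_adj X le v u \<Longrightarrow> u = b"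
    using tree_poset_leaf[OF assms] by blast
  have po: "is_poset X le" and conn: "\<And>x y. x \<in> X \<Longrightarrow> y \<in> X \<Longrightarrow> (hasse_adj X le)\<^sup>*\<^sup>* x y"
    and cE: "card (hasse_edges X le) = card X - 1"
    using tree unfolding is_tree_poset_def by blast+
  have fin: "finite X" and refl: "\<And>x. x \<in> X \<Longrightarrow> le x x"
    and antisym: "\<And>x y. x \<in> X \<Longrightarrow> y \<in> X \<Longrightarrow> le x y \<Longrightarrow> le y x \<Longrightarrow> x = y"
    using po unfolding is_poset_def by blast+
  let ?X = "X - {v}"
  have bv: "b \<noteq> v" using vb(3) unfolding hasse_adj_def covers_def by auto
  have low: "covers X le b v \<and> le u b" if "u \<in> ?X" "le u v" for u
  proof -
    have "\<exists>z. covers X le z v \<and> le u z" using that vb(1) by (intro lower_cover_exists[OF po]) auto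
    then obtain z where "covers X le z v" "le u z" by blast
    then show ?thesis using vb(4)[of z] unfolding hasse_adj_def by auto
  qed
  have up: "covers X le v b \<and> le b u" if "u \<in> ?X" "le v u" for u
  proof -
    have "\<exists>z. covers X le v z \<and> le z u" using that vb(1) by (intro upper_cover_exists[OF po]) auto
    then obtain z where "covers X le v z" "le z u" by blast
    then show ?thesis using vb(4)[of z] unfolding hasse_adj_def by auto
  qed
  have notboth: "\<not> (covers X le v b \<and> covers X le b v)"
    using antisym[of v b] bv vb(1,2) unfolding covers_def by auto
  \<comment> \<open>Deleting \<open>v\<close> creates no new cover: elements on both sides of
    \<open>v\<close> would make \<open>b\<close> both an upper and a lower cover of
    \<open>v\<close>.\<close>
  have cov: "covers ?X le x y \<longleftrightarrow> covers X le x y \<and> x \<noteq> v \<and> y \<noteq> v" for x y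
  proof
    assume c: "covers ?X le x y"
    have "\<not> (le x v \<and> le v y)" using low[of x] up[of y] notboth c unfolding covers_def by blast
    then show "covers X le x y \<and> x \<noteq> v \<and> y \<noteq> v" using c unfolding covers_def by blast
  qed (auto simp: covers_def)
  have adj: "hasse_adj ?X le x y \<longleftrightarrow> hasse_adj X le x y \<and> x \<noteq> v \<and> y \<noteq> v" for x y
    unfolding hasse_adj_def cov by blast
  have sym: "hasse_adj X le x y \<Longrightarrow> hasse_adj X le y x" for x y unfolding hasse_adj_def by blast
  \<comment> \<open>A walk may pass through \<open>v\<close>, but it enters and leaves by
    \<open>b\<close>; reading \<open>v\<close> as \<open>b\<close> turns it into a walk in
    \<open>X - {v}\<close>.\<close>
  have path: "(hasse_adj ?X le)\<^sup>*\<^sup>* x (if y = v then b else y)" if "(hasse_adj X le)\<^sup>*\<^sup>* x y" "x \<noteq> v" for x y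
    using that
  proof (induction rule: rtranclp_induct)
    case (step y z)
    have s: "(hasse_adj ?X le)\<^sup>*\<^sup>* x (if y = v then b else y)" using step by blast
    consider "y = v" | "z = v" "y \<noteq> v" | "y \<noteq> v" "z \<noteq> v" by blast
    then show ?case
    proof cases
      case 1
      then have "z = b" using step.hyps(2) vb(4) by simp
      then show ?thesis using s 1 bv by simp
    next
      case 2
      then have "y = b" using sym[OF step.hyps(2)] vb(4) by simp
      then show ?thesis using s 2 by simp
    next
      case 3
      then have "(hasse_adj ?X le)\<^sup>*\<^sup>* x y" "hasse_adj ?X le y z" using s adj step.hyps(2) by simp_all
      then show ?thesis using 3 rtranclp.rtrancl_into_rtrancl[of "hasse_adj ?X le" x y z] by simp
    qed
  qed auto
  have "hasse_edges ?X le = hasse_edges X le - {{v, b}}"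
  proof (intro equalityI subsetI)
    fix e assume "e \<in> hasse_edges ?X le"
    then obtain x y where e: "e = {x, y}" "covers X le x y" "x \<noteq> v" "y \<noteq> v"
      unfolding hasse_edges_def cov by blast
    then have "v \<notin> e" by simp
    then have "e \<noteq> {v, b}" by blast
    moreover have "e \<in> hasse_edges X le" using e(1,2) unfolding hasse_edges_def by blast
    ultimately show "e \<in> hasse_edges X le - {{v, b}}" by simp
  next
    fix e assume "e \<in> hasse_edges X le - {{v, b}}"
    then obtain x y where e: "e = {x, y}" "covers X le x y" "{x, y} \<noteq> {v, b}"
      unfolding hasse_edges_def by blast
    have "x \<noteq> v"
    proof
      assume "x = v"
      then have "y = b" using e(2) vb(4)[of y] unfolding hasse_adj_def by blast
      then show False using e(3) \<open>x = v\<close> by simp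
    qed
    moreover have "y \<noteq> v"
    proof
      assume "y = v"
      then have "x = b" using e(2) vb(4)[of x] unfolding hasse_adj_def by blast
      then show False using e(3) \<open>y = v\<close> by (simp add: insert_commute)
    qed
    ultimately show "e \<in> hasse_edges ?X le" using e(1,2) unfolding hasse_edges_def cov by blast
  qed
  moreover have "{v, b} \<in> hasse_edges X le"
  proof (cases "covers X le v b")
    case True
    then show ?thesis unfolding hasse_edges_def by blast
  next
    case False
    then have "covers X le b v" using vb(3) unfolding hasse_adj_def by blast
    then have "{b, v} \<in> hasse_edges X le" unfolding hasse_edges_def by blast
    then show ?thesis by (simp add: insert_commute)
  qed
  ultimately have "card (hasse_edges ?X le) = card ?X - 1" using cE vb(1) by simp
  moreover have "?X \<noteq> {}" using vb(2) bv by auto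
  moreover have "(hasse_adj ?X le)\<^sup>*\<^sup>* x y" if "x \<in> ?X" "y \<in> ?X" for x y
    using path[OF conn[of x y]] that by auto
  ultimately have tree': "is_tree_poset ?X le"
    unfolding is_tree_poset_def using is_poset_subset[OF po] by blast
  have "(le b v \<and> (\<forall>u\<in>?X. (le u v \<longrightarrow> le u b) \<and> \<not> le v u)) \<or>
    (le v b \<and> (\<forall>u\<in>?X. (le v u \<longrightarrow> le b u) \<and> \<not> le u v))"
  proof (cases "covers X le v b")
    case True
    then have "le v b" unfolding covers_def by blast
    moreover have "(le v u \<longrightarrow> le b u) \<and> \<not> le u v" if "u \<in> ?X" for u
      using low[OF that] up[OF that] notboth True by blast
    ultimately show ?thesis by blast
  next
    case False
    then have c: "covers X le b v" using vb(3) unfolding hasse_adj_def by blast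
    then have "le b v" unfolding covers_def by blast
    moreover have "(le u v \<longrightarrow> le u b) \<and> \<not> le v u" if "u \<in> ?X" for u
      using low[OF that] up[OF that] notboth c by blast
    ultimately show ?thesis by blast
  qed
  then show ?thesis using vb(1,2) bv tree' by blast
qed

section \<open>Height and rank of a finite poset\<close>

lemma finite_chains: "finite X \<Longrightarrow> finite {C. is_chain X le C}"
  by (rule finite_subset[of _ "Pow X"]) (auto simp: is_chain_def)

lemma card_chain_le_height:
  assumes "finite X" "is_chain X le C"
  shows "card C \<le> height X le"
  unfolding height_def using assms finite_chains[OF assms(1), of le] by (intro Max_ge) auto

lemma chain_of_height_exists:
  assumes "finite X"
  shows "\<exists>C. is_chain X le C \<and> card C = height X le"
proof -
  have "{} \<in> {C. is_chain X le C}" by (simp add: is_chain_def)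
  then have "height X le \<in> card ` {C. is_chain X le C}"
    unfolding height_def using finite_chains[OF assms, of le] by (intro Max_in) auto
  then show ?thesis by auto
qed

lemma height_pos:
  assumes "is_poset X le" "X \<noteq> {}"
  shows "0 < height X le"
proof -
  obtain x where "x \<in> X" using assms by auto
  then have "is_chain X le {x}" using assms by (auto simp: is_chain_def is_poset_def)
  then show ?thesis using card_chain_le_height[of X le "{x}"] assms by (auto simp: is_poset_def)
qed

text \<open>The rank of \<open>x\<close> is the size of a largest chain strictly below
  \<open>x\<close>. It will be the position of the image of \<open>x\<close> inside a window of
  \<open>k\<close> sets, so it has to stay below the height.\<close>

lemma rank_function_exists:
  assumes po: "is_poset X le"
  shows "\<exists>rk. (\<forall>x\<in>X. rk x < height X le) \<and> (\<forall>x\<in>X. \<forall>y\<in>X. le x y \<longrightarrow> x \<noteq> y \<longrightarrow> rk x < (rk y :: nat))"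
proof -
  have fin: "finite X" and refl: "\<And>x. x \<in> X \<Longrightarrow> le x x"
    and antisym: "\<And>x y. x \<in> X \<Longrightarrow> y \<in> X \<Longrightarrow> le x y \<Longrightarrow> le y x \<Longrightarrow> x = y"
    and trans: "\<And>x y z. x \<in> X \<Longrightarrow> y \<in> X \<Longrightarrow> z \<in> X \<Longrightarrow> le x y \<Longrightarrow> le y z \<Longrightarrow> le x z"
    using po unfolding is_poset_def by blast+
  define B where "B x = {C. is_chain X le C \<and> (\<forall>c\<in>C. le c x \<and> c \<noteq> x)}" for x
  define rk where "rk x = Max (card ` B x)" for x
  have fB: "finite (B x)" for x
    unfolding B_def by (rule finite_subset[OF _ finite_chains[OF fin, of le]]) auto
  have "{} \<in> B x" for x by (simp add: B_def is_chain_def)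
  then have "rk x \<in> card ` B x" for x unfolding rk_def using fB by (intro Max_in) auto
  then have C: "\<exists>C\<in>B x. card C = rk x" for x by (metis imageE)
  have ext: "is_chain X le (insert x C) \<and> card (insert x C) = Suc (rk x)"
    if "x \<in> X" "C \<in> B x" "card C = rk x" for x C
  proof -
    have "finite C" using that fin finite_subset unfolding B_def is_chain_def by blast
    moreover have "x \<notin> C" using that unfolding B_def by blast
    moreover have "is_chain X le (insert x C)" using that refl unfolding B_def is_chain_def by auto
    ultimately show ?thesis using that by simp
  qed
  have "rk x < height X le" if "x \<in> X" for x
    using C[of x] ext[OF that] card_chain_le_height[OF fin] by (metis Suc_le_eq)
  moreover have "rk x < rk y" if xy: "x \<in> X" "y \<in> X" "le x y" "x \<noteq> y" for x y
  proof -
    obtain C where C': "C \<in> B x" "card C = rk x" using C by blast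
    have "insert x C \<in> B y"
      unfolding B_def
    proof (intro CollectI conjI ballI)
      show "is_chain X le (insert x C)" using ext[OF xy(1) C'] by blast
      fix c assume c: "c \<in> insert x C"
      have "c \<in> X" using c C'(1) xy unfolding B_def is_chain_def by auto
      then show "le c y" "c \<noteq> y"
        using c C'(1) xy trans[of c x y] antisym[of x y] unfolding B_def by auto
    qed
    then have "card (insert x C) \<le> rk y" unfolding rk_def using fB by (intro Max_ge) auto
    then show ?thesis using ext[OF xy(1) C'] by simp
  qed
  ultimately show ?thesis by blast
qed

text \<open>A chain of \<open>X\<close> is sent to sets of pairwise different sizes. The
  contrapositive shows that \<open>k - 1\<close> levels contain no induced copy.\<close>

lemma height_le_levels:
  assumes "finite X" "contains_induced X le F" "finite F" "\<And>S. S \<in> F \<Longrightarrow> finite S"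
  shows "height X le \<le> card (card ` F)"
proof -
  obtain f where "induced_copy X le F f" using assms(2) unfolding contains_induced_def by blast
  then have f: "f ` X \<subseteq> F" "\<forall>x\<in>X. \<forall>y\<in>X. f x \<subset> f y \<longleftrightarrow> le x y \<and> x \<noteq> y"
    unfolding induced_copy_def by simp_all
  obtain C where C: "is_chain X le C" "card C = height X le"
    using chain_of_height_exists[OF assms(1)] by blast
  have CX: "C \<subseteq> X" using C unfolding is_chain_def by blast
  have lt: "card (f x) < card (f y)" if "x \<in> C" "y \<in> C" "le x y" "x \<noteq> y" for x y
  proof (rule psubset_card_mono)
    have xy: "x \<in> X" "y \<in> X" using that CX by auto
    then show "finite (f y)" using assms(4) f(1) by auto
    show "f x \<subset> f y" using f(2)[rule_format, OF xy] that by simp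
  qed
  have "inj_on (\<lambda>x. card (f x)) C"
  proof (rule inj_onI, rule ccontr)
    fix x y assume "x \<in> C" "y \<in> C" "card (f x) = card (f y)" "x \<noteq> y"
    moreover from this have "le x y \<or> le y x" using C unfolding is_chain_def by blast
    ultimately show False using lt[of x y] lt[of y x] by auto
  qed
  then have "card C = card ((\<lambda>x. card (f x)) ` C)" by (simp add: card_image)
  also have "\<dots> \<le> card (card ` F)" using f(1) CX assms(3) by (intro card_mono) auto
  finally show ?thesis using C(2) by simp
qed

section \<open>A Markov chain indexed by a tree poset\<close>

lemma sum_PiE_insert:
  fixes A :: "'b set"
  assumes "v \<notin> X"
  shows "(\<Sum>f\<in>insert v X \<rightarrow>\<^sub>E A. h f) = (\<Sum>g\<in>X \<rightarrow>\<^sub>E A. \<Sum>y\<in>A. h (g(v := y)))"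
proof -
  have "(\<Sum>f\<in>insert v X \<rightarrow>\<^sub>E A. h f) = (\<Sum>(y, g)\<in>A \<times> (X \<rightarrow>\<^sub>E A). h (g(v := y)))"
    unfolding PiE_insert_eq by (subst sum.reindex[OF inj_combinator[OF assms]]) (simp add: case_prod_unfold)
  also have "\<dots> = (\<Sum>g\<in>X \<rightarrow>\<^sub>E A. \<Sum>y\<in>A. h (g(v := y)))"
    by (simp add: sum.cartesian_product[symmetric] sum.swap[of _ _ A])
  finally show ?thesis .
qed

text \<open>Removing a leaf \<open>v\<close> with neighbour \<open>b\<close>, the image of \<open>v\<close> is sampled from the marked chains through
  the image of \<open>b\<close>. The exact marginals are part of the induction because they give the spread bound
  when \<open>D\<close> is a singleton.\<close>
lemma tree_indexed_markov_measure:
  fixes a :: "nat \<Rightarrow> 'm \<Rightarrow> nat set" and M :: "'m set" and A :: "nat set set"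
    and W c q\<^sub>0 \<beta> :: real
  assumes M: "finite M" "M \<noteq> {}" and A: "finite A"
    and aA: "\<And>m j. m \<in> M \<Longrightarrow> j < k \<Longrightarrow> a j m \<in> A"
    and chain: "\<And>m i j. m \<in> M \<Longrightarrow> i < j \<Longrightarrow> j < k \<Longrightarrow> a i m \<subset> a j m"
    and deg: "\<And>m j. m \<in> M \<Longrightarrow> j < k \<Longrightarrow> c * W \<le> card {m'\<in>M. a j m' = a j m}"
    and one: "\<And>j x. j < k \<Longrightarrow> card {m\<in>M. a j m = x} \<le> W"
    and two: "\<And>i j x y. i < j \<Longrightarrow> j < k \<Longrightarrow> card {m\<in>M. a i m = x \<and> a j m = y} \<le> W * q\<^sub>0"
    and up: "\<And>i j x z. i < j \<Longrightarrow> j < k \<Longrightarrow> x \<in> A \<Longrightarrow> z \<in> A \<Longrightarrow> \<not> z \<subseteq> x \<Longrightarrow>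
      card {m\<in>M. a i m = x \<and> (a j m \<subseteq> z \<or> z \<subseteq> a j m)} \<le> W * \<beta>"
    and dn: "\<And>i j x z. i < j \<Longrightarrow> j < k \<Longrightarrow> x \<in> A \<Longrightarrow> z \<in> A \<Longrightarrow> \<not> x \<subseteq> z \<Longrightarrow>
      card {m\<in>M. a j m = x \<and> (a i m \<subseteq> z \<or> z \<subseteq> a i m)} \<le> W * \<beta>"
    and pos: "0 < c" "0 < W" "0 \<le> q\<^sub>0" "0 \<le> \<beta>"
    and tree: "is_tree_poset X le"
    and rk: "\<And>x. x \<in> X \<Longrightarrow> rk x < k" "\<And>x y. x \<in> X \<Longrightarrow> y \<in> X \<Longrightarrow> le x y \<Longrightarrow> x \<noteq> y \<Longrightarrow> rk x < rk y"
    and small: "2 * card X * \<beta> \<le> c"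
  shows "\<exists>w. (\<forall>f. 0 \<le> w f) \<and> (\<Sum>f\<in>X \<rightarrow>\<^sub>E A. w f) = 1 \<and>
    (\<forall>v\<in>X. \<forall>x. (\<Sum>f\<in>X \<rightarrow>\<^sub>E A. w f * of_bool (f v = x)) = card {m\<in>M. a (rk v) m = x} / card M) \<and>
    (\<forall>D h. D \<subseteq> X \<longrightarrow> D \<noteq> {} \<longrightarrow> (\<Sum>f\<in>X \<rightarrow>\<^sub>E A. w f * of_bool (\<forall>d\<in>D. f d = h d)) \<le> W / card M * (q\<^sub>0 / c) ^ (card D - 1)) \<and>
    (1 / 2) ^ card X \<le> (\<Sum>f\<in>X \<rightarrow>\<^sub>E A. w f * of_bool (\<forall>x\<in>X. \<forall>y\<in>X. f x \<subseteq> f y \<longleftrightarrow> le x y))"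
  using tree rk small
proof (induction "card X" arbitrary: X rule: less_induct)
  case less
  have po: "is_poset X le" and X0: "X \<noteq> {}" using less.prems(1) by (auto simp: is_tree_poset_def)
  have fin: "finite X" and le_refl: "\<And>x. x \<in> X \<Longrightarrow> le x x"
    and le_trans: "\<And>x y z. x \<in> X \<Longrightarrow> y \<in> X \<Longrightarrow> z \<in> X \<Longrightarrow> le x y \<Longrightarrow> le y z \<Longrightarrow> le x z"
    using po unfolding is_poset_def by blast+
  have cM: "0 < real (card M)" using M by (simp add: card_gt_0_iff)
  show ?case
  proof (cases "card X = 1")
    case True
    then obtain v where v: "X = {v}" by (auto simp: card_1_singleton_iff)
    \<comment> \<open>The image of a single vertex is distributed as the entry at position
      \<open>rk v\<close> of a uniformly chosen element of \<open>M\<close>.\<close>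
    let ?w = "\<lambda>f. card {m\<in>M. a (rk v) m = f v} / card M"
    have rkv: "rk v < k" using less.prems(2) v by simp
    have S: "(\<Sum>f\<in>X \<rightarrow>\<^sub>E A. h f) = (\<Sum>y\<in>A. h ((\<lambda>_. undefined)(v := y)))" for h :: "('a \<Rightarrow> nat set) \<Rightarrow> real"
      unfolding v using sum_PiE_insert[where v = v and X = "{}" and A = A and h = h] by (simp add: fun_upd_def)
    have "real (card M) = (\<Sum>y\<in>A. card {m\<in>M. a (rk v) m = y})"
    proof -
      have "M = (\<Union>y\<in>A. {m\<in>M. a (rk v) m = y})" using aA rkv by blast
      then have "card M = card (\<Union>y\<in>A. {m\<in>M. a (rk v) m = y})" by simp
      also have "\<dots> = (\<Sum>y\<in>A. card {m\<in>M. a (rk v) m = y})"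
        using A M by (intro card_UN_disjoint) auto
      finally show ?thesis by simp
    qed
    then have tot: "(\<Sum>y\<in>A. card {m\<in>M. a (rk v) m = y} / card M) = 1"
      using cM by (simp flip: sum_divide_distrib)
    have marg: "(\<Sum>y\<in>A. card {m\<in>M. a (rk v) m = y} / card M * of_bool (y = x)) = card {m\<in>M. a (rk v) m = x} / card M" for x
    proof (cases "x \<in> A")
      case True
      then have "(\<Sum>y\<in>A. card {m\<in>M. a (rk v) m = y} / card M * of_bool (y = x)) =
        (\<Sum>y\<in>{x}. card {m\<in>M. a (rk v) m = y} / card M * of_bool (y = x))"
        using A by (intro sum.mono_neutral_right) auto
      then show ?thesis by simp
    next
      case False
      then have "{m\<in>M. a (rk v) m = x} = {}" using aA rkv by auto
      then have "card {m\<in>M. a (rk v) m = x} = 0" by (simp only: card.empty)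
      moreover have "(\<Sum>y\<in>A. card {m\<in>M. a (rk v) m = y} / card M * of_bool (y = x)) = 0"
        using False by (intro sum.neutral) auto
      ultimately show ?thesis by simp
    qed
    show ?thesis
    proof (intro exI[of _ ?w] conjI allI ballI impI)
      show "0 \<le> ?w f" for f by simp
      show "(\<Sum>f\<in>X \<rightarrow>\<^sub>E A. ?w f) = 1" unfolding S using tot by simp
      show "(\<Sum>f\<in>X \<rightarrow>\<^sub>E A. ?w f * of_bool (f u = x)) = card {m\<in>M. a (rk u) m = x} / card M" if "u \<in> X" for u x
        unfolding S using that v marg by simp
      show "(\<Sum>f\<in>X \<rightarrow>\<^sub>E A. ?w f * of_bool (\<forall>d\<in>D. f d = h d)) \<le> W / card M * (q\<^sub>0 / c) ^ (card D - 1)"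
        if "D \<subseteq> X" "D \<noteq> {}" for D h
      proof -
        have "D = {v}" using that v by auto
        then show ?thesis unfolding S using marg one[OF rkv] cM by (simp add: divide_right_mono)
      qed
      have "(1 / 2) ^ card X \<le> (1 :: real)" using True by simp
      also have "\<dots> = (\<Sum>f\<in>X \<rightarrow>\<^sub>E A. ?w f * of_bool (\<forall>x\<in>X. \<forall>y\<in>X. f x \<subseteq> f y \<longleftrightarrow> le x y))"
        unfolding S using v tot le_refl by simp
      finally show "(1 / 2) ^ card X \<le> (\<Sum>f\<in>X \<rightarrow>\<^sub>E A. ?w f * of_bool (\<forall>x\<in>X. \<forall>y\<in>X. f x \<subseteq> f y \<longleftrightarrow> le x y))" .
    qed
  next
    case False
    moreover have "card X \<noteq> 0" using X0 fin by simp
    ultimately have "2 \<le> card X" by linarith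
    from tree_poset_remove_leaf[OF less.prems(1) this] obtain v b where
      vb0: "v \<in> X \<and> b \<in> X \<and> b \<noteq> v \<and> is_tree_poset (X - {v}) le \<and>
        ((le b v \<and> (\<forall>u\<in>X - {v}. (le u v \<longrightarrow> le u b) \<and> \<not> le v u)) \<or>
         (le v b \<and> (\<forall>u\<in>X - {v}. (le v u \<longrightarrow> le b u) \<and> \<not> le u v)))"
      by (elim exE)
    have vb: "v \<in> X" "b \<in> X" "b \<noteq> v" and tree': "is_tree_poset (X - {v}) le"
      using vb0 by blast+
    have vcases: "(le b v \<and> (\<forall>u\<in>X - {v}. (le u v \<longrightarrow> le u b) \<and> \<not> le v u)) \<or>
       (le v b \<and> (\<forall>u\<in>X - {v}. (le v u \<longrightarrow> le b u) \<and> \<not> le u v))"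
      using vb0 by (elim conjE)
    define Y where "Y = X - {v}"
    have Y: "X = insert v Y" "v \<notin> Y" "b \<in> Y" "finite Y" "card X = Suc (card Y)"
      using vb fin card.remove[OF fin vb(1)] unfolding Y_def by auto
    define i j where "i = rk b" and "j = rk v"
    have ij: "i < k" "j < k" using vb less.prems(2) by (auto simp: i_def j_def)
    have "2 * card Y * \<beta> \<le> 2 * card X * \<beta>" using Y(5) pos by (intro mult_right_mono) auto
    then have small': "2 * card Y * \<beta> \<le> c" by (rule order_trans) (rule less.prems(4))
    have "\<exists>w. (\<forall>f. 0 \<le> w f) \<and> (\<Sum>f\<in>Y \<rightarrow>\<^sub>E A. w f) = 1 \<and>
      (\<forall>v\<in>Y. \<forall>x. (\<Sum>f\<in>Y \<rightarrow>\<^sub>E A. w f * of_bool (f v = x)) = card {m\<in>M. a (rk v) m = x} / card M) \<and>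
      (\<forall>D h. D \<subseteq> Y \<longrightarrow> D \<noteq> {} \<longrightarrow> (\<Sum>f\<in>Y \<rightarrow>\<^sub>E A. w f * of_bool (\<forall>d\<in>D. f d = h d)) \<le> W / card M * (q\<^sub>0 / c) ^ (card D - 1)) \<and>
      (1 / 2) ^ card Y \<le> (\<Sum>f\<in>Y \<rightarrow>\<^sub>E A. w f * of_bool (\<forall>x\<in>Y. \<forall>y\<in>Y. f x \<subseteq> f y \<longleftrightarrow> le x y))"
    proof (rule less.hyps)
      show "card Y < card X" using Y(5) by simp
      show "is_tree_poset Y le" using tree' unfolding Y_def .
      show "rk x < k" if "x \<in> Y" for x using less.prems(2) that Y(1) by blast
      show "rk x < rk y" if "x \<in> Y" "y \<in> Y" "le x y" "x \<noteq> y" for x y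
        using less.prems(3) that Y(1) by blast
    qed (rule small')
    then obtain w where w: "\<And>f. 0 \<le> w f" "(\<Sum>f\<in>Y \<rightarrow>\<^sub>E A. w f) = 1"
      "\<And>v x. v \<in> Y \<Longrightarrow> (\<Sum>f\<in>Y \<rightarrow>\<^sub>E A. w f * of_bool (f v = x)) = card {m\<in>M. a (rk v) m = x} / card M"
      "\<And>D h. D \<subseteq> Y \<Longrightarrow> D \<noteq> {} \<Longrightarrow> (\<Sum>f\<in>Y \<rightarrow>\<^sub>E A. w f * of_bool (\<forall>d\<in>D. f d = h d)) \<le> W / card M * (q\<^sub>0 / c) ^ (card D - 1)"
      "(1 / 2) ^ card Y \<le> (\<Sum>f\<in>Y \<rightarrow>\<^sub>E A. w f * of_bool (\<forall>x\<in>Y. \<forall>y\<in>Y. f x \<subseteq> f y \<longleftrightarrow> le x y))"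
      by (elim exE conjE) (rule that, simp_all)
    \<comment> \<open>Transition probability: choose \<open>m\<close> uniformly among the elements
      of \<open>M\<close> with \<open>a i m = x\<close> and read off position \<open>j\<close>. If
      there is no such \<open>m\<close>, the quotient is \<open>0 / 0 = 0\<close>.\<close>
    define \<kappa> where "\<kappa> x y = card {m\<in>M. a i m = x \<and> a j m = y} / card {m\<in>M. a i m = x}" for x y
    have \<kappa>0: "0 \<le> \<kappa> x y" for x y by (simp add: \<kappa>_def)
    define w' where "w' f = w (restrict f Y) * \<kappa> (f b) (f v)" for f
    have S: "(\<Sum>f\<in>X \<rightarrow>\<^sub>E A. w' f * h f) = (\<Sum>g\<in>Y \<rightarrow>\<^sub>E A. w g * (\<Sum>y\<in>A. \<kappa> (g b) y * h (g(v := y))))" for h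
    proof -
      have "w' (g(v := y)) = w g * \<kappa> (g b) y" if "g \<in> Y \<rightarrow>\<^sub>E A" for g y
      proof -
        have "restrict (g(v := y)) Y = g" using that Y(2) by (auto simp: fun_eq_iff PiE_def extensional_def)
        then show ?thesis using vb by (simp add: w'_def)
      qed
      then show ?thesis unfolding Y(1) sum_PiE_insert[OF Y(2)]
        by (intro sum.cong) (simp_all add: sum_distrib_left mult.assoc)
    qed
    have K0: "(\<Sum>y\<in>A. \<kappa> x y * of_bool (R y)) = card {m\<in>M. a i m = x \<and> R (a j m)} / card {m\<in>M. a i m = x}" for x R
    proof -
      have "{m\<in>M. a i m = x \<and> R (a j m)} = (\<Union>y\<in>{y\<in>A. R y}. {m\<in>M. a i m = x \<and> a j m = y})"
        using aA ij by auto
      also have "card \<dots> = (\<Sum>y\<in>{y\<in>A. R y}. card {m\<in>M. a i m = x \<and> a j m = y})"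
        using A M by (intro card_UN_disjoint) auto
      finally have "real (card {m\<in>M. a i m = x \<and> R (a j m)}) = (\<Sum>y\<in>{y\<in>A. R y}. card {m\<in>M. a i m = x \<and> a j m = y})"
        by simp
      also have "\<dots> = (\<Sum>y\<in>A. card {m\<in>M. a i m = x \<and> a j m = y} * of_bool (R y))"
        using A by (simp add: of_nat_sum) (intro sum.mono_neutral_cong_left, auto)
      finally show ?thesis unfolding \<kappa>_def by (simp add: sum_divide_distrib)
    qed
    \<comment> \<open>\<open>\<kappa> x\<close> has total mass one unless no \<open>m\<close> has
      \<open>x\<close> at position \<open>i\<close>. Such an \<open>x\<close> has marginal zero at
      \<open>b\<close>, so \<open>w g\<close> vanishes as well; this uses the exact marginals of the
      induction hypothesis.\<close>
    have K1: "w g * (\<Sum>y\<in>A. \<kappa> (g b) y) = w g" if g: "g \<in> Y \<rightarrow>\<^sub>E A" for g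
    proof (cases "{m\<in>M. a i m = g b} = {}")
      case True
      have "w g * of_bool (g b = g b) \<le> (\<Sum>f\<in>Y \<rightarrow>\<^sub>E A. w f * of_bool (f b = g b))"
        using g w(1) finite_PiE[OF Y(4), of "\<lambda>_. A"] A
        by (intro member_le_sum[where f = "\<lambda>f. w f * of_bool (f b = g b)"]) auto
      also have "\<dots> = 0" unfolding w(3)[OF Y(3), of "g b"] i_def[symmetric] True by simp
      finally have "w g = 0" using w(1)[of g] by simp
      then show ?thesis by simp
    next
      case False
      then have "card {m\<in>M. a i m = g b} \<noteq> 0" using M by simp
      then show ?thesis using K0[of "g b" "\<lambda>_. True"] by simp
    qed
    have K2: "\<kappa> x y \<le> q\<^sub>0 / c" for x y
    proof (cases "{m\<in>M. a i m = x} = {}")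
      case True
      then show ?thesis unfolding \<kappa>_def True using pos by simp
    next
      case False
      then obtain m where m: "m \<in> M" "a i m = x" by auto
      have d: "c * W \<le> card {m\<in>M. a i m = x}" using deg[OF m(1) ij(1)] m(2) by simp
      have "rk b \<noteq> rk v" using vcases less.prems(3)[of b v] less.prems(3)[of v b] vb by auto
      then have "card {m\<in>M. a i m = x \<and> a j m = y} \<le> W * q\<^sub>0"
        using two[of i j x y] two[of j i y x] ij by (auto simp: i_def j_def conj_commute nat_neq_iff)
      then have "\<kappa> x y \<le> W * q\<^sub>0 / (c * W)"
        unfolding \<kappa>_def using d pos by (intro frac_le) auto
      then show ?thesis using pos by (simp add: field_simps)
    qed
    \<comment> \<open>Both positions are read from the same uniform element of \<open>M\<close>, so
      one transition carries the marginal at \<open>i\<close> exactly to the marginal at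
      \<open>j\<close>.\<close>
    have margv: "(\<Sum>g\<in>Y \<rightarrow>\<^sub>E A. w g * \<kappa> (g b) x) = card {m\<in>M. a j m = x} / card M" for x
    proof -
      have "(\<Sum>g\<in>Y \<rightarrow>\<^sub>E A. w g * \<kappa> (g b) x) = (\<Sum>g\<in>Y \<rightarrow>\<^sub>E A. \<Sum>z\<in>A. w g * of_bool (g b = z) * \<kappa> z x)"
      proof (rule sum.cong[OF refl])
        fix g assume g: "g \<in> Y \<rightarrow>\<^sub>E A"
        then have "g b \<in> A" using Y(3) by auto
        then have "(\<Sum>z\<in>A. w g * of_bool (g b = z) * \<kappa> z x) = (\<Sum>z\<in>{g b}. w g * of_bool (g b = z) * \<kappa> z x)"
          using A by (intro sum.mono_neutral_right) auto
        then show "w g * \<kappa> (g b) x = (\<Sum>z\<in>A. w g * of_bool (g b = z) * \<kappa> z x)" by simp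
      qed
      also have "\<dots> = (\<Sum>z\<in>A. (\<Sum>g\<in>Y \<rightarrow>\<^sub>E A. w g * of_bool (g b = z)) * \<kappa> z x)"
        by (subst sum.swap) (simp add: sum_distrib_right)
      also have "\<dots> = (\<Sum>z\<in>A. card {m\<in>M. a i m = z \<and> a j m = x} / card M)"
      proof (rule sum.cong[OF refl])
        fix z
        show "(\<Sum>g\<in>Y \<rightarrow>\<^sub>E A. w g * of_bool (g b = z)) * \<kappa> z x = card {m\<in>M. a i m = z \<and> a j m = x} / card M"
        proof (cases "{m\<in>M. a i m = z} = {}")
          case True
          then have e: "{m\<in>M. a i m = z \<and> a j m = x} = {}" by auto
          show ?thesis unfolding \<kappa>_def e by simp
        next
          case False
          then have "card {m\<in>M. a i m = z} \<noteq> 0" using M by simp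
          then show ?thesis unfolding w(3)[OF Y(3)] \<kappa>_def by (simp add: i_def)
        qed
      qed
      also have "\<dots> = (\<Sum>z\<in>A. card {m\<in>M. a i m = z \<and> a j m = x}) / card M"
        by (simp add: sum_divide_distrib)
      also have "(\<Sum>z\<in>A. card {m\<in>M. a i m = z \<and> a j m = x}) = card {m\<in>M. a j m = x}"
      proof -
        have "{m\<in>M. a j m = x} = (\<Union>z\<in>A. {m\<in>M. a i m = z \<and> a j m = x})" using aA ij by auto
        also have "card \<dots> = (\<Sum>z\<in>A. card {m\<in>M. a i m = z \<and> a j m = x})"
          using A M by (intro card_UN_disjoint) auto
        finally show ?thesis by simp
      qed
      finally show ?thesis .
    qed
    have pick: "(\<Sum>y\<in>A. \<kappa> x y * of_bool (y = z \<and> P)) = \<kappa> x z * of_bool P" for x z P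
    proof (cases "z \<in> A")
      case True
      then have "(\<Sum>y\<in>A. \<kappa> x y * of_bool (y = z \<and> P)) = (\<Sum>y\<in>{z}. \<kappa> x y * of_bool (y = z \<and> P))"
        using A by (intro sum.mono_neutral_right) auto
      then show ?thesis by simp
    next
      case False
      then have e: "{m\<in>M. a i m = x \<and> a j m = z} = {}" using aA ij by auto
      have "\<kappa> x z = 0" unfolding \<kappa>_def e by simp
      moreover have "(\<Sum>y\<in>A. \<kappa> x y * of_bool (y = z \<and> P)) = 0" using False by (intro sum.neutral) auto
      ultimately show ?thesis by simp
    qed
    have half: "1 / 2 * (w g * of_bool (\<forall>x\<in>Y. \<forall>y\<in>Y. g x \<subseteq> g y \<longleftrightarrow> le x y)) \<le>
      w g * (\<Sum>y\<in>A. \<kappa> (g b) y * of_bool (\<forall>s\<in>X. \<forall>t\<in>X. (g(v := y)) s \<subseteq> (g(v := y)) t \<longleftrightarrow> le s t))"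
      if g: "g \<in> Y \<rightarrow>\<^sub>E A" for g
    proof (cases "w g = 0 \<or> \<not> (\<forall>x\<in>Y. \<forall>y\<in>Y. g x \<subseteq> g y \<longleftrightarrow> le x y)")
      case True
      have "0 \<le> w g * (\<Sum>y\<in>A. \<kappa> (g b) y * of_bool (\<forall>s\<in>X. \<forall>t\<in>X. (g(v := y)) s \<subseteq> (g(v := y)) t \<longleftrightarrow> le s t))"
        using w(1) \<kappa>0 by (intro mult_nonneg_nonneg sum_nonneg) auto
      moreover have "w g = 0 \<or> of_bool (\<forall>x\<in>Y. \<forall>y\<in>Y. g x \<subseteq> g y \<longleftrightarrow> le x y) = (0 :: real)"
        using True by (simp only: of_bool_eq_0_iff)
      then have "w g * of_bool (\<forall>x\<in>Y. \<forall>y\<in>Y. g x \<subseteq> g y \<longleftrightarrow> le x y) = 0"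
        by (simp only: mult_eq_0_iff)
      ultimately show ?thesis by linarith
    next
      case False
      then have ind: "\<And>x y. x \<in> Y \<Longrightarrow> y \<in> Y \<Longrightarrow> g x \<subseteq> g y \<longleftrightarrow> le x y" and wg: "w g > 0" using w(1)[of g] by auto
      let ?I = "\<lambda>y. \<forall>s\<in>X. \<forall>t\<in>X. (g(v := y)) s \<subseteq> (g(v := y)) t \<longleftrightarrow> le s t"
      \<comment> \<open>\<open>B u\<close> fails when the image of \<open>u\<close> lies beyond that
        of \<open>b\<close> as seen from \<open>v\<close>; its relation to the new image is then
        inherited through \<open>b\<close>. If \<open>B u\<close> holds, \<open>u\<close> and
        \<open>v\<close> are incomparable, and comparability of the images has to be
        avoided.\<close>
      define B where "B u \<longleftrightarrow> (if le b v then \<not> g u \<subseteq> g b else \<not> g b \<subseteq> g u)" for u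
      have tot: "(\<Sum>y\<in>A. \<kappa> (g b) y) = 1" using K1[OF g] wg by simp
      have "card {m\<in>M. a i m = g b} \<noteq> 0"
      proof
        assume "card {m\<in>M. a i m = g b} = 0"
        then have "\<kappa> (g b) y = 0" for y unfolding \<kappa>_def by (simp only: of_nat_0 div_by_0)
        then show False using tot by simp
      qed
      then obtain m0 where m0: "m0 \<in> M" "a i m0 = g b" by (metis (mono_tags, lifting) card.empty empty_Collect_eq)
      then have d: "c * W \<le> card {m\<in>M. a i m = g b}" using deg[OF m0(1) ij(1)] by simp
      have gA: "g u \<in> A" if "u \<in> Y" for u using g that by auto
      have badB: "(\<Sum>y\<in>A. \<kappa> (g b) y * of_bool (y \<subseteq> g u \<or> g u \<subseteq> y)) \<le> \<beta> / c" if u: "u \<in> Y" "B u" for u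
      proof -
        have "card {m\<in>M. a i m = g b \<and> (a j m \<subseteq> g u \<or> g u \<subseteq> a j m)} \<le> W * \<beta>"
        proof (cases "le b v")
          case True
          then have "i < j" using less.prems(3)[of b v] vb by (simp add: i_def j_def)
          then show ?thesis using up[of i j "g b" "g u"] gA u Y(3) ij True by (simp add: B_def)
        next
          case False
          then have "le v b" using vcases by blast
          then have "j < i" using less.prems(3)[of v b] vb by (simp add: i_def j_def)
          then show ?thesis using dn[of j i "g b" "g u"] gA u Y(3) ij False by (simp add: B_def)
        qed
        then have "(\<Sum>y\<in>A. \<kappa> (g b) y * of_bool (y \<subseteq> g u \<or> g u \<subseteq> y)) \<le> W * \<beta> / (c * W)"
          unfolding K0 using d pos by (intro frac_le) auto
        then show ?thesis using pos by (simp add: field_simps)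
      qed
      have good: "?I y" if y: "\<kappa> (g b) y \<noteq> 0" and nb: "\<And>u. u \<in> Y \<Longrightarrow> B u \<Longrightarrow> \<not> y \<subseteq> g u \<and> \<not> g u \<subseteq> y" for y
      proof -
        have "{m\<in>M. a i m = g b \<and> a j m = y} \<noteq> {}" using y unfolding \<kappa>_def by (metis card.empty div_0 of_nat_0)
        then obtain m where m: "m \<in> M" "a i m = g b" "a j m = y" by blast
        have "(\<forall>u\<in>Y. (g u \<subseteq> y \<longleftrightarrow> le u v) \<and> (y \<subseteq> g u \<longleftrightarrow> le v u))"
        proof (cases "le b v")
          case True
          have no: "le u v \<Longrightarrow> le u b" "\<not> le v u" if "u \<in> Y" for u
            using vcases that True vb Y(3) by (auto simp: Y_def)
          have "i < j" using True less.prems(3)[of b v] vb by (simp add: i_def j_def)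
          then have by': "g b \<subset> y" using chain[OF m(1), of i j] m ij by auto
          show ?thesis
          proof (intro ballI)
            fix u assume u: "u \<in> Y"
            show "(g u \<subseteq> y \<longleftrightarrow> le u v) \<and> (y \<subseteq> g u \<longleftrightarrow> le v u)"
            proof (cases "g u \<subseteq> g b")
              case True1: True
              then have "le u b" using ind u Y(3) by simp
              then have "le u v" using le_trans[of u b v] True u vb unfolding Y_def by blast
              then show ?thesis using True1 by' no(2)[OF u] by blast
            next
              case False1: False
              then have "\<not> le u v" using no(1)[OF u] ind u Y(3) by auto
              then show ?thesis using nb[OF u] False1 True no(2)[OF u] by (auto simp: B_def)
            qed
          qed
        next
          case False
          then have lvb: "le v b" and no: "\<And>u. u \<in> Y \<Longrightarrow> le v u \<Longrightarrow> le b u" "\<And>u. u \<in> Y \<Longrightarrow> \<not> le u v"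
            using vcases unfolding Y_def by blast+
          have "j < i" using lvb less.prems(3)[of v b] vb by (simp add: i_def j_def)
          then have by': "y \<subset> g b" using chain[OF m(1), of j i] m ij by auto
          show ?thesis
          proof (intro ballI)
            fix u assume u: "u \<in> Y"
            show "(g u \<subseteq> y \<longleftrightarrow> le u v) \<and> (y \<subseteq> g u \<longleftrightarrow> le v u)"
            proof (cases "g b \<subseteq> g u")
              case True1: True
              then have "le b u" using ind u Y(3) by simp
              then have "le v u" using le_trans[of v b u] lvb u vb unfolding Y_def by blast
              then show ?thesis using True1 by' no(2)[OF u] by blast
            next
              case False1: False
              then have "\<not> le v u" using no(1)[OF u] ind u Y(3) by auto
              then show ?thesis using nb[OF u] False1 False no(2)[OF u] by (auto simp: B_def)
            qed
          qed
        qed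
        then show ?thesis unfolding Y(1) using ind Y(2) le_refl[OF vb(1)] by auto
      qed
      have "1 - (\<Sum>y\<in>A. \<kappa> (g b) y * of_bool (?I y)) = (\<Sum>y\<in>A. \<kappa> (g b) y * of_bool (\<not> ?I y))"
        unfolding tot[symmetric] sum_subtractf[symmetric]
        by (intro sum.cong refl) (simp only: of_bool_not_iff right_diff_distrib mult_1_right)
      also have "\<dots> \<le> (\<Sum>y\<in>A. \<Sum>u\<in>{u\<in>Y. B u}. \<kappa> (g b) y * of_bool (y \<subseteq> g u \<or> g u \<subseteq> y))"
      proof (intro sum_mono)
        fix y assume "y \<in> A"
        have nn: "0 \<le> (\<Sum>u\<in>{u\<in>Y. B u}. \<kappa> (g b) y * of_bool (y \<subseteq> g u \<or> g u \<subseteq> y))"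
          by (intro sum_nonneg mult_nonneg_nonneg \<kappa>0 zero_less_eq_of_bool)
        show "\<kappa> (g b) y * of_bool (\<not> ?I y) \<le> (\<Sum>u\<in>{u\<in>Y. B u}. \<kappa> (g b) y * of_bool (y \<subseteq> g u \<or> g u \<subseteq> y))"
        proof (cases "\<kappa> (g b) y = 0 \<or> ?I y")
          case True
          then have "\<kappa> (g b) y * of_bool (\<not> ?I y) = 0" by (simp only: mult_eq_0_iff of_bool_eq_0_iff not_not)
          then show ?thesis using nn by (simp only:)
        next
          case False
          then obtain u where u: "u \<in> {u\<in>Y. B u}" "y \<subseteq> g u \<or> g u \<subseteq> y" using good[of y] by blast
          have "\<kappa> (g b) y * of_bool (y \<subseteq> g u \<or> g u \<subseteq> y) \<le> (\<Sum>u\<in>{u\<in>Y. B u}. \<kappa> (g b) y * of_bool (y \<subseteq> g u \<or> g u \<subseteq> y))"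
            using Y(4)
            by (intro member_le_sum[where f = "\<lambda>u. \<kappa> (g b) y * of_bool (y \<subseteq> g u \<or> g u \<subseteq> y)"] u(1)
                mult_nonneg_nonneg \<kappa>0 zero_less_eq_of_bool) simp
          moreover have "of_bool (\<not> ?I y) = (1 :: real)" "of_bool (y \<subseteq> g u \<or> g u \<subseteq> y) = (1 :: real)"
            using False u(2) by (simp_all only: of_bool_eq_1_iff de_Morgan_disj simp_thms)
          ultimately show ?thesis by (simp only:)
        qed
      qed
      also have "\<dots> = (\<Sum>u\<in>{u\<in>Y. B u}. \<Sum>y\<in>A. \<kappa> (g b) y * of_bool (y \<subseteq> g u \<or> g u \<subseteq> y))"
        by (rule sum.swap)
      also have "\<dots> \<le> (\<Sum>u\<in>{u\<in>Y. B u}. \<beta> / c)" using badB by (intro sum_mono) auto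
      also have "\<dots> \<le> card Y * (\<beta> / c)"
        using Y(4) pos by (auto intro!: mult_right_mono card_mono divide_nonneg_pos simp del: times_divide_eq_right)
      \<comment> \<open>The hypothesis \<open>2 * card X * \<beta> \<le> c\<close> makes every
        extension by a leaf succeed with conditional probability at least one half.\<close>
      also have "\<dots> \<le> 1 / 2" using small' pos by (simp add: field_simps)
      finally have "1 / 2 \<le> (\<Sum>y\<in>A. \<kappa> (g b) y * of_bool (?I y))" by simp
      then have "w g * (1 / 2) \<le> w g * (\<Sum>y\<in>A. \<kappa> (g b) y * of_bool (?I y))" using wg by (intro mult_left_mono) auto
      then show ?thesis using False by simp
    qed
    show ?thesis
    proof (intro exI[of _ w'] conjI allI ballI impI)
      show "0 \<le> w' f" for f using w(1) \<kappa>0 by (simp add: w'_def)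
      show "(\<Sum>f\<in>X \<rightarrow>\<^sub>E A. w' f) = 1"
        using S[of "\<lambda>_. 1"] K1 w(2) by simp
      show "(\<Sum>f\<in>X \<rightarrow>\<^sub>E A. w' f * of_bool (f u = x)) = card {m\<in>M. a (rk u) m = x} / card M" if u: "u \<in> X" for u x
      proof (cases "u = v")
        case True
        then show ?thesis unfolding S using margv[of x] pick[of _ x True] by (simp add: j_def)
      next
        case False
        then have uY: "u \<in> Y" using u by (simp add: Y_def)
        have "(\<Sum>f\<in>X \<rightarrow>\<^sub>E A. w' f * of_bool (f u = x)) = (\<Sum>g\<in>Y \<rightarrow>\<^sub>E A. (w g * (\<Sum>y\<in>A. \<kappa> (g b) y)) * of_bool (g u = x))"
          unfolding S using False by (simp add: sum_distrib_right[symmetric] mult.assoc)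
        also have "\<dots> = (\<Sum>g\<in>Y \<rightarrow>\<^sub>E A. w g * of_bool (g u = x))"
          by (rule sum.cong[OF refl]) (simp only: K1)
        finally show ?thesis using w(3)[OF uY] by simp
      qed
      show "(\<Sum>f\<in>X \<rightarrow>\<^sub>E A. w' f * of_bool (\<forall>d\<in>D. f d = h d)) \<le> W / card M * (q\<^sub>0 / c) ^ (card D - 1)"
        if D: "D \<subseteq> X" "D \<noteq> {}" for D h
      proof (cases "v \<in> D")
        case False
        then have DY: "D \<subseteq> Y" using D by (auto simp: Y_def)
        have e: "(\<forall>d\<in>D. (g(v := y)) d = h d) = (\<forall>d\<in>D. g d = h d)" for g y using False by auto
        have "(\<Sum>f\<in>X \<rightarrow>\<^sub>E A. w' f * of_bool (\<forall>d\<in>D. f d = h d)) = (\<Sum>g\<in>Y \<rightarrow>\<^sub>E A. (w g * (\<Sum>y\<in>A. \<kappa> (g b) y)) * of_bool (\<forall>d\<in>D. g d = h d))"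
          unfolding S e by (simp add: sum_distrib_right[symmetric] mult.assoc)
        also have "\<dots> = (\<Sum>g\<in>Y \<rightarrow>\<^sub>E A. w g * of_bool (\<forall>d\<in>D. g d = h d))"
          by (rule sum.cong[OF refl]) (simp only: K1)
        finally show ?thesis using w(4)[OF DY D(2), of h] by (simp only:)
      next
        case True
        define D' where "D' = D - {v}"
        have D': "D' \<subseteq> Y" "finite D'" "card D = Suc (card D')"
          using D True finite_subset[OF D(1) fin] card.remove[of D v] by (auto simp: D'_def Y_def)
        have e: "(\<forall>d\<in>D. (g(v := y)) d = h d) = (y = h v \<and> (\<forall>d\<in>D'. g d = h d))" for g y
          using True by (auto simp: D'_def)
        have eq: "(\<Sum>f\<in>X \<rightarrow>\<^sub>E A. w' f * of_bool (\<forall>d\<in>D. f d = h d)) =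
          (\<Sum>g\<in>Y \<rightarrow>\<^sub>E A. w g * (\<kappa> (g b) (h v) * of_bool (\<forall>d\<in>D'. g d = h d)))"
          unfolding S e pick ..
        show ?thesis
        proof (cases "D' = {}")
          case True
          then have "(\<Sum>f\<in>X \<rightarrow>\<^sub>E A. w' f * of_bool (\<forall>d\<in>D. f d = h d)) = card {m\<in>M. a j m = h v} / card M"
            using eq margv[of "h v"] by simp
          then show ?thesis using one[OF ij(2), of "h v"] cM D'(3) True by (simp add: divide_right_mono)
        next
          case False
          \<comment> \<open>Unless \<open>v\<close> is the only prescribed vertex, its prescribed
            value costs one factor \<open>q\<^sub>0 / c\<close>, whatever the image of
            \<open>b\<close> is.\<close>
          have "(\<Sum>f\<in>X \<rightarrow>\<^sub>E A. w' f * of_bool (\<forall>d\<in>D. f d = h d)) \<le>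
            (\<Sum>g\<in>Y \<rightarrow>\<^sub>E A. w g * (q\<^sub>0 / c * of_bool (\<forall>d\<in>D'. g d = h d)))"
            unfolding eq using w(1) K2 by (intro sum_mono mult_left_mono mult_right_mono) auto
          also have "\<dots> = q\<^sub>0 / c * (\<Sum>g\<in>Y \<rightarrow>\<^sub>E A. w g * of_bool (\<forall>d\<in>D'. g d = h d))"
            by (simp add: sum_distrib_left mult_ac)
          also have "\<dots> \<le> q\<^sub>0 / c * (W / card M * (q\<^sub>0 / c) ^ (card D' - 1))"
            using w(4)[OF D'(1) False, of h] pos by (intro mult_left_mono) auto
          also have "\<dots> = W / card M * (q\<^sub>0 / c) ^ (card D - 1)"
          proof -
            have "card D - 1 = Suc (card D' - 1)" using D'(2,3) False by (simp add: card_gt_0_iff)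
            then show ?thesis by (simp add: mult_ac)
          qed
          finally show ?thesis .
        qed
      qed
      have "(1 / 2) ^ card X \<le> 1 / 2 * (\<Sum>f\<in>Y \<rightarrow>\<^sub>E A. w f * of_bool (\<forall>x\<in>Y. \<forall>y\<in>Y. f x \<subseteq> f y \<longleftrightarrow> le x y))"
        using w(5) Y(5) by simp
      also have "\<dots> \<le> (\<Sum>f\<in>X \<rightarrow>\<^sub>E A. w' f * of_bool (\<forall>x\<in>X. \<forall>y\<in>X. f x \<subseteq> f y \<longleftrightarrow> le x y))"
        unfolding S by (subst sum_distrib_left) (intro sum_mono half)
      finally show "(1 / 2) ^ card X \<le> (\<Sum>f\<in>X \<rightarrow>\<^sub>E A. w' f * of_bool (\<forall>x\<in>X. \<forall>y\<in>X. f x \<subseteq> f y \<longleftrightarrow> le x y))" .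
    qed
  qed
qed

section \<open>Windows of a family on truncated chains\<close>

definition lvls :: "nat \<Rightarrow> nat set set \<Rightarrow> (nat \<Rightarrow> nat) \<times> nat \<Rightarrow> nat set" where
  "lvls n F \<omega> = {i. i \<le> n \<and> snd \<omega> \<le> n choose i \<and> fst \<omega> ` {..<i} \<in> F}"

text \<open>The second component is a threshold which truncates the chain to the levels of size at least the
  threshold. Each \<open>x\<close> thus lies on \<open>card (fiber n x) * (n choose card x) = fact n\<close> truncated chains.\<close>
definition chain_index :: "nat \<Rightarrow> ((nat \<Rightarrow> nat) \<times> nat) set" where
  "chain_index n = {\<pi>. \<pi> permutes {..<n}} \<times> {1..n choose (n div 2)}"

text \<open>\<open>((\<pi>, \<tau>), t)\<close> stands for the window formed by the members number \<open>t, ..., t + k - 1\<close> of \<open>F\<close> on the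
  truncated chain \<open>(\<pi>, \<tau>)\<close>; \<open>mark\<close> returns its member number \<open>j\<close>.\<close>
definition marked :: "nat \<Rightarrow> nat set set \<Rightarrow> nat \<Rightarrow> (((nat \<Rightarrow> nat) \<times> nat) \<times> nat) set" where
  "marked n F k = Sigma (chain_index n) (\<lambda>\<omega>. {t. t + k \<le> card (lvls n F \<omega>)})"

definition mark :: "nat \<Rightarrow> nat set set \<Rightarrow> nat \<Rightarrow> ((nat \<Rightarrow> nat) \<times> nat) \<times> nat \<Rightarrow> nat set" where
  "mark n F j m = fst (fst m) ` {..<sorted_list_of_set (lvls n F (fst m)) ! (snd m + j)}"

lemma finite_lvls [simp]: "finite (lvls n F \<omega>)"
  unfolding lvls_def by (rule finite_subset[of _ "{..n}"]) auto

lemma finite_chain_index [simp]: "finite (chain_index n)"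
  unfolding chain_index_def using finite_permutations[of "{..<n}"] by simp

lemma finite_marked [simp]: "finite (marked n F k)"
proof -
  have "finite {t. t + k \<le> c}" for c :: nat by (rule finite_subset[of _ "{..c}"]) auto
  then show ?thesis unfolding marked_def by (intro finite_SigmaI) auto
qed

lemma mark_level:
  assumes m: "m \<in> marked n F k" and j: "j < k"
  defines "i \<equiv> sorted_list_of_set (lvls n F (fst m)) ! (snd m + j)"
  shows "i \<in> lvls n F (fst m)" "mark n F j m = fst (fst m) ` {..<i}" "card (mark n F j m) = i"
    "fst (fst m) permutes {..<n}" "mark n F j m \<in> F" "fst (fst m) \<in> fiber n (mark n F j m)"
    "snd (fst m) \<in> {1..n choose card (mark n F j m)}" "card (mark n F j m) \<le> n"
proof -
  have "snd m + j < length (sorted_list_of_set (lvls n F (fst m)))"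
    using m j by (auto simp: marked_def)
  then have "i \<in> set (sorted_list_of_set (lvls n F (fst m)))" unfolding i_def by (rule nth_mem)
  then show i: "i \<in> lvls n F (fst m)" by simp
  show e: "mark n F j m = fst (fst m) ` {..<i}" by (simp add: mark_def i_def)
  show p: "fst (fst m) permutes {..<n}" using m by (auto simp: marked_def chain_index_def)
  show c: "card (mark n F j m) = i" unfolding e using card_image_permutes[OF p, of "{..<i}"] by simp
  show "mark n F j m \<in> F" using i unfolding e by (simp add: lvls_def)
  show "fst (fst m) \<in> fiber n (mark n F j m)" unfolding fiber_def c using p e by simp
  show "snd (fst m) \<in> {1..n choose card (mark n F j m)}"
    using m i unfolding c by (auto simp: marked_def chain_index_def lvls_def)
  show "card (mark n F j m) \<le> n" using i unfolding c by (simp add: lvls_def)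
qed

lemma mark_chain:
  assumes m: "m \<in> marked n F k" and ij: "i < j" "j < k"
  shows "mark n F i m \<subset> mark n F j m"
proof -
  have "i < k" using ij by simp
  note li = mark_level[OF m this] and lj = mark_level[OF m ij(2)]
  have "snd m + j < length (sorted_list_of_set (lvls n F (fst m)))"
    using m ij by (auto simp: marked_def)
  then have lt: "sorted_list_of_set (lvls n F (fst m)) ! (snd m + i) < sorted_list_of_set (lvls n F (fst m)) ! (snd m + j)"
    using ij by (intro sorted_wrt_nth_less[OF strict_sorted_list_of_set]) auto
  then have "mark n F i m \<subseteq> mark n F j m"
    unfolding li(2) lj(2) by (intro image_mono) auto
  moreover have "card (mark n F i m) < card (mark n F j m)" using lt unfolding li(3) lj(3) .
  ultimately show ?thesis by auto
qed

text \<open>A window whose member number \<open>j\<close> is \<open>x\<close> is determined by its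
  truncated chain, because the start \<open>t\<close> is forced by the place of
  \<open>card x\<close> in the sorted list of levels. The chain lies in \<open>fiber n x\<close>,
  and \<open>n choose card x\<close> thresholds are admissible.\<close>

lemma card_marked_le:
  assumes j: "j < k" and x: "x \<subseteq> {..<n}"
    and R: "\<And>m. m \<in> marked n F k \<Longrightarrow> mark n F j m = x \<Longrightarrow> P m \<Longrightarrow> R (fst (fst m))"
  shows "card {m\<in>marked n F k. mark n F j m = x \<and> P m} \<le> card {\<pi>\<in>fiber n x. R \<pi>} * (n choose card x)"
proof -
  let ?S = "{m\<in>marked n F k. mark n F j m = x \<and> P m}"
  have inj: "inj_on fst ?S"
  proof (rule inj_onI)
    fix m m' assume m: "m \<in> ?S" "m' \<in> ?S" "fst m = fst m'"
    let ?L = "sorted_list_of_set (lvls n F (fst m))"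
    have "?L ! (snd m + j) = card x" "?L ! (snd m' + j) = card x"
      using m mark_level(3)[OF _ j, of m n F] mark_level(3)[OF _ j, of m' n F] by auto
    moreover have "snd m + j < length ?L" "snd m' + j < length ?L"
      using m j by (auto simp: marked_def)
    ultimately have "snd m + j = snd m' + j"
      using nth_eq_iff_index_eq[of ?L "snd m + j" "snd m' + j"] by simp
    then show "m = m'" using m(3) by (simp add: prod_eq_iff)
  qed
  have "fst ` ?S \<subseteq> {\<pi>\<in>fiber n x. R \<pi>} \<times> {1..n choose card x}"
  proof
    fix \<omega> assume "\<omega> \<in> fst ` ?S"
    then obtain m where m: "m \<in> marked n F k" "mark n F j m = x" "P m" "\<omega> = fst m" by auto
    show "\<omega> \<in> {\<pi>\<in>fiber n x. R \<pi>} \<times> {1..n choose card x}"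
      using mark_level(6,7)[OF m(1) j] R[OF m(1-3)] m(2,4) by (auto simp: mem_Times_iff)
  qed
  then have "card (fst ` ?S) \<le> card ({\<pi>\<in>fiber n x. R \<pi>} \<times> {1..n choose card x})"
    by (intro card_mono) auto
  then show ?thesis using card_image[OF inj] by (simp add: card_cartesian_product)
qed

text \<open>Truncation makes the incidence count independent of the level: each member of
  \<open>F\<close> lies on exactly \<open>fact n\<close> of the
  \<open>fact n * (n choose (n div 2))\<close> truncated chains. A chain meeting \<open>F\<close> in
  \<open>s\<close> sets has at least \<open>s - (k - 1)\<close> windows.\<close>

lemma card_marked_ge:
  assumes F: "F \<subseteq> Pow {..<n}" and k: "0 < k"
  shows "fact n * (real (card F) - (real k - 1) * real (n choose (n div 2))) \<le> card (marked n F k)"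
proof -
  have fF: "finite F" using F finite_subset by blast
  have cx: "card x \<le> n" "x \<subseteq> {..<n}" if "x \<in> F" for x
    using that F by (auto simp: subset_iff intro!: card_mono[of "{..<n}" x, simplified])
  have lv: "card (lvls n F (\<pi>, \<tau>)) = card {x\<in>F. \<pi> \<in> fiber n x \<and> \<tau> \<le> n choose card x}"
    if \<pi>: "\<pi> permutes {..<n}" for \<pi> \<tau>
  proof (rule bij_betw_same_card)
    have c: "card (\<pi> ` {..<i}) = i" for i using card_image_permutes[OF \<pi>, of "{..<i}"] by simp
    show "bij_betw (\<lambda>i. \<pi> ` {..<i}) (lvls n F (\<pi>, \<tau>)) {x\<in>F. \<pi> \<in> fiber n x \<and> \<tau> \<le> n choose card x}"
    proof (rule bij_betw_byWitness[where f' = card])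
      show "\<forall>x\<in>{x\<in>F. \<pi> \<in> fiber n x \<and> \<tau> \<le> n choose card x}. \<pi> ` {..<card x} = x"
        by (auto simp: fiber_def)
      show "card ` {x\<in>F. \<pi> \<in> fiber n x \<and> \<tau> \<le> n choose card x} \<subseteq> lvls n F (\<pi>, \<tau>)"
        using cx by (auto simp: fiber_def lvls_def)
    qed (use c \<pi> in \<open>auto simp: fiber_def lvls_def\<close>)
  qed
  have "(\<Sum>\<omega>\<in>chain_index n. card (lvls n F \<omega>)) = (\<Sum>\<omega>\<in>chain_index n. card {x\<in>F. fst \<omega> \<in> fiber n x \<and> snd \<omega> \<le> n choose card x})"
    using lv by (intro sum.cong) (auto simp: chain_index_def)
  also have "\<dots> = (\<Sum>x\<in>F. card {\<omega>\<in>chain_index n. fst \<omega> \<in> fiber n x \<and> snd \<omega> \<le> n choose card x})"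
    using sum.swap_restrict[OF finite_chain_index fF, of "\<lambda>_ _. 1::nat" "\<lambda>\<omega> x. fst \<omega> \<in> fiber n x \<and> snd \<omega> \<le> n choose card x"]
    by simp
  also have "\<dots> = (\<Sum>x\<in>F. fact n)"
  proof (rule sum.cong[OF refl])
    fix x assume x: "x \<in> F"
    have "{\<omega>\<in>chain_index n. fst \<omega> \<in> fiber n x \<and> snd \<omega> \<le> n choose card x} = fiber n x \<times> {1..n choose card x}"
      using binomial_maximum[of n "card x"] by (auto simp: chain_index_def fiber_def intro: order_trans)
    then show "card {\<omega>\<in>chain_index n. fst \<omega> \<in> fiber n x \<and> snd \<omega> \<le> n choose card x} = fact n"
      using card_fiber[OF cx(2)[OF x]] by (simp add: card_cartesian_product)
  qed
  finally have tot: "(\<Sum>\<omega>\<in>chain_index n. card (lvls n F \<omega>)) = card F * fact n" by simp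
  have cc: "card (chain_index n) = fact n * (n choose (n div 2))"
    unfolding chain_index_def using card_permutations[of "{..<n}" n] by (simp add: card_cartesian_product)
  have "real (card (marked n F k)) = (\<Sum>\<omega>\<in>chain_index n. real (card {t. t + k \<le> card (lvls n F \<omega>)}))"
  proof -
    have "finite {t. t + k \<le> c}" for c :: nat by (rule finite_subset[of _ "{..c}"]) auto
    then show ?thesis unfolding marked_def by (subst card_SigmaI) auto
  qed
  also have "\<dots> \<ge> (\<Sum>\<omega>\<in>chain_index n. real (card (lvls n F \<omega>)) - (real k - 1))"
  proof (rule sum_mono)
    fix \<omega>
    \<comment> \<open>For fewer than \<open>k\<close> levels the natural subtraction gives
      \<open>0\<close>, while the real bound derived from it is not positive.\<close>
    have "card {t. t + k \<le> card (lvls n F \<omega>)} \<ge> card (lvls n F \<omega>) + 1 - k"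
    proof -
      have "{..<card (lvls n F \<omega>) + 1 - k} \<subseteq> {t. t + k \<le> card (lvls n F \<omega>)}" by auto
      moreover have "finite {t. t + k \<le> c}" for c :: nat by (rule finite_subset[of _ "{..c}"]) auto
      ultimately show ?thesis using card_mono by (metis card_lessThan)
    qed
    then show "real (card (lvls n F \<omega>)) - (real k - 1) \<le> real (card {t. t + k \<le> card (lvls n F \<omega>)})"
      by linarith
  qed
  also have "(\<Sum>\<omega>\<in>chain_index n. real (card (lvls n F \<omega>)) - (real k - 1)) =
    real (\<Sum>\<omega>\<in>chain_index n. card (lvls n F \<omega>)) - (real k - 1) * card (chain_index n)"
    by (simp add: sum_subtractf)
  also have "\<dots> = fact n * (real (card F) - (real k - 1) * real (n choose (n div 2)))"
    unfolding tot cc by (simp add: algebra_simps)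
  finally show ?thesis by simp
qed

text \<open>A maximiser of the number of marked chains minus \<open>t\<close> times the number of used
  (position, set) pairs uses no pair fewer than \<open>t\<close> times.\<close>
lemma discard_rare_positions:
  fixes a :: "nat \<Rightarrow> 'm \<Rightarrow> 'v" and t :: real and k :: nat
  assumes M: "finite M" and F: "finite F" and a: "\<And>m j. m \<in> M \<Longrightarrow> j < k \<Longrightarrow> a j m \<in> F" and t: "0 \<le> t"
  shows "\<exists>M'\<subseteq>M. (\<forall>m\<in>M'. \<forall>j<k. t \<le> card {m'\<in>M'. a j m' = a j m}) \<and> real (card M) - k * t * card F \<le> card M'"
proof -
  define U where "U = (\<lambda>N. {(j, x). j < k \<and> (\<exists>m\<in>N. a j m = x)})"
  define \<phi> where "\<phi> = (\<lambda>N. real (card N) - t * card (U N))"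
  have U: "U N \<subseteq> {..<k} \<times> F" if "N \<subseteq> M" for N using that a unfolding U_def by auto
  have fU: "finite (U N)" if "N \<subseteq> M" for N using U[OF that] F finite_subset by (metis finite_SigmaI finite_lessThan)
  have "finite (Pow M)" "Pow M \<noteq> {}" using M by auto
  then have B: "finite (\<phi> ` Pow M)" "\<phi> ` Pow M \<noteq> {}" by blast+
  from Max_in[OF B] obtain M' where max: "Max (\<phi> ` Pow M) = \<phi> M'" and M': "M' \<in> Pow M" by (rule imageE)
  have best: "\<phi> N \<le> \<phi> M'" if "N \<subseteq> M" for N using Max_ge[OF B(1) imageI[of N "Pow M"]] that unfolding max by simp
  have sub: "M' \<subseteq> M" and fM': "finite M'" using M' M finite_subset by auto
  have "t \<le> card {m'\<in>M'. a j m' = a j m}" if m: "m \<in> M'" and j: "j < k" for m j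
  proof (rule ccontr)
    assume less: "\<not> ?thesis"
    \<comment> \<open>Dropping everything that uses the rare pair \<open>(j, a j m)\<close> loses
      fewer than \<open>t\<close> chains but frees at least one pair, so it would increase
      \<open>\<phi>\<close>.\<close>
    let ?R = "{m'\<in>M'. a j m' = a j m}"
    let ?N = "M' - ?R"
    have "U ?N \<subseteq> U M' - {(j, a j m)}" unfolding U_def by auto
    moreover have "(j, a j m) \<in> U M'" unfolding U_def using m j by auto
    ultimately have "card (U ?N) \<le> card (U M') - 1" "card (U M') > 0"
      using fU[OF sub] card_mono[of "U M' - {(j, a j m)}" "U ?N"] by (auto simp: card_gt_0_iff)
    then have "real (card (U ?N)) \<le> real (card (U M')) - 1" by linarith
    then have "t * card (U ?N) \<le> t * (real (card (U M')) - 1)" using t by (intro mult_left_mono) auto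
    moreover have "real (card ?N) = real (card M') - real (card ?R)"
      using fM' by (subst card_Diff_subset) (auto intro!: of_nat_diff card_mono)
    ultimately have "\<phi> ?N \<ge> \<phi> M' - card ?R + t" unfolding \<phi>_def by (simp add: algebra_simps)
    moreover have "\<phi> ?N \<le> \<phi> M'" using sub by (intro best) auto
    ultimately show False using less by linarith
  qed
  moreover have "real (card M) - k * t * card F \<le> card M'"
  proof -
    have "card (U M) \<le> card ({..<k} \<times> F)" using U[of M] F by (intro card_mono) auto
    then have "real (card (U M)) \<le> k * card F" by (simp add: card_cartesian_product flip: of_nat_mult)
    then have "t * card (U M) \<le> t * (k * card F)" using t by (intro mult_left_mono) auto
    then have "real (card M) - k * t * card F \<le> \<phi> M" unfolding \<phi>_def by (simp add: mult_ac)
    also have "\<dots> \<le> \<phi> M'" by (rule best) simp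
    also have "\<dots> \<le> card M'" unfolding \<phi>_def using t by simp
    finally show ?thesis .
  qed
  ultimately show ?thesis using sub by blast
qed

lemma card_marked_at:
  assumes F: "F \<subseteq> Pow {..<n}" and j: "j < k"
  shows "card {m\<in>marked n F k. mark n F j m = x} \<le> fact n"
proof (cases "x \<in> F")
  case True
  then have x: "x \<subseteq> {..<n}" using F by auto
  show ?thesis using card_marked_le[OF j x, of F "\<lambda>_. True" "\<lambda>_. True"] card_fiber[OF x] by simp
next
  case False
  then have e: "{m\<in>marked n F k. mark n F j m = x} = {}" using mark_level(5)[OF _ j] by auto
  show ?thesis unfolding e by simp
qed

text \<open>Put \<open>p = n - card x\<close> and \<open>d = card y - card x\<close>. A chain
  through \<open>x\<close> reaches \<open>y\<close> with probability at most the reciprocal of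
  \<open>p choose d\<close>. Since \<open>g \<le> d\<close> and, by \<open>narrow\<close>,
  \<open>2 * d \<le> p\<close>, this coefficient is at least \<open>p choose g\<close>, hence at
  least \<open>(p / g) ^ g\<close>: a larger gap makes pairs rarer.\<close>

lemma card_marked_pair:
  assumes F: "F \<subseteq> Pow {..<n}" and ij: "i < j" "j < k"
    and lev: "\<And>x. x \<in> F \<Longrightarrow> l \<le> card x" "\<And>x. x \<in> F \<Longrightarrow> card x \<le> h" and h: "h < n"
    and gap: "\<And>x y. x \<in> F \<Longrightarrow> y \<in> F \<Longrightarrow> card x < card y \<Longrightarrow> card x + g \<le> card y" and g: "0 < g"
    and narrow: "2 * (h - l) \<le> n - h"
  shows "real (card {m\<in>marked n F k. mark n F i m = x \<and> mark n F j m = y}) \<le> fact n * (g / (real n - real h)) ^ g"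
proof (cases "{m\<in>marked n F k. mark n F i m = x \<and> mark n F j m = y} = {}")
  case True
  show ?thesis unfolding True using h by simp
next
  case False
  have ik: "i < k" using ij by simp
  from False obtain m where m: "m \<in> marked n F k" "mark n F i m = x" "mark n F j m = y" by auto
  have xF: "x \<in> F" and yF: "y \<in> F" using mark_level(5)[OF m(1) ik] mark_level(5)[OF m(1) ij(2)] m by auto
  have xy: "x \<subset> y" using mark_chain[OF m(1) ij] m by simp
  have x: "x \<subseteq> {..<n}" and y: "y \<subseteq> {..<n}" using xF yF F by auto
  have "finite y" using y finite_subset by blast
  then have cxy: "card x < card y" using xy by (rule psubset_card_mono)
  define p d where "p = n - card x" and "d = card y - card x"
  have d: "g \<le> d" "2 * d \<le> p" "n - h \<le> p"
    using gap[OF xF yF cxy] lev(1)[OF xF] lev(2)[OF xF] lev(2)[OF yF] narrow unfolding p_def d_def by auto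
  have "((real n - real h) / g) ^ g \<le> (real p / g) ^ g"
    using d h g by (intro power_mono divide_right_mono) auto
  also have "\<dots> \<le> real (p choose g)" using d binomial_ge_n_over_k_pow_k[of g p] by simp
  also have "\<dots> \<le> real (p choose d)" using d binomial_mono[of g d p] by simp
  finally have B: "((real n - real h) / g) ^ g \<le> real (p choose d)" .
  let ?N = "card (fiber n x \<inter> fiber n y)"
  have "card {m\<in>marked n F k. mark n F i m = x \<and> mark n F j m = y} \<le> card {\<pi>\<in>fiber n x. \<pi> \<in> fiber n y} * (n choose card x)"
    by (rule card_marked_le[OF ik x]) (use mark_level(6)[OF _ ij(2)] in auto)
  also have "{\<pi>\<in>fiber n x. \<pi> \<in> fiber n y} = fiber n x \<inter> fiber n y" by auto
  finally have "real (card {m\<in>marked n F k. mark n F i m = x \<and> mark n F j m = y}) \<le> real (?N * (n choose card x))"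
    by (simp only: of_nat_le_iff)
  also have "real (?N * (n choose card x)) \<le> fact n / ((real n - real h) / g) ^ g"
  proof -
    have "?N * (p choose d) * (n choose card x) \<le> card (fiber n x) * (n choose card x)"
      using card_fiber_pair[of x y n] xy y unfolding p_def d_def by (intro mult_right_mono) auto
    then have "real (?N * (p choose d) * (n choose card x)) \<le> real (fact n)"
      unfolding card_fiber[OF x] by (simp only: of_nat_le_iff)
    moreover have "real ?N * real (n choose card x) * ((real n - real h) / g) ^ g
      \<le> real ?N * real (n choose card x) * real (p choose d)"
      using B by (intro mult_left_mono) auto
    ultimately have "real ?N * real (n choose card x) * ((real n - real h) / g) ^ g \<le> fact n"
      by (simp add: mult_ac)
    moreover have "0 < ((real n - real h) / g) ^ g" using h g by simp
    ultimately show ?thesis by (simp only: pos_le_divide_eq of_nat_mult)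
  qed
  also have "\<dots> = fact n * (g / (real n - real h)) ^ g" by (simp add: power_divide)
  finally show ?thesis .
qed

text \<open>A later member comparable to \<open>z\<close> forces one of two unlikely events. If it
  contains \<open>z\<close>, the chain has acquired a fixed element of \<open>z - x\<close> by level
  \<open>h\<close>. If it lies inside \<open>z\<close>, then \<open>x \<subseteq> z\<close> and the
  very next element after \<open>x\<close> is one of the at most \<open>h - l\<close> elements of
  \<open>z - x\<close>. Each has probability at most \<open>(h - l) / (n - card x)\<close>, whence
  the factor 2.\<close>

lemma card_marked_comparable_above:
  assumes F: "F \<subseteq> Pow {..<n}" and ij: "i < j" "j < k"
    and lev: "\<And>x. x \<in> F \<Longrightarrow> l \<le> card x" "\<And>x. x \<in> F \<Longrightarrow> card x \<le> h" and h: "h < n"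
    and \<beta>: "2 * (real h - real l) \<le> \<beta> * (real n - real h)" "0 \<le> \<beta>"
    and xz: "x \<in> F" "z \<in> F" "\<not> z \<subseteq> x"
  shows "real (card {m\<in>marked n F k. mark n F i m = x \<and> (mark n F j m \<subseteq> z \<or> z \<subseteq> mark n F j m)}) \<le> fact n * \<beta>"
proof -
  have ik: "i < k" using ij by simp
  have x: "x \<subseteq> {..<n}" and z: "z \<subseteq> {..<n}" using xz F by auto
  have fz: "finite z" using z finite_subset by blast
  have cx: "card x \<le> h" "l \<le> card x" "card z \<le> h" using lev xz by auto
  obtain a\<^sub>0 where a\<^sub>0: "a\<^sub>0 \<in> z" "a\<^sub>0 \<notin> x" using xz by auto
  define R where "R \<pi> \<longleftrightarrow> a\<^sub>0 \<in> \<pi> ` {..<h} \<or> (x \<subseteq> z \<and> (\<exists>a\<in>z - x. a \<in> \<pi> ` {..<Suc (card x)}))" for \<pi> :: "nat \<Rightarrow> nat"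
  define f where "f = card (fiber n x)"
  have le: "card {m\<in>marked n F k. mark n F i m = x \<and> (mark n F j m \<subseteq> z \<or> z \<subseteq> mark n F j m)}
    \<le> card {\<pi>\<in>fiber n x. R \<pi>} * (n choose card x)"
  proof (rule card_marked_le[OF ik x])
    fix m assume m: "m \<in> marked n F k" "mark n F i m = x" "mark n F j m \<subseteq> z \<or> z \<subseteq> mark n F j m"
    note li = mark_level[OF m(1) ik] and lj = mark_level[OF m(1) ij(2)]
    let ?\<pi> = "fst (fst m)"
    have yx: "x \<subset> mark n F j m" using mark_chain[OF m(1) ij] m(2) by simp
    have yeq: "mark n F j m = ?\<pi> ` {..<card (mark n F j m)}" using lj(6) by (simp add: fiber_def)
    have xeq: "x = ?\<pi> ` {..<card x}" using li(6) m(2) by (simp add: fiber_def)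
    from m(3) show "R ?\<pi>"
    proof
      assume "z \<subseteq> mark n F j m"
      moreover have "mark n F j m \<subseteq> ?\<pi> ` {..<h}"
        using lev(2)[OF lj(5)] by (subst yeq, intro image_mono) simp
      ultimately show ?thesis unfolding R_def using a\<^sub>0 by blast
    next
      assume yz: "mark n F j m \<subseteq> z"
      have "finite (mark n F j m)" using yz fz finite_subset by blast
      then have "card x < card (mark n F j m)" using yx by (rule psubset_card_mono)
      then have "?\<pi> (card x) \<in> mark n F j m" by (subst yeq) auto
      moreover have "?\<pi> (card x) \<notin> x"
        using permutes_inj[OF li(4)] by (subst xeq) (auto simp: inj_eq)
      ultimately show ?thesis unfolding R_def using yz yx by (auto intro!: disjI2 bexI[of _ "?\<pi> (card x)"])
    qed
  qed
  have "card {\<pi>\<in>fiber n x. R \<pi>} * (n - card x) \<le> (2 * (h - l)) * f"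
  proof -
    let ?A = "{\<pi>\<in>fiber n x. a\<^sub>0 \<in> \<pi> ` {..<h}}"
    let ?B = "\<lambda>a. {\<pi>\<in>fiber n x. a \<in> \<pi> ` {..<Suc (card x)}}"
    have A: "card ?A * (n - card x) \<le> (h - l) * f"
    proof -
      have "card ?A * (n - card x) = (h - card x) * f"
        unfolding f_def using a\<^sub>0 z h cx by (intro card_fiber_above[OF x]) auto
      moreover have "h - card x \<le> h - l" using cx(2) by (rule diff_le_mono2)
      ultimately show ?thesis by (simp only: mult_le_mono1)
    qed
    have B: "card (?B a) * (n - card x) = f" if "a \<in> z - x" for a
      using card_fiber_above[OF x, of a "Suc (card x)"] that z h cx unfolding f_def by auto
    show ?thesis
    proof (cases "x \<subseteq> z")
      case False
      then have "{\<pi>\<in>fiber n x. R \<pi>} = ?A" unfolding R_def by auto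
      then have "card {\<pi>\<in>fiber n x. R \<pi>} * (n - card x) \<le> (h - l) * f" using A by simp
      also have "\<dots> \<le> (2 * (h - l)) * f" by simp
      finally show ?thesis .
    next
      case True
      have "{\<pi>\<in>fiber n x. R \<pi>} = ?A \<union> (\<Union>a\<in>z - x. ?B a)" unfolding R_def using True by auto
      then have "card {\<pi>\<in>fiber n x. R \<pi>} \<le> card ?A + card (\<Union>a\<in>z - x. ?B a)"
        by (simp only: card_Un_le)
      also have "\<dots> \<le> card ?A + (\<Sum>a\<in>z - x. card (?B a))"
        using fz by (intro add_left_mono card_UN_le) auto
      finally have "card {\<pi>\<in>fiber n x. R \<pi>} * (n - card x) \<le> (card ?A + (\<Sum>a\<in>z - x. card (?B a))) * (n - card x)"
        by (rule mult_right_mono) simp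
      also have "\<dots> = card ?A * (n - card x) + (\<Sum>a\<in>z - x. card (?B a) * (n - card x))"
        by (simp add: distrib_right sum_distrib_right)
      also have "(\<Sum>a\<in>z - x. card (?B a) * (n - card x)) = card (z - x) * f"
        using B by (subst sum.cong[OF refl B]) auto
      also have "card (z - x) \<le> h - l"
        using True cx card_Diff_subset[OF finite_subset[OF True fz] True] by simp
      finally show ?thesis using A by (simp add: distrib_right)
    qed
  qed
  then have "real (card {\<pi>\<in>fiber n x. R \<pi>}) * (real n - real (card x)) \<le> 2 * (real h - real l) * f"
  proof -
    assume "card {\<pi>\<in>fiber n x. R \<pi>} * (n - card x) \<le> (2 * (h - l)) * f"
    then have "real (card {\<pi>\<in>fiber n x. R \<pi>} * (n - card x)) \<le> real ((2 * (h - l)) * f)"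
      by (simp only: of_nat_le_iff)
    then show ?thesis using cx h by (simp add: of_nat_diff)
  qed
  also have "\<dots> \<le> \<beta> * (real n - real (card x)) * f"
    using \<beta> cx mult_left_mono[of "real n - real h" "real n - real (card x)" \<beta>] by (intro mult_right_mono) auto
  finally have "real (card {\<pi>\<in>fiber n x. R \<pi>}) \<le> \<beta> * f" using cx h by simp
  then have "real (card {\<pi>\<in>fiber n x. R \<pi>}) * (n choose card x) \<le> \<beta> * f * (n choose card x)"
    by (intro mult_right_mono) auto
  also have "\<dots> = \<beta> * real (f * (n choose card x))" by simp
  also have "\<dots> = \<beta> * fact n" unfolding f_def card_fiber[OF x] by simp
  finally have "real (card {\<pi>\<in>fiber n x. R \<pi>} * (n choose card x)) \<le> fact n * \<beta>" by (simp add: mult_ac)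
  moreover have "real (card {m\<in>marked n F k. mark n F i m = x \<and> (mark n F j m \<subseteq> z \<or> z \<subseteq> mark n F j m)})
    \<le> real (card {\<pi>\<in>fiber n x. R \<pi>} * (n choose card x))" using le by (simp only: of_nat_le_iff)
  ultimately show ?thesis by linarith
qed

text \<open>Dual, walking down from \<open>x\<close>: either a fixed element of \<open>x - z\<close>
  is absent at level \<open>l\<close>, or \<open>z \<subseteq> x\<close> and the last element
  acquired by \<open>x\<close> lies outside \<open>z\<close>. The denominator is now
  \<open>card x\<close>, hence the comparison with \<open>l\<close>.\<close>

lemma card_marked_comparable_below:
  assumes F: "F \<subseteq> Pow {..<n}" and ij: "i < j" "j < k"
    and lev: "\<And>x. x \<in> F \<Longrightarrow> l \<le> card x" "\<And>x. x \<in> F \<Longrightarrow> card x \<le> h" and l: "0 < l"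
    and \<beta>: "2 * (real h - real l) \<le> \<beta> * real l" "0 \<le> \<beta>"
    and xz: "x \<in> F" "z \<in> F" "\<not> x \<subseteq> z"
  shows "real (card {m\<in>marked n F k. mark n F j m = x \<and> (mark n F i m \<subseteq> z \<or> z \<subseteq> mark n F i m)}) \<le> fact n * \<beta>"
proof -
  have ik: "i < k" using ij by simp
  have x: "x \<subseteq> {..<n}" and z: "z \<subseteq> {..<n}" using xz F by auto
  have fx: "finite x" using x finite_subset by blast
  have cx: "card x \<le> h" "l \<le> card x" "l \<le> card z" using lev xz by auto
  obtain a\<^sub>0 where a\<^sub>0: "a\<^sub>0 \<in> x" "a\<^sub>0 \<notin> z" using xz by auto
  define R where "R \<pi> \<longleftrightarrow> a\<^sub>0 \<notin> \<pi> ` {..<l} \<or> (z \<subseteq> x \<and> (\<exists>a\<in>x - z. a \<notin> \<pi> ` {..<card x - 1}))" for \<pi> :: "nat \<Rightarrow> nat"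
  define f where "f = card (fiber n x)"
  have le: "card {m\<in>marked n F k. mark n F j m = x \<and> (mark n F i m \<subseteq> z \<or> z \<subseteq> mark n F i m)}
    \<le> card {\<pi>\<in>fiber n x. R \<pi>} * (n choose card x)"
  proof (rule card_marked_le[OF ij(2) x])
    fix m assume m: "m \<in> marked n F k" "mark n F j m = x" "mark n F i m \<subseteq> z \<or> z \<subseteq> mark n F i m"
    note li = mark_level[OF m(1) ik] and lj = mark_level[OF m(1) ij(2)]
    let ?\<pi> = "fst (fst m)"
    have yx: "mark n F i m \<subset> x" using mark_chain[OF m(1) ij] m(2) by simp
    have yeq: "mark n F i m = ?\<pi> ` {..<card (mark n F i m)}" using li(6) by (simp add: fiber_def)
    have xeq: "x = ?\<pi> ` {..<card x}" using lj(6) m(2) by (simp add: fiber_def)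
    from m(3) show "R ?\<pi>"
    proof
      assume "mark n F i m \<subseteq> z"
      moreover have "?\<pi> ` {..<l} \<subseteq> mark n F i m"
        using lev(1)[OF li(5)] by (subst yeq, intro image_mono) simp
      ultimately show ?thesis unfolding R_def using a\<^sub>0 by blast
    next
      assume yz: "z \<subseteq> mark n F i m"
      have lt: "card (mark n F i m) < card x" using fx yx by (rule psubset_card_mono)
      have "?\<pi> (card x - 1) \<in> x" using lt by (subst xeq) auto
      moreover have "?\<pi> (card x - 1) \<notin> mark n F i m"
        using permutes_inj[OF li(4)] lt by (subst yeq) (auto simp: inj_eq)
      moreover have "?\<pi> (card x - 1) \<notin> ?\<pi> ` {..<card x - 1}"
        using permutes_inj[OF li(4)] by (auto simp: inj_eq)
      ultimately show ?thesis unfolding R_def using yz yx by (auto intro!: disjI2 bexI[of _ "?\<pi> (card x - 1)"])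
    qed
  qed
  have "card {\<pi>\<in>fiber n x. R \<pi>} * card x \<le> (2 * (h - l)) * f"
  proof -
    let ?A = "{\<pi>\<in>fiber n x. a\<^sub>0 \<notin> \<pi> ` {..<l}}"
    let ?B = "\<lambda>a. {\<pi>\<in>fiber n x. a \<notin> \<pi> ` {..<card x - 1}}"
    have A: "card ?A * card x \<le> (h - l) * f"
    proof -
      have "card ?A * card x = (card x - l) * f"
        unfolding f_def using a\<^sub>0 cx by (intro card_fiber_below[OF x]) auto
      moreover have "card x - l \<le> h - l" using cx(1) by (rule diff_le_mono)
      ultimately show ?thesis by (simp only: mult_le_mono1)
    qed
    have B: "card (?B a) * card x = f" if "a \<in> x - z" for a
      using card_fiber_below[OF x, of a "card x - 1"] that l cx unfolding f_def by auto
    show ?thesis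
    proof (cases "z \<subseteq> x")
      case False
      then have "{\<pi>\<in>fiber n x. R \<pi>} = ?A" unfolding R_def by auto
      then have "card {\<pi>\<in>fiber n x. R \<pi>} * card x \<le> (h - l) * f" using A by simp
      also have "\<dots> \<le> (2 * (h - l)) * f" by simp
      finally show ?thesis .
    next
      case True
      have "{\<pi>\<in>fiber n x. R \<pi>} = ?A \<union> (\<Union>a\<in>x - z. ?B a)" unfolding R_def using True by auto
      then have "card {\<pi>\<in>fiber n x. R \<pi>} \<le> card ?A + card (\<Union>a\<in>x - z. ?B a)"
        by (simp only: card_Un_le)
      also have "\<dots> \<le> card ?A + (\<Sum>a\<in>x - z. card (?B a))"
        using fx by (intro add_left_mono card_UN_le) auto
      finally have "card {\<pi>\<in>fiber n x. R \<pi>} * card x \<le> (card ?A + (\<Sum>a\<in>x - z. card (?B a))) * card x"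
        by (rule mult_right_mono) simp
      also have "\<dots> = card ?A * card x + (\<Sum>a\<in>x - z. card (?B a) * card x)"
        by (simp add: distrib_right sum_distrib_right)
      also have "(\<Sum>a\<in>x - z. card (?B a) * card x) = card (x - z) * f"
        using B by (subst sum.cong[OF refl B]) auto
      also have "card (x - z) \<le> h - l"
        using cx card_Diff_subset[OF finite_subset[OF True fx] True] by simp
      finally show ?thesis using A by (simp add: distrib_right)
    qed
  qed
  then have "real (card {\<pi>\<in>fiber n x. R \<pi>} * card x) \<le> real ((2 * (h - l)) * f)"
    by (simp only: of_nat_le_iff)
  then have "real (card {\<pi>\<in>fiber n x. R \<pi>}) * real (card x) \<le> 2 * (real h - real l) * f"
    using cx by (simp add: of_nat_diff)
  also have "\<dots> \<le> \<beta> * real (card x) * f"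
    using \<beta> cx mult_left_mono[of "real l" "real (card x)" \<beta>] by (intro mult_right_mono) auto
  finally have "real (card {\<pi>\<in>fiber n x. R \<pi>}) \<le> \<beta> * f" using cx l by simp
  then have "real (card {\<pi>\<in>fiber n x. R \<pi>}) * (n choose card x) \<le> \<beta> * f * (n choose card x)"
    by (intro mult_right_mono) auto
  also have "\<dots> = \<beta> * real (f * (n choose card x))" by simp
  also have "\<dots> = \<beta> * fact n" unfolding f_def card_fiber[OF x] by simp
  finally have "real (card {\<pi>\<in>fiber n x. R \<pi>} * (n choose card x)) \<le> fact n * \<beta>" by (simp add: mult_ac)
  moreover have "real (card {m\<in>marked n F k. mark n F j m = x \<and> (mark n F i m \<subseteq> z \<or> z \<subseteq> mark n F i m)})
    \<le> real (card {\<pi>\<in>fiber n x. R \<pi>} * (n choose card x))" using le by (simp only: of_nat_le_iff)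
  ultimately show ?thesis by linarith
qed

section \<open>Low conditional marginals for tree posets\<close>

text \<open>The tree measure supplies the weighted edges for \<open>low_marginal\<close>. The family
  \<open>F\<close> that carries the edges may be smaller than the container \<open>V\<close> on
  which marginals are taken; this leaves room for restricting the edges to sparse levels, where a
  larger gap \<open>g\<close> weakens the lower bound required of \<open>q\<close>.\<close>

lemma tree_poset_low_marginal:
  fixes V F :: "nat set set" and c q \<beta> \<delta> :: real
  assumes tree: "is_tree_poset X le" and V: "finite V" "F \<subseteq> V"
    and F: "F \<subseteq> Pow {..<n}" "F \<noteq> {}"
    and lev: "\<And>x. x \<in> F \<Longrightarrow> l \<le> card x" "\<And>x. x \<in> F \<Longrightarrow> card x \<le> h" and lh: "0 < l" "h < n"
    and gap: "\<And>x y. x \<in> F \<Longrightarrow> y \<in> F \<Longrightarrow> card x < card y \<Longrightarrow> card x + g \<le> card y" and g: "0 < g"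
    and narrow: "2 * (h - l) \<le> n - h"
    and \<beta>: "2 * (real h - real l) \<le> \<beta> * (real n - real h)" "2 * (real h - real l) \<le> \<beta> * real l" "0 \<le> \<beta>"
    and c: "0 < c" "2 * card X * \<beta> \<le> c"
    and dense: "2 * real (height X le) * c * card F \<le> real (card F) - (real (height X le) - 1) * real (n choose (n div 2))"
    and q: "0 < q" "q < 1" "(g / (real n - real h)) ^ g / c \<le> q"
    and Q: "Q \<subseteq> Pow V" "{} \<in> Q" "\<And>J J'. J \<in> Q \<Longrightarrow> J' \<subseteq> J \<Longrightarrow> J' \<in> Q"
    and free: "\<And>J. J \<in> Q \<Longrightarrow> \<not> contains_induced X le J"
    and \<delta>: "\<delta> * 8 ^ card X * (real (card X) ^ card X * 2 ^ card X / c)\<^sup>2 < 1"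
  shows "\<exists>v\<in>V. (\<Sum>J\<in>{J\<in>Q. v \<in> J}. wt q V J) < (1 - \<delta>) * q * (\<Sum>J\<in>Q. wt q V J)"
proof -
  define k where "k = height X le"
  define W where "W = (fact n :: real)"
  define q\<^sub>0 where "q\<^sub>0 = (g / (real n - real h)) ^ g"
  define N where "N = card X"
  have W: "0 < W" unfolding W_def by simp
  have q\<^sub>0: "0 \<le> q\<^sub>0" unfolding q\<^sub>0_def using lh by simp
  have po: "is_poset X le" and X0: "X \<noteq> {}" using tree by (auto simp: is_tree_poset_def)
  have fX: "finite X" and antisym: "\<And>x y. x \<in> X \<Longrightarrow> y \<in> X \<Longrightarrow> le x y \<Longrightarrow> le y x \<Longrightarrow> x = y"
    and le_refl: "\<And>x. x \<in> X \<Longrightarrow> le x x"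
    using po unfolding is_poset_def by blast+
  have k: "0 < k" unfolding k_def using height_pos[OF po X0] .
  have N: "0 < N" unfolding N_def using X0 fX by (simp add: card_gt_0_iff)
  have fF: "finite F" using V finite_subset by blast
  have cF: "0 < real (card F)" using F(2) fF by (simp add: card_gt_0_iff)
  obtain rk where rk: "\<And>x. x \<in> X \<Longrightarrow> rk x < k" "\<And>x y. x \<in> X \<Longrightarrow> y \<in> X \<Longrightarrow> le x y \<Longrightarrow> x \<noteq> y \<Longrightarrow> rk x < (rk y :: nat)"
    using rank_function_exists[OF po] unfolding k_def by blast
  \<comment> \<open>There are at least \<open>2 * k * c * W * card F\<close> windows. Discarding
    pairs used fewer than \<open>c * W\<close> times costs at most half of that, as there are at
    most \<open>k * card F\<close> pairs.\<close>
  have "W * (2 * k * c * card F) \<le> W * (real (card F) - (real k - 1) * real (n choose (n div 2)))"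
    using dense W unfolding k_def by (intro mult_left_mono) auto
  also have "\<dots> \<le> card (marked n F k)" unfolding W_def by (rule card_marked_ge[OF F(1) k])
  finally have M\<^sub>0: "W * (2 * k * c * card F) \<le> card (marked n F k)" .
  have "\<exists>M\<subseteq>marked n F k. (\<forall>m\<in>M. \<forall>j<k. c * W \<le> card {m'\<in>M. mark n F j m' = mark n F j m}) \<and>
      real (card (marked n F k)) - k * (c * W) * card F \<le> card M"
    by (rule discard_rare_positions[OF finite_marked fF]) (use mark_level(5) c W in auto)
  then obtain M where M: "M \<subseteq> marked n F k" "\<forall>m\<in>M. \<forall>j<k. c * W \<le> card {m'\<in>M. mark n F j m' = mark n F j m}"
    "real (card (marked n F k)) - k * (c * W) * card F \<le> card M" by blast
  have fM: "finite M" using M(1) finite_subset finite_marked by blast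
  have "W * c * card F \<le> k * (c * W) * card F"
    using k c W by (simp add: mult_le_cancel_right1 mult_ac)
  also have "\<dots> \<le> card M" using M(3) M\<^sub>0 by (simp add: algebra_simps)
  finally have cM: "W * c * card F \<le> card M" .
  have "0 < W * c * card F" using W c cF by simp
  then have cM0: "0 < real (card M)" using cM by linarith
  then have M0: "M \<noteq> {}" by auto
  have le: "card {m\<in>M. P m} \<le> card {m\<in>marked n F k. P m}" for P
    using M(1) by (intro card_mono) auto
  have ler: "real (card {m\<in>M. P m}) \<le> b" if "real (card {m\<in>marked n F k. P m}) \<le> b" for P b
    using le[of P] that by linarith
  have "\<exists>w. (\<forall>f. 0 \<le> w f) \<and> (\<Sum>f\<in>X \<rightarrow>\<^sub>E F. w f) = 1 \<and>
    (\<forall>v\<in>X. \<forall>x. (\<Sum>f\<in>X \<rightarrow>\<^sub>E F. w f * of_bool (f v = x)) = card {m\<in>M. mark n F (rk v) m = x} / card M) \<and>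
    (\<forall>D h. D \<subseteq> X \<longrightarrow> D \<noteq> {} \<longrightarrow> (\<Sum>f\<in>X \<rightarrow>\<^sub>E F. w f * of_bool (\<forall>d\<in>D. f d = h d)) \<le> W / card M * (q\<^sub>0 / c) ^ (card D - 1)) \<and>
    (1 / 2) ^ card X \<le> (\<Sum>f\<in>X \<rightarrow>\<^sub>E F. w f * of_bool (\<forall>x\<in>X. \<forall>y\<in>X. f x \<subseteq> f y \<longleftrightarrow> le x y))"
  proof (rule tree_indexed_markov_measure[OF fM M0 fF, where k = k and \<beta> = \<beta>])
    show "mark n F j m \<in> F" if "m \<in> M" "j < k" for m j
      using mark_level(5)[of m n F k j] that M(1) by auto
    show "mark n F i m \<subset> mark n F j m" if "m \<in> M" "i < j" "j < k" for m i j
      using mark_chain[of m n F k i j] that M(1) by auto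
    show "c * W \<le> card {m'\<in>M. mark n F j m' = mark n F j m}" if "m \<in> M" "j < k" for m j
      using M(2) that by blast
    show "card {m\<in>M. mark n F j m = x} \<le> W" if "j < k" for j x
    proof (rule ler)
      have "real (card {m\<in>marked n F k. mark n F j m = x}) \<le> real (fact n)"
        using card_marked_at[OF F(1) that, of x] by (simp only: of_nat_le_iff)
      then show "real (card {m\<in>marked n F k. mark n F j m = x}) \<le> W"
        unfolding W_def by (simp only: of_nat_fact)
    qed
    show "card {m\<in>M. mark n F i m = x \<and> mark n F j m = y} \<le> W * q\<^sub>0" if "i < j" "j < k" for i j x y
      unfolding W_def q\<^sub>0_def
      by (rule ler, rule card_marked_pair[OF F(1) that lev lh(2) gap g narrow])
    show "card {m\<in>M. mark n F i m = x \<and> (mark n F j m \<subseteq> z \<or> z \<subseteq> mark n F j m)} \<le> W * \<beta>"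
      if "i < j" "j < k" "x \<in> F" "z \<in> F" "\<not> z \<subseteq> x" for i j x z
      unfolding W_def by (rule ler, rule card_marked_comparable_above[OF F(1) that(1,2) lev lh(2) \<beta>(1,3) that(3-5)])
    show "card {m\<in>M. mark n F j m = x \<and> (mark n F i m \<subseteq> z \<or> z \<subseteq> mark n F i m)} \<le> W * \<beta>"
      if "i < j" "j < k" "x \<in> F" "z \<in> F" "\<not> x \<subseteq> z" for i j x z
      unfolding W_def by (rule ler, rule card_marked_comparable_below[OF F(1) that(1,2) lev lh(1) \<beta>(2,3) that(3-5)])
  qed (use c W q\<^sub>0 \<beta> tree rk in auto)
  then obtain w where w: "\<And>f. 0 \<le> w f"
    "\<And>D h. D \<subseteq> X \<Longrightarrow> D \<noteq> {} \<Longrightarrow> (\<Sum>f\<in>X \<rightarrow>\<^sub>E F. w f * of_bool (\<forall>d\<in>D. f d = h d)) \<le> W / card M * (q\<^sub>0 / c) ^ (card D - 1)"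
    "(1 / 2) ^ N \<le> (\<Sum>f\<in>X \<rightarrow>\<^sub>E F. w f * of_bool (\<forall>x\<in>X. \<forall>y\<in>X. f x \<subseteq> f y \<longleftrightarrow> le x y))"
    unfolding N_def by blast
  \<comment> \<open>Stated with \<open>\<subseteq>\<close> instead of \<open>\<subset>\<close>, the
    equivalence also yields injectivity by antisymmetry of \<open>le\<close>, so the members of
    \<open>\<Phi>\<close> are induced copies.\<close>
  define \<Phi> where "\<Phi> = {f\<in>X \<rightarrow>\<^sub>E F. \<forall>x\<in>X. \<forall>y\<in>X. f x \<subseteq> f y \<longleftrightarrow> le x y}"
  have fP: "finite (X \<rightarrow>\<^sub>E F)" using fX fF by (intro finite_PiE)
  then have f\<Phi>: "finite \<Phi>" unfolding \<Phi>_def by simp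
  define T where "T = (\<Sum>f\<in>\<Phi>. w f)"
  have "(\<Sum>f\<in>X \<rightarrow>\<^sub>E F. w f * of_bool (\<forall>x\<in>X. \<forall>y\<in>X. f x \<subseteq> f y \<longleftrightarrow> le x y)) = T"
    unfolding T_def \<Phi>_def using fP by (intro sum.mono_neutral_cong_right) auto
  then have T: "(1 / 2) ^ N \<le> T" using w(3) by simp
  then have T0: "0 < T" by (rule order.strict_trans2[rotated]) simp
  have T1: "1 / T \<le> 2 ^ N" using T T0 by (simp add: field_simps power_divide)
  \<comment> \<open>\<open>N ^ N\<close> bounds the choices of the poset elements mapped onto
    \<open>E\<close>, \<open>2 ^ N\<close> comes from conditioning on an induced copy, and
    \<open>1 / c\<close> from \<open>card M \<ge> c * W * card F\<close>.\<close>
  define K where "K = real N ^ N * 2 ^ N / c"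
  have K: "0 < K" unfolding K_def using N c by simp
  have K\<delta>: "\<delta> * 8 ^ N * K\<^sup>2 < 1" using \<delta> unfolding K_def N_def .
  show ?thesis
  proof (rule low_marginal[OF V f\<Phi>, where e = "\<lambda>f. f ` X" and w = "\<lambda>f. w f / T" and r = N and K = K])
    show "f ` X \<subseteq> F" if "f \<in> \<Phi>" for f using that unfolding \<Phi>_def by auto
    show "card (f ` X) \<le> N" for f unfolding N_def using fX by (rule card_image_le)
    show "0 \<le> w f / T" for f using w(1) T0 by simp
    show "(\<Sum>f\<in>\<Phi>. w f / T) = 1" unfolding sum_divide_distrib[symmetric] using T0 by (simp add: T_def)
    show "\<not> f ` X \<subseteq> J" if f: "f \<in> \<Phi>" and J: "J \<in> Q" for f J
    proof
      assume sub: "f ` X \<subseteq> J"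
      have ind: "f x \<subseteq> f y \<longleftrightarrow> le x y" if "x \<in> X" "y \<in> X" for x y using f that unfolding \<Phi>_def by blast
      have inj: "inj_on f X"
      proof (rule inj_onI)
        fix x y assume xy: "x \<in> X" "y \<in> X" "f x = f y"
        have "le x y" "le y x" using ind[OF xy(1,2)] ind[OF xy(2,1)] xy(3) by simp_all
        then show "x = y" using antisym xy by blast
      qed
      have "induced_copy X le J f"
        unfolding induced_copy_def using sub inj ind by (auto simp: psubset_eq inj_on_eq_iff)
      then show False using free[OF J] unfolding contains_induced_def by blast
    qed
    show "(\<Sum>f\<in>{f\<in>\<Phi>. E \<subseteq> f ` X}. w f / T) \<le> K / card F * q ^ (card E - 1)"
      if E: "E \<subseteq> F" "E \<noteq> {}" for E
    proof (cases "card E \<le> N")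
      case False
      have fE: "finite (f ` X)" for f :: "'a \<Rightarrow> nat set" using fX by simp
      have "card E \<le> N" if "E \<subseteq> f ` X" for f
        using card_mono[OF fE that] card_image_le[OF fX, of f] unfolding N_def by linarith
      then have e: "{f\<in>\<Phi>. E \<subseteq> f ` X} = {}" using False by auto
      show ?thesis unfolding e using K q by simp
    next
      case True
      have fE: "finite E" using E fF finite_subset by blast
      let ?G = "{s\<in>E \<rightarrow>\<^sub>E X. inj_on s E}"
      have fG: "finite ?G" using fE fX by (simp add: finite_PiE)
      have fGc: "card ?G \<le> N ^ N"
      proof -
        have "card ?G \<le> card (E \<rightarrow>\<^sub>E X)" using fE fX by (intro card_mono finite_PiE) auto
        also have "\<dots> = N ^ card E" using fE by (simp add: card_PiE N_def)
        also have "\<dots> \<le> N ^ N" using True N by (intro power_increasing) auto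
        finally show ?thesis .
      qed
      \<comment> \<open>If the image covers \<open>E\<close>, choosing preimages gives an injection
        \<open>s\<close>, and \<open>f\<close> has prescribed values on the \<open>card E\<close>
        elements in its range. This brings the event into the form bounded by the tree
        measure.\<close>
      have one: "w f * of_bool (E \<subseteq> f ` X) \<le> (\<Sum>s\<in>?G. w f * of_bool (\<forall>d\<in>s ` E. f d = inv_into E s d))" for f
      proof (cases "E \<subseteq> f ` X")
        case True
        define s where "s = restrict (inv_into X f) E"
        have s: "s e \<in> X" "f (s e) = e" if "e \<in> E" for e
          using that True by (auto simp: s_def inv_into_into f_inv_into_f)
        have inj: "inj_on s E" by (rule inj_on_inverseI[of _ f]) (use s in auto)
        have "s \<in> ?G" using s inj by (auto simp: s_def)
        moreover have "\<forall>d\<in>s ` E. f d = inv_into E s d" using inj s by auto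
        ultimately have "w f * of_bool (E \<subseteq> f ` X) = (\<Sum>s\<in>{s}. w f * of_bool (\<forall>d\<in>s ` E. f d = inv_into E s d))"
          using True by simp
        also have "\<dots> \<le> (\<Sum>s\<in>?G. w f * of_bool (\<forall>d\<in>s ` E. f d = inv_into E s d))"
          using fG \<open>s \<in> ?G\<close> w(1) by (intro sum_mono2) auto
        finally show ?thesis .
      next
        case False
        then show ?thesis using w(1) by (simp add: sum_nonneg)
      qed
      have "(\<Sum>f\<in>{f\<in>\<Phi>. E \<subseteq> f ` X}. w f) \<le> (\<Sum>f\<in>{f\<in>X \<rightarrow>\<^sub>E F. E \<subseteq> f ` X}. w f)"
        using fP w(1) by (intro sum_mono2) (auto simp: \<Phi>_def)
      also have "\<dots> = (\<Sum>f\<in>X \<rightarrow>\<^sub>E F. w f * of_bool (E \<subseteq> f ` X))"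
        using fP by (intro sum.mono_neutral_cong_left) auto
      also have "\<dots> \<le> (\<Sum>f\<in>X \<rightarrow>\<^sub>E F. \<Sum>s\<in>?G. w f * of_bool (\<forall>d\<in>s ` E. f d = inv_into E s d))"
        by (intro sum_mono one)
      also have "\<dots> = (\<Sum>s\<in>?G. \<Sum>f\<in>X \<rightarrow>\<^sub>E F. w f * of_bool (\<forall>d\<in>s ` E. f d = inv_into E s d))"
        by (rule sum.swap)
      also have "\<dots> \<le> (\<Sum>s\<in>?G. W / card M * (q\<^sub>0 / c) ^ (card E - 1))"
      proof (rule sum_mono)
        fix s assume s: "s \<in> ?G"
        have "card (s ` E) = card E" using s by (auto intro: card_image)
        then show "(\<Sum>f\<in>X \<rightarrow>\<^sub>E F. w f * of_bool (\<forall>d\<in>s ` E. f d = inv_into E s d)) \<le> W / card M * (q\<^sub>0 / c) ^ (card E - 1)"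
          using w(2)[of "s ` E" "inv_into E s"] s E by auto
      qed
      also have "\<dots> = real (card ?G) * (W / card M * (q\<^sub>0 / c) ^ (card E - 1))" by simp
      also have "\<dots> \<le> real N ^ N * (1 / (c * card F) * q ^ (card E - 1))"
      proof (intro mult_mono)
        have "real (card ?G) \<le> real (N ^ N)" using fGc by (simp only: of_nat_le_iff)
        then show "real (card ?G) \<le> real N ^ N" by (simp only: of_nat_power)
        show "W / card M \<le> 1 / (c * card F)" using cM cM0 c cF by (simp add: field_simps)
        show "(q\<^sub>0 / c) ^ (card E - 1) \<le> q ^ (card E - 1)"
          using q q\<^sub>0 c unfolding q\<^sub>0_def by (intro power_mono) auto
      qed (use W c cF q\<^sub>0 in auto)
      finally have S: "(\<Sum>f\<in>{f\<in>\<Phi>. E \<subseteq> f ` X}. w f) \<le> real N ^ N * (1 / (c * card F) * q ^ (card E - 1))" .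
      have "(\<Sum>f\<in>{f\<in>\<Phi>. E \<subseteq> f ` X}. w f / T) = (\<Sum>f\<in>{f\<in>\<Phi>. E \<subseteq> f ` X}. w f) * (1 / T)"
        by (simp add: sum_divide_distrib)
      also have "\<dots> \<le> (real N ^ N * (1 / (c * card F) * q ^ (card E - 1))) * 2 ^ N"
        using S T1 T0 c cF q w(1) by (intro mult_mono) (auto intro!: sum_nonneg)
      also have "\<dots> = K / card F * q ^ (card E - 1)" unfolding K_def by (simp add: mult_ac)
      finally show ?thesis .
    qed
  qed (use Q q K K\<delta> in auto)
qed

section \<open>Random families\<close>

lemma prob_Pnp_eq:
  "prob_Pnp n p E = (\<Sum>F\<in>Pow (boolean_lattice n). wt p (boolean_lattice n) F * of_bool (E F))"
  unfolding prob_Pnp_def wt_def by (intro sum.cong) auto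

lemma finite_boolean_lattice [simp]: "finite (boolean_lattice n)"
  by (simp add: boolean_lattice_def)

lemma prob_Pnp_le_1:
  assumes "0 \<le> p" "p \<le> 1"
  shows "prob_Pnp n p E \<le> 1"
proof -
  have "prob_Pnp n p E \<le> (\<Sum>F\<in>Pow (boolean_lattice n). wt p (boolean_lattice n) F)"
    unfolding prob_Pnp_eq using wt_nonneg[OF assms] by (intro sum_mono) (auto simp: mult_left_le)
  then show ?thesis by (simp add: sum_wt)
qed

lemma prob_Pnp_mono:
  assumes "0 \<le> p" "p \<le> 1" and "\<And>F. F \<subseteq> boolean_lattice n \<Longrightarrow> E F \<Longrightarrow> E' F"
  shows "prob_Pnp n p E \<le> prob_Pnp n p E'"
  unfolding prob_Pnp_eq using wt_nonneg[OF assms(1,2)] assms(3)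
  by (intro sum_mono mult_left_mono) auto

lemma prob_Pnp_disj:
  assumes "0 \<le> p" "p \<le> 1"
  shows "prob_Pnp n p (\<lambda>F. E F \<or> E' F) \<le> prob_Pnp n p E + prob_Pnp n p E'"
  unfolding prob_Pnp_eq sum.distrib[symmetric] distrib_left[symmetric]
  using wt_nonneg[OF assms] by (intro sum_mono mult_left_mono) auto

lemma prob_Pnp_bex:
  assumes "0 \<le> p" "p \<le> 1" "finite I"
  shows "prob_Pnp n p (\<lambda>F. \<exists>i\<in>I. E i F) \<le> (\<Sum>i\<in>I. prob_Pnp n p (E i))"
  using assms(3)
proof (induction I)
  case empty
  then show ?case by (simp add: prob_Pnp_eq)
next
  case (insert i I)
  have "prob_Pnp n p (\<lambda>F. \<exists>i\<in>insert i I. E i F) \<le> prob_Pnp n p (\<lambda>F. E i F \<or> (\<exists>i\<in>I. E i F))"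
    using assms by (intro prob_Pnp_mono) auto
  also have "\<dots> \<le> prob_Pnp n p (E i) + prob_Pnp n p (\<lambda>F. \<exists>i\<in>I. E i F)"
    using assms by (intro prob_Pnp_disj)
  finally show ?case using insert by simp
qed

lemma prob_Pnp_compl:
  assumes "0 \<le> p" "p \<le> 1" and "\<And>F. F \<subseteq> boolean_lattice n \<Longrightarrow> \<not> E F \<Longrightarrow> E' F"
  shows "1 - prob_Pnp n p E' \<le> prob_Pnp n p E"
proof -
  have "1 = prob_Pnp n p (\<lambda>_. True)" by (simp add: prob_Pnp_eq sum_wt)
  also have "\<dots> \<le> prob_Pnp n p (\<lambda>F. E F \<or> E' F)" using assms by (intro prob_Pnp_mono) auto
  also have "\<dots> \<le> prob_Pnp n p E + prob_Pnp n p E'" using assms by (intro prob_Pnp_disj)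
  finally show ?thesis by simp
qed

section \<open>Exponential moments and tail bounds\<close>

text \<open>A joint moment generating function that keeps the event \<open>S \<subseteq> F\<close>
  together with the number of members in \<open>D\<close>. An element of \<open>S\<close> outside
  \<open>D\<close> contributes \<open>p\<close>, which is bounded by \<open>p * a\<close>; this is
  the reason for \<open>1 \<le> a\<close> unless \<open>S\<close> is empty. The empty case with
  \<open>a \<le> 1\<close> serves the lower tail.\<close>

lemma moment_bound:
  assumes p: "0 \<le> p" "p \<le> 1" and S: "S \<subseteq> boolean_lattice n" and D: "D \<subseteq> boolean_lattice n"
    and a: "0 < a" and aS: "1 \<le> a \<or> S = {}"
  shows "(\<Sum>F\<in>Pow (boolean_lattice n). wt p (boolean_lattice n) F * (of_bool (S \<subseteq> F) * a ^ card (F \<inter> D)))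
    \<le> (p * a) ^ card S * exp (p * (a - 1) * card D)"
proof -
  let ?B = "boolean_lattice n"
  let ?u = "\<lambda>x. if x \<in> D then a else 1" and ?v = "\<lambda>x. of_bool (x \<notin> S) :: real"
  have fin: "finite F" if "F \<subseteq> ?B" for F using finite_subset[OF that] by simp
  have "(\<Sum>F\<in>Pow ?B. wt p ?B F * (of_bool (S \<subseteq> F) * a ^ card (F \<inter> D)))
    = (\<Sum>F\<in>Pow ?B. wt p ?B F * ((\<Prod>x\<in>F. ?u x) * (\<Prod>x\<in>?B - F. ?v x)))"
  proof (rule sum.cong[OF refl], rule arg_cong2[where f = "(*)", OF refl])
    fix F assume F: "F \<in> Pow ?B"
    have "(\<Prod>x\<in>?B - F. ?v x) = of_bool (S \<subseteq> F)"
    proof (cases "S \<subseteq> F")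
      case True
      then have "(\<Prod>x\<in>?B - F. ?v x) = 1" by (intro prod.neutral) auto
      then show ?thesis using True by simp
    next
      case False
      then obtain x where "x \<in> ?B - F" "x \<in> S" using S by blast
      then have "(\<Prod>x\<in>?B - F. ?v x) = 0" by (intro prod_zero) auto
      then show ?thesis using False by simp
    qed
    moreover have "(\<Prod>x\<in>F. ?u x) = a ^ card (F \<inter> D)"
      using fin[of F] F by (simp add: prod.If_cases)
    ultimately show "of_bool (S \<subseteq> F) * a ^ card (F \<inter> D) = (\<Prod>x\<in>F. ?u x) * (\<Prod>x\<in>?B - F. ?v x)" by simp
  qed
  also have "\<dots> = (\<Prod>x\<in>?B. p * ?u x + (1 - p) * ?v x)" by (rule sum_wt_prod) simp
  also have "\<dots> \<le> (\<Prod>x\<in>?B. (if x \<in> S then p * a else 1) * (if x \<in> D then exp (p * (a - 1)) else 1))"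
  proof (rule prod_mono)
    fix x assume "x \<in> ?B"
    have e: "1 + p * (a - 1) \<le> exp (p * (a - 1))" by (rule exp_ge_add_one_self)
    have pa: "0 \<le> p * a" using p a by simp
    have "p * ?u x + (1 - p) * ?v x \<le> (if x \<in> S then p * a else 1) * (if x \<in> D then exp (p * (a - 1)) else 1)"
    proof (cases "x \<in> S")
      case True
      then have a1: "1 \<le> a" using aS by auto
      then have "1 \<le> exp (p * (a - 1))" using p by simp
      then have "p * a * 1 \<le> p * a * exp (p * (a - 1))" using pa by (intro mult_left_mono)
      moreover have "p \<le> p * a" using a1 p by (simp add: mult_le_cancel_left1)
      ultimately show ?thesis using True by auto
    next
      case False
      then show ?thesis using e by (auto simp: algebra_simps)
    qed
    moreover have "0 \<le> p * ?u x + (1 - p) * ?v x" using p a by (intro add_nonneg_nonneg mult_nonneg_nonneg) auto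
    ultimately show "0 \<le> p * ?u x + (1 - p) * ?v x \<and> p * ?u x + (1 - p) * ?v x
      \<le> (if x \<in> S then p * a else 1) * (if x \<in> D then exp (p * (a - 1)) else 1)" by simp
  qed
  also have "\<dots> = (p * a) ^ card S * exp (p * (a - 1)) ^ card D"
    unfolding prod.distrib using S D fin[of S] fin[of D]
    by (simp add: prod.If_cases Int_absorb1 Int_absorb2 Int_commute)
  also have "\<dots> = (p * a) ^ card S * exp (p * (a - 1) * card D)"
    by (simp flip: exp_of_nat_mult add: mult_ac)
  finally show ?thesis .
qed

text \<open>Markov's inequality for \<open>a ^ card (F \<inter> D)\<close>. The event
  \<open>S \<subseteq> F\<close> stays inside the probability because its factor
  \<open>(p * a) ^ card S\<close> makes the sum over fingerprints affordable; \<open>S\<close> and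
  \<open>D\<close> may overlap.\<close>

lemma prob_upper_tail:
  fixes a m :: real
  assumes p: "0 \<le> p" "p \<le> 1" and S: "S \<subseteq> boolean_lattice n" and D: "D \<subseteq> boolean_lattice n" and a: "1 \<le> a"
  shows "prob_Pnp n p (\<lambda>F. S \<subseteq> F \<and> m \<le> card (F \<inter> D))
    \<le> (p * a) ^ card S * exp (p * (a - 1) * card D) * a powr (- m)"
proof -
  let ?B = "boolean_lattice n"
  have "prob_Pnp n p (\<lambda>F. S \<subseteq> F \<and> m \<le> card (F \<inter> D))
    \<le> (\<Sum>F\<in>Pow ?B. wt p ?B F * (of_bool (S \<subseteq> F) * a ^ card (F \<inter> D)) * a powr (- m))"
    unfolding prob_Pnp_eq
  proof (rule sum_mono)
    fix F
    have w: "0 \<le> wt p ?B F" using p by (rule wt_nonneg)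
    show "wt p ?B F * of_bool (S \<subseteq> F \<and> m \<le> card (F \<inter> D)) \<le> wt p ?B F * (of_bool (S \<subseteq> F) * a ^ card (F \<inter> D)) * a powr (- m)"
    proof (cases "S \<subseteq> F \<and> m \<le> card (F \<inter> D)")
      case True
      have "1 = a powr 0" using a by simp
      also have "\<dots> \<le> a powr (real (card (F \<inter> D)) - m)" using a True by (intro powr_mono) auto
      also have "\<dots> = a ^ card (F \<inter> D) * a powr (- m)"
        using a by (simp add: powr_diff powr_minus divide_inverse powr_realpow)
      finally show ?thesis using True mult_left_mono[OF _ w, of 1 "a ^ card (F \<inter> D) * a powr (- m)"] by (simp add: mult_ac)
    next
      case False
      then show ?thesis using w a by auto
    qed
  qed
  also have "\<dots> = (\<Sum>F\<in>Pow ?B. wt p ?B F * (of_bool (S \<subseteq> F) * a ^ card (F \<inter> D))) * a powr (- m)"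
    by (simp add: sum_distrib_right)
  also have "\<dots> \<le> (p * a) ^ card S * exp (p * (a - 1) * card D) * a powr (- m)"
    using assms by (intro mult_right_mono moment_bound) auto
  finally show ?thesis .
qed

lemma prob_lower_tail:
  fixes a m :: real
  assumes p: "0 \<le> p" "p \<le> 1" and D: "D \<subseteq> boolean_lattice n" and a: "0 < a" "a \<le> 1"
  shows "prob_Pnp n p (\<lambda>F. card (F \<inter> D) \<le> m) \<le> exp (p * (a - 1) * card D) * a powr (- m)"
proof -
  let ?B = "boolean_lattice n"
  have "prob_Pnp n p (\<lambda>F. card (F \<inter> D) \<le> m)
    \<le> (\<Sum>F\<in>Pow ?B. wt p ?B F * (of_bool ({} \<subseteq> F) * a ^ card (F \<inter> D)) * a powr (- m))"
    unfolding prob_Pnp_eq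
  proof (rule sum_mono)
    fix F
    have w: "0 \<le> wt p ?B F" using p by (rule wt_nonneg)
    show "wt p ?B F * of_bool (card (F \<inter> D) \<le> m) \<le> wt p ?B F * (of_bool ({} \<subseteq> F) * a ^ card (F \<inter> D)) * a powr (- m)"
    proof (cases "card (F \<inter> D) \<le> m")
      case True
      have "1 = a powr 0" using a by simp
      also have "\<dots> \<le> a powr (real (card (F \<inter> D)) - m)" using a True by (intro powr_mono') auto
      also have "\<dots> = a ^ card (F \<inter> D) * a powr (- m)"
        using a by (simp add: powr_diff powr_minus divide_inverse powr_realpow)
      finally show ?thesis using True mult_left_mono[OF _ w, of 1 "a ^ card (F \<inter> D) * a powr (- m)"] by (simp add: mult_ac)
    next
      case False
      then show ?thesis using w a by auto
    qed
  qed
  also have "\<dots> = (\<Sum>F\<in>Pow ?B. wt p ?B F * (of_bool ({} \<subseteq> F) * a ^ card (F \<inter> D))) * a powr (- m)"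
    by (simp add: sum_distrib_right)
  also have "\<dots> \<le> (p * a) ^ card ({} :: nat set set) * exp (p * (a - 1) * card D) * a powr (- m)"
    using assms by (intro mult_right_mono moment_bound) auto
  finally show ?thesis by simp
qed

text \<open>Rankin's trick: for \<open>card S \<le> s\<close> the factor
  \<open>y ^ card S * y powr (- s)\<close> is at least one, and with it the sum over all subsets
  becomes a product. The free parameter \<open>y\<close> replaces estimates of binomial
  sums.\<close>

lemma sum_small_subsets_le:
  fixes x y s :: real
  assumes V: "finite V" and x: "0 \<le> x" and y: "0 < y" "y \<le> 1"
  shows "(\<Sum>S\<in>{S\<in>Pow V. card S \<le> s}. x ^ card S) \<le> exp (x * y * card V) * y powr (- s)"
proof -
  have "(\<Sum>S\<in>{S\<in>Pow V. card S \<le> s}. x ^ card S) \<le> (\<Sum>S\<in>{S\<in>Pow V. card S \<le> s}. (x * y) ^ card S * y powr (- s))"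
  proof (rule sum_mono)
    fix S assume S: "S \<in> {S\<in>Pow V. card S \<le> s}"
    have "1 = y powr 0" using y by simp
    also have "\<dots> \<le> y powr (real (card S) - s)" using y S by (intro powr_mono') auto
    also have "\<dots> = y ^ card S * y powr (- s)"
      using y by (simp add: powr_diff powr_minus divide_inverse powr_realpow)
    finally have "x ^ card S * 1 \<le> x ^ card S * (y ^ card S * y powr (- s))" using x by (intro mult_left_mono) auto
    then show "x ^ card S \<le> (x * y) ^ card S * y powr (- s)" by (simp add: power_mult_distrib)
  qed
  also have "\<dots> \<le> (\<Sum>S\<in>Pow V. (x * y) ^ card S * y powr (- s))"
    using V x y by (intro sum_mono2) auto
  also have "\<dots> = (\<Sum>S\<in>Pow V. (\<Prod>_\<in>S. x * y) * (\<Prod>_\<in>V - S. 1)) * y powr (- s)"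
    by (simp add: sum_distrib_right)
  also have "\<dots> = (x * y + 1) ^ card V * y powr (- s)"
    by (subst prod_add[OF V, symmetric]) simp
  also have "\<dots> \<le> exp (x * y) ^ card V * y powr (- s)"
    using x y exp_ge_add_one_self[of "x * y"] by (intro mult_right_mono power_mono) (auto simp: add.commute)
  also have "\<dots> = exp (x * y * card V) * y powr (- s)" by (simp flip: exp_of_nat_mult add: mult_ac)
  finally show ?thesis .
qed

section \<open>Level sizes of the Boolean lattice\<close>

lemma central_binomial_ge: "2 ^ n / (real n + 1) \<le> real (n choose (n div 2))"
proof -
  have "(2::real) ^ n = (\<Sum>k\<le>n. real (n choose k))"
    using choose_row_sum[of n] by (metis of_nat_numeral of_nat_power of_nat_sum)
  also have "\<dots> \<le> (\<Sum>k\<le>n. real (n choose (n div 2)))"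
    using binomial_maximum[of n] by (intro sum_mono) simp
  also have "\<dots> = (real n + 1) * real (n choose (n div 2))" by simp
  finally show ?thesis by (simp add: field_simps)
qed

lemma sum_exp_card:
  "(\<Sum>x\<in>Pow {..<n}. exp (t * real (card x))) = (exp t + 1) ^ n"
proof -
  have "(\<Sum>x\<in>Pow {..<n}. exp (t * real (card x))) = (\<Sum>x\<in>Pow {..<n}. (\<Prod>_\<in>x. exp t) * (\<Prod>_\<in>{..<n} - x. 1))"
    by (simp flip: exp_of_nat_mult add: mult_ac)
  also have "\<dots> = (exp t + 1) ^ n" by (subst prod_add[symmetric]) auto
  finally show ?thesis .
qed

text \<open>Chernoff bound for the levels: \<open>\<rho>\<close> is
  \<open>exp (- t * \<eta>)\<close> times the moment generating function at \<open>t\<close> of one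
  fair centred coin with values \<open>1 / 2\<close> and \<open>- 1 / 2\<close>.\<close>

lemma far_sets_le:
  fixes t \<eta> :: real
  assumes t: "0 \<le> t"
  defines "\<rho> \<equiv> exp (- t * \<eta>) * ((exp (t / 2) + exp (- t / 2)) / 2)"
  shows "real (card {x\<in>Pow {..<n}. \<eta> * n < \<bar>real (card x) - n / 2\<bar>}) \<le> 2 * (2 * \<rho>) ^ n"
proof -
  let ?S = "{x\<in>Pow {..<n}. \<eta> * n < \<bar>real (card x) - n / 2\<bar>}"
  have exps: "exp (- (t * n / 2) - t * \<eta> * n) * (exp t + 1) ^ n = (2 * \<rho>) ^ n"
    "exp (t * n / 2 - t * \<eta> * n) * (exp (- t) + 1) ^ n = (2 * \<rho>) ^ n"
  proof -
    have "exp (- (t * n / 2) - t * \<eta> * n) = exp (- (t / 2) - t * \<eta>) ^ n"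
      by (simp flip: exp_of_nat_mult add: algebra_simps)
    moreover have "exp (- (t / 2) - t * \<eta>) * (exp t + 1) = 2 * \<rho>"
      unfolding \<rho>_def by (simp add: distrib_left mult_exp_exp algebra_simps)
    ultimately show "exp (- (t * n / 2) - t * \<eta> * n) * (exp t + 1) ^ n = (2 * \<rho>) ^ n"
      by (simp only: power_mult_distrib[symmetric])
    have "exp (t * n / 2 - t * \<eta> * n) = exp (t / 2 - t * \<eta>) ^ n"
      by (simp flip: exp_of_nat_mult add: algebra_simps)
    moreover have "exp (t / 2 - t * \<eta>) * (exp (- t) + 1) = 2 * \<rho>"
      unfolding \<rho>_def by (simp add: distrib_left mult_exp_exp algebra_simps)
    ultimately show "exp (t * n / 2 - t * \<eta> * n) * (exp (- t) + 1) ^ n = (2 * \<rho>) ^ n"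
      by (simp only: power_mult_distrib[symmetric])
  qed
  have "real (card ?S) = (\<Sum>x\<in>?S. 1)" by simp
  also have "\<dots> \<le> (\<Sum>x\<in>?S. exp (- (t * n / 2) - t * \<eta> * n) * exp (t * card x) + exp (t * n / 2 - t * \<eta> * n) * exp (- t * card x))"
  proof (rule sum_mono)
    fix x assume x: "x \<in> ?S"
    have eq: "exp (- (t * n / 2) - t * \<eta> * n) * exp (t * card x) = exp (t * ((real (card x) - n / 2) - \<eta> * n))"
      "exp (t * n / 2 - t * \<eta> * n) * exp (- t * card x) = exp (t * (- (real (card x) - n / 2) - \<eta> * n))"
      by (simp_all add: mult_exp_exp algebra_simps)
    consider "0 \<le> (real (card x) - n / 2) - \<eta> * n" | "0 \<le> - (real (card x) - n / 2) - \<eta> * n"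
      using x by fastforce
    then show "1 \<le> exp (- (t * n / 2) - t * \<eta> * n) * exp (t * card x) + exp (t * n / 2 - t * \<eta> * n) * exp (- t * card x)"
    proof cases
      case 1
      then have "1 \<le> exp (t * ((real (card x) - n / 2) - \<eta> * n))" using t by simp
      then show ?thesis unfolding eq by (rule order_trans) simp
    next
      case 2
      then have "1 \<le> exp (t * (- (real (card x) - n / 2) - \<eta> * n))" using t by simp
      then show ?thesis unfolding eq by (rule order_trans) simp
    qed
  qed
  also have "\<dots> \<le> (\<Sum>x\<in>Pow {..<n}. exp (- (t * n / 2) - t * \<eta> * n) * exp (t * card x) + exp (t * n / 2 - t * \<eta> * n) * exp (- t * card x))"
    by (intro sum_mono2) auto
  also have "\<dots> = 2 * (2 * \<rho>) ^ n"
    unfolding sum.distrib sum_distrib_left[symmetric] sum_exp_card exps by simp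
  finally show ?thesis .
qed

text \<open>At \<open>t = 0\<close> the Chernoff factor is \<open>1\<close> with derivative
  \<open>- \<eta>\<close>, so it is below \<open>1\<close> for some small \<open>t\<close>. Its
  \<open>n\<close>-th power then beats the factor \<open>n + 1\<close> lost in the lower bound for
  the central coefficient.\<close>

lemma far_sets_negligible:
  fixes \<eta> :: real
  assumes \<eta>: "0 < \<eta>"
  shows "(\<lambda>n. real (card {x\<in>Pow {..<n}. \<eta> * n < \<bar>real (card x) - n / 2\<bar>}) / real (n choose (n div 2))) \<longlonglongrightarrow> 0"
proof -
  define f where "f t = exp (- t * \<eta>) * ((exp (t / 2) + exp (- t / 2)) / 2)" for t :: real
  have "(f has_real_derivative - \<eta>) (at 0)"
    unfolding f_def by (auto intro!: derivative_eq_intros)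
  then obtain d where d: "0 < d" "\<And>h. 0 < h \<Longrightarrow> h < d \<Longrightarrow> f (0 + h) < f 0"
    using DERIV_neg_dec_right[of f "- \<eta>" 0] \<eta> by auto
  define t where "t = d / 2"
  have t: "0 < t" "f t < 1" using d(1) d(2)[of t] by (auto simp: t_def f_def)
  have f0: "0 < f t" unfolding f_def by (intro mult_pos_pos) (auto intro!: add_pos_pos)
  have lim: "(\<lambda>n. 2 * (real n + 1) * f t ^ n) \<longlonglongrightarrow> 0" using t f0 by real_asymp
  have le: "real (card {x\<in>Pow {..<n}. \<eta> * n < \<bar>real (card x) - n / 2\<bar>}) / real (n choose (n div 2))
    \<le> 2 * (real n + 1) * f t ^ n" for n
  proof -
    have "real (card {x\<in>Pow {..<n}. \<eta> * n < \<bar>real (card x) - n / 2\<bar>}) / real (n choose (n div 2))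
      \<le> 2 * (2 * f t) ^ n / (2 ^ n / (real n + 1))"
      using far_sets_le[where t = t and \<eta> = \<eta> and n = n] t central_binomial_ge[of n] unfolding f_def by (intro frac_le) auto
    also have "\<dots> = 2 * (real n + 1) * f t ^ n" by (simp add: power_mult_distrib field_simps)
    finally show ?thesis .
  qed
  show ?thesis
    by (rule tendsto_sandwich[OF always_eventually always_eventually tendsto_const lim]) (use le in simp_all)
qed

text \<open>Induction on \<open>j\<close>: the ratio of consecutive coefficients at a bounded
  distance from the middle tends to \<open>1\<close>.\<close>

lemma near_central_binomial:
  "(\<lambda>n. real (n choose (n div 2 + j)) / real (n choose (n div 2))) \<longlonglongrightarrow> 1"
proof (induction j)
  case 0
  have "(\<lambda>n. real (n choose (n div 2 + 0)) / real (n choose (n div 2))) = (\<lambda>_. 1)"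
    by (auto simp: fun_eq_iff)
  then show ?case by simp
next
  case (Suc j)
  have lim: "(\<lambda>n. (real n - (real (n div 2) + real j)) / (real (n div 2) + real j + 1)) \<longlonglongrightarrow> 1"
  proof (rule tendsto_sandwich)
    show "\<forall>\<^sub>F n in sequentially. (real n / 2 - real j) / (real n / 2 + real j + 1) \<le> (real n - (real (n div 2) + real j)) / (real (n div 2) + real j + 1)"
      using eventually_ge_at_top[of "2 * j"]
    proof eventually_elim
      case (elim n)
      have "real (n div 2) \<le> real n / 2" by linarith
      then show ?case using elim by (intro frac_le) auto
    qed
    show "\<forall>\<^sub>F n in sequentially. (real n - (real (n div 2) + real j)) / (real (n div 2) + real j + 1) \<le> (real n / 2 + 1) / (real n / 2 - 1 / 2 + real j + 1)"
    proof (intro always_eventually allI)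
      fix n
      have "real n / 2 - 1 / 2 \<le> real (n div 2)" by linarith
      then show "(real n - (real (n div 2) + real j)) / (real (n div 2) + real j + 1) \<le> (real n / 2 + 1) / (real n / 2 - 1 / 2 + real j + 1)"
        by (intro frac_le) auto
    qed
    show "(\<lambda>n. (real n / 2 - real j) / (real n / 2 + real j + 1)) \<longlonglongrightarrow> 1" by real_asymp
    show "(\<lambda>n. (real n / 2 + 1) / (real n / 2 - 1 / 2 + real j + 1)) \<longlonglongrightarrow> 1" by real_asymp
  qed
  have "\<forall>\<^sub>F n in sequentially. real (n choose (n div 2 + j)) / real (n choose (n div 2)) *
      ((real n - (real (n div 2) + real j)) / (real (n div 2) + real j + 1)) = real (n choose (n div 2 + Suc j)) / real (n choose (n div 2))"
    using eventually_ge_at_top[of "2 * j"]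
  proof eventually_elim
    case (elim n)
    define i where "i = n div 2 + j"
    have i: "i \<le> n" using elim by (simp add: i_def)
    have "Suc i * (n choose Suc i) = (n - i) * (n choose i)" 
      using binomial_absorb_comp[of n i] binomial_absorption[of i n] by simp
    then have "real (Suc i) * real (n choose Suc i) = real (n - i) * real (n choose i)" by (metis of_nat_mult)
    then have "real (n choose Suc i) = real (n choose i) * ((real n - real i) / (real i + 1))"
      using i by (simp add: field_simps of_nat_diff)
    then show ?case by (simp add: i_def)
  qed
  with tendsto_mult[OF Suc lim] show ?case by (auto elim: Lim_transform_eventually)
qed

section \<open>Containers for free families\<close>

definition middle :: "real \<Rightarrow> nat \<Rightarrow> nat set set" where
  "middle \<eta> n = {x\<in>Pow {..<n}. \<bar>real (card x) - n / 2\<bar> \<le> \<eta> * n}"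

lemma finite_middle [simp]: "finite (middle \<eta> n)"
  by (simp add: middle_def)

lemma contains_induced_mono: "contains_induced X le F \<Longrightarrow> F \<subseteq> G \<Longrightarrow> contains_induced X le G"
proof -
  assume "contains_induced X le F" "F \<subseteq> G"
  then obtain f where "induced_copy X le F f" unfolding contains_induced_def by blast
  then have "induced_copy X le G f"
    unfolding induced_copy_def using subset_trans[OF _ \<open>F \<subseteq> G\<close>, of "f ` X"] by simp
  then show ?thesis unfolding contains_induced_def by blast
qed

lemma max_free_bounds:
  assumes "X \<noteq> {}" "finite R"
  shows "G \<subseteq> R \<Longrightarrow> \<not> contains_induced X le G \<Longrightarrow> card G \<le> max_free X le R"
    "\<exists>G\<subseteq>R. \<not> contains_induced X le G \<and> card G = max_free X le R"
proof -
  let ?S = "{card G |G. G \<subseteq> R \<and> \<not> contains_induced X le G}"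
  have fin: "finite ?S"
    by (rule finite_subset[of _ "card ` Pow R"]) (use assms in auto)
  have "\<not> contains_induced X le {}"
    using assms(1) by (auto simp: contains_induced_def induced_copy_def)
  then have "card ({} :: nat set set) \<in> ?S" by blast
  then have "?S \<noteq> {}" by blast
  then have "max_free X le R \<in> ?S" unfolding max_free_def using fin by (intro Max_in)
  then show "\<exists>G\<subseteq>R. \<not> contains_induced X le G \<and> card G = max_free X le R" by auto
  show "card G \<le> max_free X le R" if "G \<subseteq> R" "\<not> contains_induced X le G"
    unfolding max_free_def using fin that by (intro Max_ge) auto
qed

locale tree_poset_density =
  fixes X :: "'a set" and le :: "'a \<Rightarrow> 'a \<Rightarrow> bool" and k :: nat and e :: real
  assumes tree: "is_tree_poset X le" and k: "k = height X le" and e: "0 < e" "e \<le> 1"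
begin

text \<open>\<open>c\<close> makes the supersaturation condition
  \<open>2 * k * c * card F \<le> card F - (k - 1) * C n\<close> tight at
  \<open>card F = (k - 1 + e) * C n\<close>. The choice of \<open>\<eta>\<close> gives
  \<open>2 * card X * \<beta> = c\<close> for \<open>\<beta> = 16 * \<eta>\<close>, and
  \<open>\<delta>\<close> is small enough for the second-moment estimate; all three depend only on
  \<open>X\<close> and \<open>e\<close>.\<close>

definition "c = e / (2 * real k * (real k - 1 + e))"
definition "\<eta> = c / (32 * real (card X))"
definition "\<delta> = 1 / (2 * (1 + 8 ^ card X * (real (card X) ^ card X * 2 ^ card X / c)\<^sup>2))"

abbreviation "C n \<equiv> real (n choose (n div 2))"

lemma X: "X \<noteq> {}" "finite X" "is_poset X le"
proof -
  show "X \<noteq> {}" "is_poset X le" using tree unfolding is_tree_poset_def by simp_all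
  then show "finite X" unfolding is_poset_def by simp
qed

lemma card_X: "1 \<le> card X" using X by (simp add: Suc_le_eq card_gt_0_iff)

lemma k_pos: "1 \<le> k" using height_pos[OF X(3,1)] k by simp

lemma c: "0 < c" "c \<le> 1 / 2"
proof -
  have k1: "1 \<le> real k" using k_pos by simp
  have pos: "0 < 2 * real k * (real k - 1 + e)" using k1 e by (intro mult_pos_pos) auto
  then show "0 < c" unfolding c_def using e by simp
  have "e \<le> real k * (real k - 1 + e)"
    using k1 e mult_mono[of 1 "real k" e "real k - 1 + e"] by simp
  then show "c \<le> 1 / 2" unfolding c_def using pos by (simp add: field_simps)
qed

lemma \<eta>: "0 < \<eta>" "\<eta> \<le> 1 / 64"
proof -
  show "0 < \<eta>" unfolding \<eta>_def using c card_X by simp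
  have "c / (32 * real (card X)) \<le> (1 / 2) / (32 * 1)"
    using c card_X by (intro frac_le) auto
  then show "\<eta> \<le> 1 / 64" unfolding \<eta>_def by simp
qed

lemma \<delta>: "0 < \<delta>" "\<delta> < 1" "\<delta> * 8 ^ card X * (real (card X) ^ card X * 2 ^ card X / c)\<^sup>2 < 1"
proof -
  define L where "L = 8 ^ card X * (real (card X) ^ card X * 2 ^ card X / c)\<^sup>2"
  have L: "0 \<le> L" unfolding L_def by simp
  have d: "\<delta> = 1 / (2 * (1 + L))" unfolding \<delta>_def L_def ..
  show "0 < \<delta>" "\<delta> < 1" unfolding d using L by auto
  have "\<delta> * L < 1" unfolding d using L by simp
  then show "\<delta> * 8 ^ card X * (real (card X) ^ card X * 2 ^ card X / c)\<^sup>2 < 1"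
    unfolding L_def by (simp add: mult.assoc)
qed

lemma C_pos: "0 < C n"
  by (simp add: zero_less_binomial)

text \<open>Middle sets have sizes in an interval of length at most \<open>2 * \<eta> * n\<close>,
  while \<open>l\<close> and \<open>n - h\<close> are at least \<open>n / 2 - \<eta> * n\<close>;
  this is why \<open>\<beta> = 16 * \<eta>\<close> suffices in both directions.\<close>

lemma middle_low_marginal:
  fixes q :: real
  assumes n: "0 < n" and V: "finite V" "F \<subseteq> V" and F: "F \<subseteq> middle \<eta> n"
    and gap: "\<And>x y. x \<in> F \<Longrightarrow> y \<in> F \<Longrightarrow> card x < card y \<Longrightarrow> card x + g \<le> card y" and g: "0 < g"
    and big: "(real k - 1 + e) * C n \<le> card F"
    and q: "0 < q" "q < 1" "(4 * real g / real n) ^ g / c \<le> q"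
    and Q: "Q \<subseteq> Pow V" "{} \<in> Q" "\<And>J J'. J \<in> Q \<Longrightarrow> J' \<subseteq> J \<Longrightarrow> J' \<in> Q"
    and free: "\<And>J. J \<in> Q \<Longrightarrow> \<not> contains_induced X le J"
  shows "\<exists>v\<in>V. (\<Sum>J\<in>{J\<in>Q. v \<in> J}. wt q V J) < (1 - \<delta>) * q * (\<Sum>J\<in>Q. wt q V J)"
proof -
  have k1: "1 \<le> real k" using k_pos by simp
  define u where "u = \<eta> * n"
  define l where "l = nat \<lceil>n / 2 - u\<rceil>"
  define h where "h = nat \<lfloor>n / 2 + u\<rfloor>"
  have u: "u \<le> n / 64" "0 < u" using \<eta> n mult_right_mono[of \<eta> "1 / 64" "real n"] unfolding u_def by auto
  have lh: "n / 2 - u \<le> l" "h \<le> n / 2 + u" unfolding l_def h_def using u by linarith+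
  have l0: "0 < l" using lh u n by linarith
  have hn: "h < n" using lh u n by linarith
  have lev: "l \<le> card x" "card x \<le> h" if "x \<in> F" for x
  proof -
    have "n / 2 - u \<le> card x" "card x \<le> n / 2 + u"
      using that F unfolding middle_def u_def by (auto simp: abs_le_iff)
    then show "l \<le> card x" "card x \<le> h" unfolding l_def h_def by linarith+
  qed
  have "0 < (real k - 1 + e) * C n" using k1 e C_pos by (intro mult_pos_pos) auto
  then have F0: "F \<noteq> {}" using big by auto
  have w: "2 * (real h - real l) \<le> 16 * \<eta> * (n / 2 - u)"
  proof -
    have "16 * \<eta> * (n / 2 - u) = 8 * u - 16 * (\<eta> * u)" unfolding u_def by (simp add: algebra_simps)
    moreover have "\<eta> * u \<le> 1 / 64 * u" using \<eta> u by (intro mult_right_mono) auto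
    moreover have "2 * (real h - real l) \<le> 4 * u" using lh by argo
    ultimately show ?thesis using u by argo
  qed
  have mono: "16 * \<eta> * (n / 2 - u) \<le> 16 * \<eta> * y" if "n / 2 - u \<le> y" for y
    using that \<eta> by (intro mult_left_mono) auto
  show ?thesis
  proof (rule tree_poset_low_marginal[OF tree V _ F0, where l = l and h = h and g = g and \<beta> = "16 * \<eta>" and c = c and n = n])
    show "F \<subseteq> Pow {..<n}" using F unfolding middle_def by auto
    show "2 * (h - l) \<le> n - h" using lh u by linarith
    show "2 * (real h - real l) \<le> 16 * \<eta> * (real n - real h)"
      using w mono[of "real n - real h"] lh by linarith
    show "2 * (real h - real l) \<le> 16 * \<eta> * real l"
      using w mono[of "real l"] lh by linarith
    show "0 \<le> 16 * \<eta>" using \<eta> by simp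
    show "real (2 * card X) * (16 * \<eta>) \<le> c" unfolding \<eta>_def using card_X by simp
    show "2 * real (height X le) * c * card F \<le> real (card F) - (real (height X le) - 1) * C n"
    proof -
      have s: "0 < real k - 1 + e" using k1 e by simp
      have "2 * real k * (e / (2 * real k * t)) = e / t" for t using k1 by simp
      then have "2 * real k * c = e / (real k - 1 + e)" unfolding c_def .
      moreover have "e / (real k - 1 + e) * card F \<le> real (card F) - (real k - 1) * C n"
      proof -
        have "(real k - 1) * ((real k - 1 + e) * C n) \<le> (real k - 1) * card F"
          using big k1 by (intro mult_left_mono) auto
        then have "e * card F \<le> (real (card F) - (real k - 1) * C n) * (real k - 1 + e)"
          by (simp add: algebra_simps)
        then show ?thesis using s by (simp add: pos_divide_le_eq)
      qed
      ultimately show ?thesis unfolding k[symmetric] by simp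
    qed
    show "(real g / (real n - real h)) ^ g / c \<le> q"
    proof -
      \<comment> \<open>Origin of the factor \<open>4\<close> in the condition on
        \<open>q\<close>.\<close>
      have "real n / 4 \<le> real n - real h" using lh u by linarith
      then have "real g / (real n - real h) \<le> real g / (real n / 4)" using n by (intro divide_left_mono) auto
      then have "(real g / (real n - real h)) ^ g \<le> (4 * real g / real n) ^ g"
        using hn by (intro power_mono) (auto simp: mult.commute)
      then have "(real g / (real n - real h)) ^ g / c \<le> (4 * real g / real n) ^ g / c"
        using c by (intro divide_right_mono) auto
      then show ?thesis using q by linarith
    qed
  qed (use lev l0 hn gap g c q Q free \<delta> in auto)
qed

text \<open>The fingerprint is removed from its own container. A later fingerprint drawn from the
  container is then disjoint from the earlier one, and their sizes add up in the exponent of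
  \<open>p\<close>.\<close>

lemma middle_containers:
  fixes b q :: real
  assumes V: "V \<subseteq> middle \<eta> n" and b: "0 < b" and q: "0 < q" "q \<le> 1 / 2"
    and marg: "\<And>D Q. D \<subseteq> V \<Longrightarrow> b \<le> real (card D) \<Longrightarrow> Q \<subseteq> Pow D \<Longrightarrow> {} \<in> Q \<Longrightarrow>
      (\<And>J J'. J \<in> Q \<Longrightarrow> J' \<subseteq> J \<Longrightarrow> J' \<in> Q) \<Longrightarrow> (\<And>J. J \<in> Q \<Longrightarrow> \<not> contains_induced X le J) \<Longrightarrow>
      \<exists>v\<in>D. (\<Sum>J\<in>{J\<in>Q. v \<in> J}. wt q D J) < (1 - \<delta>) * q * (\<Sum>J\<in>Q. wt q D J)"
  shows "\<exists>cont. (\<forall>I. I \<subseteq> V \<longrightarrow> \<not> contains_induced X le I \<longrightarrow>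
      (\<exists>S\<subseteq>I. I \<subseteq> S \<union> cont S \<and> real (card S) \<le> 2 * q * card V / \<delta>)) \<and>
    (\<forall>S. cont S \<subseteq> V \<and> S \<inter> cont S = {} \<and> card (cont S) \<le> b)"
proof -
  have fV: "finite V" using V finite_subset by (metis finite_middle)
  have "\<exists>cont. (\<forall>I. I \<subseteq> V \<longrightarrow> I \<in> {I. \<not> contains_induced X le I} \<longrightarrow>
      (\<exists>S\<subseteq>I. I \<subseteq> S \<union> cont S \<and> real (card S) \<le> 2 * q * card V / \<delta>)) \<and>
    (\<forall>S. cont S \<subseteq> V \<and> card (cont S) < b)"
    using contains_induced_mono
    by (intro containers_card[OF q \<delta>(1,2) b _ _ fV] marg) blast+
  then obtain cont where cont: "\<forall>I. I \<subseteq> V \<longrightarrow> I \<in> {I. \<not> contains_induced X le I} \<longrightarrow>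
      (\<exists>S\<subseteq>I. I \<subseteq> S \<union> cont S \<and> real (card S) \<le> 2 * q * card V / \<delta>)"
    "\<forall>S. cont S \<subseteq> V \<and> card (cont S) < b" by (elim exE conjE)
  show ?thesis
  proof (intro exI[of _ "\<lambda>S. cont S - S"] conjI allI impI)
    fix I assume I: "I \<subseteq> V" "\<not> contains_induced X le I"
    then have "\<exists>S\<subseteq>I. I \<subseteq> S \<union> cont S \<and> real (card S) \<le> 2 * q * card V / \<delta>"
      by (intro cont(1)[rule_format]) simp_all
    then obtain S where "S \<subseteq> I" "I \<subseteq> S \<union> cont S" "real (card S) \<le> 2 * q * card V / \<delta>"
      by blast
    then show "\<exists>S\<subseteq>I. I \<subseteq> S \<union> (cont S - S) \<and> real (card S) \<le> 2 * q * card V / \<delta>" by auto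
  next
    fix S
    have "card (cont S - S) \<le> card (cont S)"
      using cont(2) fV by (intro card_mono) (auto intro: finite_subset)
    then show "card (cont S - S) \<le> b" using cont(2)[rule_format, of S] by linarith
  qed (use cont(2) in auto)
qed

text \<open>The first round must bring \<open>2 ^ n\<close> down to a multiple of \<open>C n\<close> at negligible cost in the union bound.
  It works in a single residue class of levels modulo 3, where the \<open>1 / n\<close> of the spread bound
  improves to \<open>1 / n ^ 3\<close>.\<close>
lemma two_containers:
  fixes q\<^sub>1 q\<^sub>2 :: real
  assumes n: "0 < n" and q1: "0 < q\<^sub>1" "q\<^sub>1 \<le> 1 / 2" "(12 / real n) ^ 3 / c \<le> q\<^sub>1"
    and q2: "0 < q\<^sub>2" "q\<^sub>2 \<le> 1 / 2" "(4 / real n) / c \<le> q\<^sub>2"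
  shows "\<exists>C\<^sub>1 C\<^sub>2. (\<forall>S. C\<^sub>1 S \<subseteq> middle \<eta> n \<and> S \<inter> C\<^sub>1 S = {} \<and> card (C\<^sub>1 S) \<le> 3 * real k * C n) \<and>
    (\<forall>S T. C\<^sub>2 S T \<subseteq> middle \<eta> n \<and> card (C\<^sub>2 S T) \<le> (real k - 1 + e) * C n) \<and>
    (\<forall>I. I \<subseteq> middle \<eta> n \<longrightarrow> \<not> contains_induced X le I \<longrightarrow>
      (\<exists>S\<subseteq>I. \<exists>T\<subseteq>I \<inter> C\<^sub>1 S. I \<subseteq> S \<union> T \<union> C\<^sub>2 S T \<and>
        real (card S) \<le> 2 * q\<^sub>1 * card (middle \<eta> n) / \<delta> \<and> real (card T) \<le> 2 * q\<^sub>2 * (3 * real k * C n) / \<delta>))"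
proof -
  have k1: "1 \<le> real k" using k_pos by simp
  have "\<exists>cont. (\<forall>I. I \<subseteq> middle \<eta> n \<longrightarrow> \<not> contains_induced X le I \<longrightarrow>
      (\<exists>S\<subseteq>I. I \<subseteq> S \<union> cont S \<and> real (card S) \<le> 2 * q\<^sub>1 * card (middle \<eta> n) / \<delta>)) \<and>
    (\<forall>S. cont S \<subseteq> middle \<eta> n \<and> S \<inter> cont S = {} \<and> card (cont S) \<le> 3 * real k * C n)"
  proof (rule middle_containers[OF subset_refl _ q1(1,2)])
    show "0 < 3 * real k * C n" using k1 C_pos by simp
    fix D Q assume D: "D \<subseteq> middle \<eta> n" "3 * real k * C n \<le> real (card D)"
      and Q: "Q \<subseteq> Pow D" "{} \<in> Q" "\<And>J J'. J \<in> Q \<Longrightarrow> J' \<subseteq> J \<Longrightarrow> J' \<in> Q"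
      "\<And>J. J \<in> Q \<Longrightarrow> \<not> contains_induced X le J"
    have fD: "finite D" using D(1) finite_subset finite_middle by blast
    define F where "F r = {x\<in>D. card x mod 3 = r}" for r
    \<comment> \<open>The fullest of the three classes keeps a third of \<open>D\<close>, hence at
      least \<open>k * C n\<close> sets, which is still at least \<open>(k - 1 + e) * C n\<close>
      because \<open>e \<le> 1\<close>.\<close>
    have "\<exists>r. real (card D) \<le> 3 * real (card (F r))"
    proof (rule ccontr)
      assume "\<not> ?thesis"
      then have lt: "3 * real (card (F r)) < card D" for r by (simp add: not_le)
      have "D = F 0 \<union> F 1 \<union> F 2" unfolding F_def by auto
      then have "card D \<le> card (F 0) + card (F 1) + card (F 2)"
        by (metis card_Un_le order_trans add_right_mono)
      then show False using lt[of 0] lt[of 1] lt[of 2] by linarith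
    qed
    then obtain r where r: "real (card D) \<le> 3 * real (card (F r))" by blast
    show "\<exists>v\<in>D. (\<Sum>J\<in>{J\<in>Q. v \<in> J}. wt q\<^sub>1 D J) < (1 - \<delta>) * q\<^sub>1 * (\<Sum>J\<in>Q. wt q\<^sub>1 D J)"
    proof (rule middle_low_marginal[OF n fD, of "F r" 3])
      show "F r \<subseteq> D" "F r \<subseteq> middle \<eta> n" using D(1) unfolding F_def by auto
      show "card x + 3 \<le> card y" if "x \<in> F r" "y \<in> F r" "card x < card y" for x y
      proof -
        have "card x mod 3 = card y mod 3" using that unfolding F_def by simp
        then show ?thesis using that(3) by presburger
      qed
      have "(real k - 1 + e) * C n \<le> real k * C n" using e C_pos[of n] by (intro mult_right_mono) auto
      also have "\<dots> \<le> card (F r)" using D(2) r by simp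
      finally show "(real k - 1 + e) * C n \<le> card (F r)" .
    qed (use q1 Q in auto)
  qed
  then obtain C\<^sub>1 where C1: "\<forall>I. I \<subseteq> middle \<eta> n \<longrightarrow> \<not> contains_induced X le I \<longrightarrow>
      (\<exists>S\<subseteq>I. I \<subseteq> S \<union> C\<^sub>1 S \<and> real (card S) \<le> 2 * q\<^sub>1 * card (middle \<eta> n) / \<delta>)"
    "\<forall>S. C\<^sub>1 S \<subseteq> middle \<eta> n \<and> S \<inter> C\<^sub>1 S = {} \<and> card (C\<^sub>1 S) \<le> 3 * real k * C n"
    by (elim exE conjE)
  have "\<exists>cont. (\<forall>I. I \<subseteq> C\<^sub>1 S \<longrightarrow> \<not> contains_induced X le I \<longrightarrow>
      (\<exists>T\<subseteq>I. I \<subseteq> T \<union> cont T \<and> real (card T) \<le> 2 * q\<^sub>2 * card (C\<^sub>1 S) / \<delta>)) \<and>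
    (\<forall>T. cont T \<subseteq> C\<^sub>1 S \<and> T \<inter> cont T = {} \<and> card (cont T) \<le> (real k - 1 + e) * C n)" for S
  proof (rule middle_containers[OF _ _ q2(1,2)])
    show S: "C\<^sub>1 S \<subseteq> middle \<eta> n" using C1(2) by blast
    show "0 < (real k - 1 + e) * C n" using k1 e C_pos by (intro mult_pos_pos) auto
    fix D Q assume D: "D \<subseteq> C\<^sub>1 S" "(real k - 1 + e) * C n \<le> real (card D)"
      and Q: "Q \<subseteq> Pow D" "{} \<in> Q" "\<And>J J'. J \<in> Q \<Longrightarrow> J' \<subseteq> J \<Longrightarrow> J' \<in> Q"
      "\<And>J. J \<in> Q \<Longrightarrow> \<not> contains_induced X le J"
    have D': "D \<subseteq> middle \<eta> n" using D(1) S by blast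
    have fD: "finite D" using D' finite_subset finite_middle by blast
    show "\<exists>v\<in>D. (\<Sum>J\<in>{J\<in>Q. v \<in> J}. wt q\<^sub>2 D J) < (1 - \<delta>) * q\<^sub>2 * (\<Sum>J\<in>Q. wt q\<^sub>2 D J)"
    \<comment> \<open>The second round uses all levels of \<open>D\<close>, so the gap is
      \<open>1\<close> and the required \<open>q\<^sub>2\<close> is of order
      \<open>1 / n\<close>.\<close>
    proof (rule middle_low_marginal[OF n fD subset_refl D', of 1])
      show "(4 * real 1 / real n) ^ 1 / c \<le> q\<^sub>2" using q2(3) by simp
      show "q\<^sub>2 < 1" using q2(2) by simp
      show "card x + 1 \<le> card y" if "x \<in> D" "y \<in> D" "card x < card y" for x y using that by simp
      show "0 < (1 :: nat)" by simp
      show "J' \<in> Q" if "J \<in> Q" "J' \<subseteq> J" for J J' using that by (rule Q(3))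
      show "\<not> contains_induced X le J" if "J \<in> Q" for J using that by (rule Q(4))
    qed (rule q2(1) D(2) Q(1) Q(2))+
  qed
  then have "\<exists>C\<^sub>2. \<forall>S. (\<forall>I. I \<subseteq> C\<^sub>1 S \<longrightarrow> \<not> contains_induced X le I \<longrightarrow>
      (\<exists>T\<subseteq>I. I \<subseteq> T \<union> C\<^sub>2 S T \<and> real (card T) \<le> 2 * q\<^sub>2 * card (C\<^sub>1 S) / \<delta>)) \<and>
    (\<forall>T. C\<^sub>2 S T \<subseteq> C\<^sub>1 S \<and> T \<inter> C\<^sub>2 S T = {} \<and> card (C\<^sub>2 S T) \<le> (real k - 1 + e) * C n)"
    by (intro choice allI)
  then obtain C\<^sub>2 where C2': "\<forall>S. (\<forall>I. I \<subseteq> C\<^sub>1 S \<longrightarrow> \<not> contains_induced X le I \<longrightarrow>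
      (\<exists>T\<subseteq>I. I \<subseteq> T \<union> C\<^sub>2 S T \<and> real (card T) \<le> 2 * q\<^sub>2 * card (C\<^sub>1 S) / \<delta>)) \<and>
    (\<forall>T. C\<^sub>2 S T \<subseteq> C\<^sub>1 S \<and> T \<inter> C\<^sub>2 S T = {} \<and> card (C\<^sub>2 S T) \<le> (real k - 1 + e) * C n)"
    by (elim exE)
  note C2 = C2'[THEN spec, THEN conjunct1] C2'[THEN spec, THEN conjunct2, THEN spec]
  note C1S = C1(2)[THEN spec, THEN conjunct1] and C1c = C1(2)[THEN spec, THEN conjunct2, THEN conjunct2]
  show ?thesis
  proof (intro exI[of _ C\<^sub>1] exI[of _ C\<^sub>2] conjI[OF C1(2)] conjI allI impI)
    fix S T
    show "C\<^sub>2 S T \<subseteq> middle \<eta> n" by (rule subset_trans[OF C2(2)[THEN conjunct1] C1S])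
    show "card (C\<^sub>2 S T) \<le> (real k - 1 + e) * C n" by (rule C2(2)[THEN conjunct2, THEN conjunct2])
  next
    fix I assume I: "I \<subseteq> middle \<eta> n" "\<not> contains_induced X le I"
    obtain S where S: "S \<subseteq> I" "I \<subseteq> S \<union> C\<^sub>1 S" "real (card S) \<le> 2 * q\<^sub>1 * card (middle \<eta> n) / \<delta>"
      using C1(1)[rule_format, OF I] by blast
    have "\<not> contains_induced X le (I \<inter> C\<^sub>1 S)"
      using I(2) contains_induced_mono[of X le "I \<inter> C\<^sub>1 S" I] by blast
    then have "\<exists>T\<subseteq>I \<inter> C\<^sub>1 S. I \<inter> C\<^sub>1 S \<subseteq> T \<union> C\<^sub>2 S T \<and> real (card T) \<le> 2 * q\<^sub>2 * card (C\<^sub>1 S) / \<delta>"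
      by (intro C2(1)[rule_format]) simp_all
    then obtain T where T: "T \<subseteq> I \<inter> C\<^sub>1 S" "I \<inter> C\<^sub>1 S \<subseteq> T \<union> C\<^sub>2 S T" "real (card T) \<le> 2 * q\<^sub>2 * card (C\<^sub>1 S) / \<delta>"
      by blast
    have "2 * q\<^sub>2 * card (C\<^sub>1 S) / \<delta> \<le> 2 * q\<^sub>2 * (3 * real k * C n) / \<delta>"
      using C1c[of S] q2 \<delta> by (intro divide_right_mono mult_left_mono) auto
    then have cT: "real (card T) \<le> 2 * q\<^sub>2 * (3 * real k * C n) / \<delta>" using T(3) by (rule order_trans[rotated])
    have IT: "I \<subseteq> S \<union> T \<union> C\<^sub>2 S T" using S(2) T(2) by blast
    show "\<exists>S\<subseteq>I. \<exists>T\<subseteq>I \<inter> C\<^sub>1 S. I \<subseteq> S \<union> T \<union> C\<^sub>2 S T \<and>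
        real (card S) \<le> 2 * q\<^sub>1 * card (middle \<eta> n) / \<delta> \<and> real (card T) \<le> 2 * q\<^sub>2 * (3 * real k * C n) / \<delta>"
      by (intro exI[of _ S] exI[of _ T] conjI S(1,3) T(1) cT IT)
  qed
qed

text \<open>A large free subfamily of \<open>R\<close> consists of its sets far from the middle, two
  fingerprints and a part inside the final container. With budgets \<open>m\<^sub>0\<close>,
  \<open>s\<^sub>1\<close>, \<open>s\<^sub>2\<close> and \<open>m\<close>, the far part or the
  container part must reach its budget; the latter is handled by a union bound over the fingerprint
  pairs contained in \<open>R\<close>.\<close>

lemma upper_tail:
  fixes p q\<^sub>1 q\<^sub>2 y\<^sub>1 y\<^sub>2 a s\<^sub>1 s\<^sub>2 m\<^sub>0 m :: real
  assumes n: "0 < n" and p: "0 \<le> p" "p \<le> 1"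
    and q1: "0 < q\<^sub>1" "q\<^sub>1 \<le> 1 / 2" "(12 / real n) ^ 3 / c \<le> q\<^sub>1"
    and q2: "0 < q\<^sub>2" "q\<^sub>2 \<le> 1 / 2" "(4 / real n) / c \<le> q\<^sub>2"
    and y: "0 < y\<^sub>1" "y\<^sub>1 \<le> 1" "0 < y\<^sub>2" "y\<^sub>2 \<le> 1" and a: "1 \<le> a"
    and s1: "s\<^sub>1 = 2 * q\<^sub>1 * card (middle \<eta> n) / \<delta>" and s2: "s\<^sub>2 = 2 * q\<^sub>2 * (3 * real k * C n) / \<delta>"
  shows "prob_Pnp n p (\<lambda>R. m\<^sub>0 + s\<^sub>1 + s\<^sub>2 + m < max_free X le R) \<le>
    exp (p * card (boolean_lattice n - middle \<eta> n)) * 2 powr (- m\<^sub>0) +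
    (exp (p * a * y\<^sub>1 * card (middle \<eta> n)) * y\<^sub>1 powr (- s\<^sub>1)) * (exp (p * a * y\<^sub>2 * (3 * real k * C n)) * y\<^sub>2 powr (- s\<^sub>2)) *
      (exp (p * (a - 1) * ((real k - 1 + e) * C n)) * a powr (- m))"
proof -
  let ?B = "boolean_lattice n" and ?M = "middle \<eta> n"
  obtain C\<^sub>1 C\<^sub>2 where C12: "\<forall>S. C\<^sub>1 S \<subseteq> ?M \<and> S \<inter> C\<^sub>1 S = {} \<and> card (C\<^sub>1 S) \<le> 3 * real k * C n"
    "\<forall>S T. C\<^sub>2 S T \<subseteq> ?M \<and> card (C\<^sub>2 S T) \<le> (real k - 1 + e) * C n"
    "\<forall>I. I \<subseteq> ?M \<longrightarrow> \<not> contains_induced X le I \<longrightarrow>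
      (\<exists>S\<subseteq>I. \<exists>T\<subseteq>I \<inter> C\<^sub>1 S. I \<subseteq> S \<union> T \<union> C\<^sub>2 S T \<and> real (card S) \<le> s\<^sub>1 \<and> real (card T) \<le> s\<^sub>2)"
    using two_containers[OF n q1 q2] unfolding s1 s2 by (elim exE conjE)
  have MB: "?M \<subseteq> ?B" unfolding middle_def boolean_lattice_def by auto
  have fin: "finite F" if "F \<subseteq> ?M" for F using finite_subset[OF that] by simp
  let ?S1 = "{S\<in>Pow ?M. card S \<le> s\<^sub>1}" and ?S2 = "\<lambda>S. {T\<in>Pow (C\<^sub>1 S). card T \<le> s\<^sub>2}"
  note C1S = C12(1)[THEN spec, THEN conjunct1]
    and C1d = C12(1)[THEN spec, THEN conjunct2, THEN conjunct1]
    and C1c = C12(1)[THEN spec, THEN conjunct2, THEN conjunct2]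
    and C2S = C12(2)[THEN spec, THEN spec, THEN conjunct1]
    and C2c = C12(2)[THEN spec, THEN spec, THEN conjunct2]
  have fC1: "finite (C\<^sub>1 S)" for S by (rule fin[OF C1S])
  have fS: "finite ?S1" "finite (?S2 S)" for S using fC1 by auto
  have "prob_Pnp n p (\<lambda>R. m\<^sub>0 + s\<^sub>1 + s\<^sub>2 + m < max_free X le R) \<le>
    prob_Pnp n p (\<lambda>R. ({} \<subseteq> R \<and> m\<^sub>0 \<le> card (R \<inter> (?B - ?M))) \<or>
      (\<exists>S\<in>?S1. \<exists>T\<in>?S2 S. S \<union> T \<subseteq> R \<and> m \<le> card (R \<inter> C\<^sub>2 S T)))"
  proof (rule prob_Pnp_mono[OF p])
    fix R assume R: "R \<subseteq> ?B" and big: "m\<^sub>0 + s\<^sub>1 + s\<^sub>2 + m < max_free X le R"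
    have fR: "finite R" using finite_subset[OF R] by simp
    obtain G where G: "G \<subseteq> R" "\<not> contains_induced X le G" "card G = max_free X le R"
      using max_free_bounds(2)[OF X(1) fR] by blast
    have fG: "finite G" using G(1) fR finite_subset by blast
    have "\<not> contains_induced X le (G \<inter> ?M)" using G(2) contains_induced_mono[of X le "G \<inter> ?M" G] by blast
    then have "\<exists>S\<subseteq>G \<inter> ?M. \<exists>T\<subseteq>G \<inter> ?M \<inter> C\<^sub>1 S. G \<inter> ?M \<subseteq> S \<union> T \<union> C\<^sub>2 S T \<and> real (card S) \<le> s\<^sub>1 \<and> real (card T) \<le> s\<^sub>2"
      by (intro C12(3)[rule_format]) simp_all
    then obtain S T where ST: "S \<subseteq> G \<inter> ?M" "T \<subseteq> G \<inter> ?M \<inter> C\<^sub>1 S" "G \<inter> ?M \<subseteq> S \<union> T \<union> C\<^sub>2 S T"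
      "real (card S) \<le> s\<^sub>1" "real (card T) \<le> s\<^sub>2"
      by blast
    have "G \<subseteq> (R \<inter> (?B - ?M)) \<union> S \<union> T \<union> (R \<inter> C\<^sub>2 S T)" using ST(3) G(1) R by blast
    then have "card G \<le> card ((R \<inter> (?B - ?M)) \<union> S \<union> T \<union> (R \<inter> C\<^sub>2 S T))"
      using ST fR fG by (intro card_mono) (auto intro: finite_subset)
    also have "\<dots> \<le> card (R \<inter> (?B - ?M)) + card S + card T + card (R \<inter> C\<^sub>2 S T)"
      by (meson add_mono card_Un_le order_refl order_trans)
    finally have "real (card G) \<le> card (R \<inter> (?B - ?M)) + card S + card T + card (R \<inter> C\<^sub>2 S T)" by linarith
    then have "m\<^sub>0 \<le> card (R \<inter> (?B - ?M)) \<or> m \<le> card (R \<inter> C\<^sub>2 S T)" using big G(3) ST(4,5) by linarith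
    moreover have "S \<in> ?S1" "T \<in> ?S2 S" "S \<union> T \<subseteq> R" using ST G(1) by auto
    ultimately show "({} \<subseteq> R \<and> m\<^sub>0 \<le> card (R \<inter> (?B - ?M))) \<or>
      (\<exists>S\<in>?S1. \<exists>T\<in>?S2 S. S \<union> T \<subseteq> R \<and> m \<le> card (R \<inter> C\<^sub>2 S T))" by blast
  qed
  also have "\<dots> \<le> prob_Pnp n p (\<lambda>R. {} \<subseteq> R \<and> m\<^sub>0 \<le> card (R \<inter> (?B - ?M))) +
    prob_Pnp n p (\<lambda>R. \<exists>S\<in>?S1. \<exists>T\<in>?S2 S. S \<union> T \<subseteq> R \<and> m \<le> card (R \<inter> C\<^sub>2 S T))"
    by (rule prob_Pnp_disj[OF p])
  also have "prob_Pnp n p (\<lambda>R. {} \<subseteq> R \<and> m\<^sub>0 \<le> card (R \<inter> (?B - ?M))) \<le> exp (p * card (?B - ?M)) * 2 powr (- m\<^sub>0)"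
    using prob_upper_tail[OF p, of "{}" n "?B - ?M" 2 m\<^sub>0] by simp
  also have "prob_Pnp n p (\<lambda>R. \<exists>S\<in>?S1. \<exists>T\<in>?S2 S. S \<union> T \<subseteq> R \<and> m \<le> card (R \<inter> C\<^sub>2 S T)) \<le>
    (\<Sum>S\<in>?S1. \<Sum>T\<in>?S2 S. prob_Pnp n p (\<lambda>R. S \<union> T \<subseteq> R \<and> m \<le> card (R \<inter> C\<^sub>2 S T)))"
    by (rule order_trans[OF prob_Pnp_bex[OF p fS(1)]], intro sum_mono prob_Pnp_bex[OF p fS(2)])
  also have "\<dots> \<le> (\<Sum>S\<in>?S1. \<Sum>T\<in>?S2 S. (p * a) ^ card S * ((p * a) ^ card T *
      (exp (p * (a - 1) * ((real k - 1 + e) * C n)) * a powr (- m))))"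
  proof (intro sum_mono)
    fix S T assume S: "S \<in> ?S1" and T: "T \<in> ?S2 S"
    have SM: "S \<subseteq> ?M" using S by simp
    have TC: "T \<subseteq> C\<^sub>1 S" using T by simp
    have TM: "T \<subseteq> ?M" using TC C1S[of S] by (rule subset_trans)
    have "S \<inter> T = {}" using TC C1d[of S] by blast
    then have cST: "card (S \<union> T) = card S + card T" using fin[OF SM] fin[OF TM] by (rule card_Un_disjoint[rotated 2])
    have "prob_Pnp n p (\<lambda>R. S \<union> T \<subseteq> R \<and> m \<le> card (R \<inter> C\<^sub>2 S T))
      \<le> (p * a) ^ card (S \<union> T) * exp (p * (a - 1) * card (C\<^sub>2 S T)) * a powr (- m)"
      using SM TM MB C2S[of S T] by (intro prob_upper_tail[OF p _ _ a]) blast+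
    also have "\<dots> \<le> (p * a) ^ card (S \<union> T) * exp (p * (a - 1) * ((real k - 1 + e) * C n)) * a powr (- m)"
      using C2c[of S T] p a by (intro mult_right_mono mult_left_mono) (auto intro!: mult_left_mono)
    finally show "prob_Pnp n p (\<lambda>R. S \<union> T \<subseteq> R \<and> m \<le> card (R \<inter> C\<^sub>2 S T)) \<le> (p * a) ^ card S * ((p * a) ^ card T *
      (exp (p * (a - 1) * ((real k - 1 + e) * C n)) * a powr (- m)))"
      by (simp add: cST power_add mult.assoc)
  qed
  also have "\<dots> = (\<Sum>S\<in>?S1. (p * a) ^ card S * ((\<Sum>T\<in>?S2 S. (p * a) ^ card T) *
      (exp (p * (a - 1) * ((real k - 1 + e) * C n)) * a powr (- m))))"
    by (simp only: sum_distrib_left sum_distrib_right)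
  also have "\<dots> \<le> (\<Sum>S\<in>?S1. (p * a) ^ card S * ((exp (p * a * y\<^sub>2 * (3 * real k * C n)) * y\<^sub>2 powr (- s\<^sub>2)) *
      (exp (p * (a - 1) * ((real k - 1 + e) * C n)) * a powr (- m))))"
  proof (rule sum_mono)
    fix S
    have pa: "0 \<le> p * a" using p a by simp
    have "(\<Sum>T\<in>?S2 S. (p * a) ^ card T) \<le> exp (p * a * y\<^sub>2 * card (C\<^sub>1 S)) * y\<^sub>2 powr (- s\<^sub>2)"
      using fC1 pa y by (intro sum_small_subsets_le)
    also have "\<dots> \<le> exp (p * a * y\<^sub>2 * (3 * real k * C n)) * y\<^sub>2 powr (- s\<^sub>2)"
      using C1c[of S] pa y by (intro mult_right_mono) (auto intro!: mult_left_mono)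
    finally show "(p * a) ^ card S * ((\<Sum>T\<in>?S2 S. (p * a) ^ card T) *
      (exp (p * (a - 1) * ((real k - 1 + e) * C n)) * a powr (- m))) \<le> (p * a) ^ card S * ((exp (p * a * y\<^sub>2 * (3 * real k * C n)) * y\<^sub>2 powr (- s\<^sub>2)) *
      (exp (p * (a - 1) * ((real k - 1 + e) * C n)) * a powr (- m)))"
      using pa by (intro mult_left_mono mult_right_mono) auto
  qed
  also have "\<dots> = (\<Sum>S\<in>?S1. (p * a) ^ card S) * ((exp (p * a * y\<^sub>2 * (3 * real k * C n)) * y\<^sub>2 powr (- s\<^sub>2)) *
      (exp (p * (a - 1) * ((real k - 1 + e) * C n)) * a powr (- m)))"
    by (simp only: sum_distrib_right)
  also have "\<dots> \<le> (exp (p * a * y\<^sub>1 * card ?M) * y\<^sub>1 powr (- s\<^sub>1)) * ((exp (p * a * y\<^sub>2 * (3 * real k * C n)) * y\<^sub>2 powr (- s\<^sub>2)) *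
      (exp (p * (a - 1) * ((real k - 1 + e) * C n)) * a powr (- m)))"
    using p a y by (intro mult_right_mono sum_small_subsets_le) auto
  finally show ?thesis by (simp add: mult.assoc)
qed

end

section \<open>The two asymptotic bounds\<close>

context tree_poset_density
begin

text \<open>The central coefficient grows exponentially, whereas \<open>p n\<close> is eventually at
  least \<open>1 / n\<close>. The error terms below have the form \<open>exp (- a * P n)\<close>, so
  this makes them vanish.\<close>

lemma expected_size_at_top:
  assumes p: "filterlim (\<lambda>n. p n * real n) at_top sequentially"
  shows "filterlim (\<lambda>n. p n * C n) at_top sequentially"
proof (rule filterlim_at_top_mono)
  show "filterlim (\<lambda>n. 2 ^ n / (real n + 1) / real n) at_top sequentially" by real_asymp
  show "\<forall>\<^sub>F n in sequentially. 2 ^ n / (real n + 1) / real n \<le> p n * C n"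
    using p[unfolded filterlim_at_top, rule_format, of 1] eventually_gt_at_top[of 0]
  proof eventually_elim
    case (elim n)
    have "2 ^ n / (real n + 1) / real n \<le> C n / real n"
      using central_binomial_ge[of n] by (intro divide_right_mono) auto
    also have "\<dots> = 1 / real n * C n" by simp
    also have "\<dots> \<le> p n * C n"
      using elim by (intro mult_right_mono) (auto simp: divide_le_eq)
    finally show ?case .
  qed
qed

text \<open>\<open>\<kappa>\<close> will be the ratio of \<open>q\<^sub>2\<close> to
  \<open>p\<close>. The second fingerprint then has \<open>O (\<kappa>) * p * C n\<close> members,
  and the sum over its choices costs an exponent of order
  \<open>\<kappa> * ln (1 / \<kappa>)\<close>, which tends to zero with
  \<open>\<kappa>\<close>.\<close>

lemma small_fingerprint_constant:
  assumes "0 < \<epsilon>" "0 < a" "0 < b"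
  shows "\<exists>\<kappa>>0. \<kappa> \<le> 1 / 2 \<and> a * \<kappa> \<le> e \<and> b * \<kappa> + a * \<kappa> * ln (1 / \<kappa>) \<le> (\<epsilon> :: real)"
proof -
  have "((\<lambda>\<kappa>. a * \<kappa>) \<longlongrightarrow> 0) (at_right 0)" "((\<lambda>\<kappa>. b * \<kappa> + a * \<kappa> * ln (1 / \<kappa>)) \<longlongrightarrow> 0) (at_right 0)"
    using assms by real_asymp+
  then have "\<forall>\<^sub>F \<kappa> in at_right 0. a * \<kappa> < e" "\<forall>\<^sub>F \<kappa> in at_right 0. b * \<kappa> + a * \<kappa> * ln (1 / \<kappa>) < \<epsilon>"
    using e assms by (auto dest: order_tendstoD)
  moreover have "\<forall>\<^sub>F \<kappa> in at_right 0. \<kappa> \<in> {0<..<1 / 2 :: real}"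
    by (intro eventually_at_right_real) simp
  ultimately have "\<forall>\<^sub>F \<kappa> in at_right 0. \<kappa> \<in> {0<..<1 / 2} \<and> a * \<kappa> < e \<and> b * \<kappa> + a * \<kappa> * ln (1 / \<kappa>) < \<epsilon>"
    by eventually_elim auto
  then obtain \<kappa> where "\<kappa> \<in> {0<..<1 / 2} \<and> a * \<kappa> < e \<and> b * \<kappa> + a * \<kappa> * ln (1 / \<kappa>) < \<epsilon>"
    using eventually_happens'[OF trivial_limit_at_right_real[of 0]] by blast
  then show ?thesis by (intro exI[of _ \<kappa>]) auto
qed

text \<open>The slack \<open>8 * e\<close> is spent as \<open>e\<close> for the far sets,
  \<open>e\<close> for each of the two fingerprints and \<open>5 * e\<close> for the container. The
  container has at most \<open>(k - 1 + e) * C n\<close> members, so an excess of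
  \<open>4 * e\<close> is left to drive the tail bound.\<close>

lemma upper_limit:
  assumes p: "\<And>n. 0 \<le> p n \<and> p n \<le> 1" and pn: "filterlim (\<lambda>n. p n * real n) at_top sequentially"
  shows "(\<lambda>n. prob_Pnp n (p n) (\<lambda>R. (real k - 1 + 8 * e) * (p n * C n) < max_free X le R)) \<longlonglongrightarrow> 0"
proof -
  have k1: "1 \<le> real k" using k_pos by simp
  \<comment> \<open>With this \<open>t\<close> the quadratic error
    \<open>(k - 1 + 5 * e) * t\<^sup>2\<close> from \<open>ln (1 + t) \<ge> t - t\<^sup>2\<close> is
    at most \<open>e * t\<close>, a quarter of the linear gain \<open>4 * e * t\<close>.\<close>
  define t where "t = e / (real k + 5)"
  have t: "0 < t" "t \<le> 1" "(real k + 5) * t = e" unfolding t_def using e k1 by auto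
  obtain \<kappa> where \<kappa>: "0 < \<kappa>" "\<kappa> \<le> 1 / 2" "6 * real k / \<delta> * \<kappa> \<le> e"
    "6 * real k * \<kappa> + 6 * real k / \<delta> * \<kappa> * ln (1 / \<kappa>) \<le> e * t / 2"
    using small_fingerprint_constant[of "e * t / 2" "6 * real k / \<delta>" "6 * real k"] e t k1 \<delta> by auto
  define P where "P n = p n * C n" for n
  have P: "filterlim P at_top sequentially" unfolding P_def by (rule expected_size_at_top[OF pn])
  let ?pr = "\<lambda>n. prob_Pnp n (p n) (\<lambda>R. (real k - 1 + 8 * e) * P n < max_free X le R)"
  have l1: "(\<lambda>n. (12 / real n) ^ 3 / real n powr (- 5 / 2)) \<longlonglongrightarrow> 0"
    and l2: "(\<lambda>n. real n powr (- 5 / 2)) \<longlonglongrightarrow> 0"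
    and l3: "(\<lambda>n. 2 * (real n + 1) / (real n)\<^sup>2) \<longlonglongrightarrow> 0"
    and l4: "(\<lambda>n. real n powr (- 5 / 2) * (real n + 1) * real n * ln (real n)) \<longlonglongrightarrow> 0"
    and l5: "(\<lambda>n. real n powr (- 5 / 2) * (real n + 1) * real n) \<longlonglongrightarrow> 0" by real_asymp+
  have d: "0 < e * t / 4" "0 < e * t * \<delta> / 16" "0 < e * \<delta> / 2" "0 < e / 4" "0 < 1 / (2 :: real)" using e t \<delta> by auto
  note ev = order_tendstoD(2)[OF l1 c(1)] order_tendstoD(2)[OF l2 d(5)] order_tendstoD(2)[OF l3 d(1)]
    order_tendstoD(2)[OF l4 d(2)] order_tendstoD(2)[OF l5 d(3)] order_tendstoD(2)[OF far_sets_negligible[OF \<eta>(1)] d(4)]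
  have "\<forall>\<^sub>F n in sequentially. ?pr n \<le> exp (- (e / 4) * P n) + exp (- (2 * e * t) * P n)"
    using ev pn[unfolded filterlim_at_top, rule_format, of 1] pn[unfolded filterlim_at_top, rule_format, of "4 / (c * \<kappa>)"]
      eventually_ge_at_top[of 2]
  proof eventually_elim
    case (elim n)
    have n: "0 < n" "1 \<le> real n" using elim by auto
    \<comment> \<open>The exponent lies between two constraints. The spread bound with gap
      \<open>3\<close> needs \<open>q\<close> of order at least \<open>1 / n ^ 3\<close>. On the
      other hand \<open>q * n ^ 2 * ln n\<close> must tend to zero, because the middle is only
      bounded by \<open>(n + 1) * n * P n\<close> and each element of the fingerprint costs a factor
      \<open>n ^ 2\<close>.\<close>
    define q where "q = real n powr (- 5 / 2)"
    have q: "0 < q" unfolding q_def using n by simp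
    have p0: "0 < p n" using elim(7) n p[of n] by (cases "p n = 0") auto
    have P0: "0 < P n" unfolding P_def using p0 C_pos by simp
    have CP: "C n \<le> n * P n" using mult_right_mono[OF elim(7), of "C n"] by (simp add: P_def mult_ac)
    define m\<^sub>M where "m\<^sub>M = real (card (middle \<eta> n))"
    have mM: "m\<^sub>M \<le> (real n + 1) * C n"
    proof -
      have "card (middle \<eta> n) \<le> card (Pow {..<n})" unfolding middle_def by (intro card_mono) auto
      then have "m\<^sub>M \<le> 2 ^ n" unfolding m\<^sub>M_def by (simp add: card_Pow flip: of_nat_le_iff)
      then show ?thesis using central_binomial_ge[of n] by (simp add: field_simps)
    qed
    have mM': "m\<^sub>M \<le> (real n + 1) * (n * P n)"
      using mM CP by (rule order_trans[OF _ mult_left_mono]) simp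
    define s\<^sub>1 where "s\<^sub>1 = 2 * q * m\<^sub>M / \<delta>"
    define s\<^sub>2 where "s\<^sub>2 = 2 * (\<kappa> * p n) * (3 * real k * C n) / \<delta>"
    have s1q: "s\<^sub>1 \<le> 2 / \<delta> * (q * (real n + 1) * n) * P n"
    proof -
      have "2 / \<delta> * q * m\<^sub>M \<le> 2 / \<delta> * q * ((real n + 1) * (n * P n))"
        using mM' q \<delta> by (intro mult_left_mono) auto
      then show ?thesis unfolding s\<^sub>1_def by (simp add: mult_ac)
    qed
    also have "\<dots> \<le> 2 / \<delta> * (e * \<delta> / 2) * P n"
      using elim(5) P0 \<delta> unfolding q_def by (intro mult_right_mono mult_left_mono) auto
    finally have s1: "s\<^sub>1 \<le> e * P n" using \<delta> by simp
    have s2eq: "s\<^sub>2 = 6 * real k / \<delta> * \<kappa> * P n" unfolding s\<^sub>2_def P_def by simp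
    have s2: "s\<^sub>2 \<le> e * P n" unfolding s2eq using \<kappa> P0 by (intro mult_right_mono) auto
    have "?pr n \<le> prob_Pnp n (p n) (\<lambda>R. e * P n + s\<^sub>1 + s\<^sub>2 + (real k - 1 + 5 * e) * P n < max_free X le R)"
    proof (rule prob_Pnp_mono)
      fix R assume "(real k - 1 + 8 * e) * P n < max_free X le R"
      moreover have "(real k - 1 + 8 * e) * P n = 3 * (e * P n) + (real k - 1 + 5 * e) * P n" by (simp add: algebra_simps)
      moreover have "0 < e * P n" using e P0 by simp
      ultimately show "e * P n + s\<^sub>1 + s\<^sub>2 + (real k - 1 + 5 * e) * P n < max_free X le R" using s1 s2 by linarith
    qed (use p in auto)
    \<comment> \<open>Here \<open>a = 1 + t\<close>, \<open>y\<^sub>1 = 1 / n ^ 2\<close> and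
      \<open>y\<^sub>2 = \<kappa>\<close>. The choice of \<open>y\<^sub>1\<close> makes
      \<open>y\<^sub>1 * card (middle \<eta> n)\<close> negligible against \<open>C n\<close>; that
      of \<open>y\<^sub>2\<close> leads to the two terms bounded by
      \<open>small_fingerprint_constant\<close>.\<close>
    also have "\<dots> \<le> exp (p n * card (boolean_lattice n - middle \<eta> n)) * 2 powr (- (e * P n)) +
      (exp (p n * (1 + t) * (1 / (real n)\<^sup>2) * card (middle \<eta> n)) * (1 / (real n)\<^sup>2) powr (- s\<^sub>1)) *
      (exp (p n * (1 + t) * \<kappa> * (3 * real k * C n)) * \<kappa> powr (- s\<^sub>2)) *
      (exp (p n * (1 + t - 1) * ((real k - 1 + e) * C n)) * (1 + t) powr (- ((real k - 1 + 5 * e) * P n)))"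
    proof (rule upper_tail[OF n(1), where q\<^sub>1 = q and q\<^sub>2 = "\<kappa> * p n"])
      show "(12 / real n) ^ 3 / c \<le> q" using elim(1) c q unfolding q_def by (simp add: field_simps)
      show "4 / real n / c \<le> \<kappa> * p n" using elim(8) c n \<kappa> by (simp add: field_simps)
      show "\<kappa> * p n \<le> 1 / 2" using \<kappa> p[of n] mult_mono[of \<kappa> "1 / 2" "p n" 1] by simp
      show "s\<^sub>1 = 2 * q * card (middle \<eta> n) / \<delta>" unfolding s\<^sub>1_def m\<^sub>M_def ..
      show "s\<^sub>2 = 2 * (\<kappa> * p n) * (3 * real k * C n) / \<delta>" unfolding s\<^sub>2_def ..
      show "1 / (real n)\<^sup>2 \<le> 1" using n by simp
    qed (use p q p0 \<kappa> t n elim(2) in \<open>auto simp: q_def\<close>)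
    also have "exp (p n * card (boolean_lattice n - middle \<eta> n)) * 2 powr (- (e * P n)) \<le> exp (- (e / 4) * P n)"
    proof -
      have "boolean_lattice n - middle \<eta> n = {x\<in>Pow {..<n}. \<eta> * n < \<bar>real (card x) - n / 2\<bar>}"
        unfolding boolean_lattice_def middle_def by auto
      then have "card (boolean_lattice n - middle \<eta> n) \<le> e / 4 * C n"
        using elim(6) C_pos[of n] by (simp add: field_simps)
      then have "p n * card (boolean_lattice n - middle \<eta> n) \<le> p n * (e / 4 * C n)"
        using p0 by (intro mult_left_mono) auto
      then have "p n * card (boolean_lattice n - middle \<eta> n) \<le> e / 4 * P n" by (simp add: P_def mult_ac)
      moreover have "e * P n * (1 / 2) \<le> e * P n * ln 2"
      proof -
        have "ln (1 / 2 :: real) \<le> 1 / 2 - 1" by (rule ln_le_minus_one) simp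
        then have "1 / 2 \<le> ln (2 :: real)" by (simp add: ln_div)
        then show ?thesis using e P0 by (intro mult_left_mono) auto
      qed
      ultimately have "p n * card (boolean_lattice n - middle \<eta> n) + - (e * P n) * ln 2 \<le> - (e / 4) * P n"
        by simp
      then show ?thesis by (simp add: powr_def mult_exp_exp)
    qed
    also have "(exp (p n * (1 + t) * (1 / (real n)\<^sup>2) * card (middle \<eta> n)) * (1 / (real n)\<^sup>2) powr (- s\<^sub>1)) *
      (exp (p n * (1 + t) * \<kappa> * (3 * real k * C n)) * \<kappa> powr (- s\<^sub>2)) *
      (exp (p n * (1 + t - 1) * ((real k - 1 + e) * C n)) * (1 + t) powr (- ((real k - 1 + 5 * e) * P n)))
      \<le> exp (- (2 * e * t) * P n)"
    proof -
      have A1: "p n * (1 + t) * (1 / (real n)\<^sup>2) * card (middle \<eta> n) \<le> e * t / 4 * P n"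
      proof -
        have "p n * (1 + t) * (1 / (real n)\<^sup>2) * m\<^sub>M \<le> p n * 2 * (1 / (real n)\<^sup>2) * ((real n + 1) * C n)"
          using p0 t mM by (intro mult_mono) (auto simp: m\<^sub>M_def)
        also have "\<dots> = 2 * (real n + 1) / (real n)\<^sup>2 * P n" by (simp add: P_def)
        also have "\<dots> \<le> e * t / 4 * P n" using elim(3) P0 by (intro mult_right_mono) auto
        finally show ?thesis unfolding m\<^sub>M_def .
      qed
      have A2: "- s\<^sub>1 * ln (1 / (real n)\<^sup>2) \<le> e * t / 4 * P n"
      proof -
        have "- s\<^sub>1 * ln (1 / (real n)\<^sup>2) = s\<^sub>1 * (2 * ln (real n))" using n by (simp add: ln_div ln_realpow)
        also have "\<dots> \<le> 2 / \<delta> * (q * (real n + 1) * n) * P n * (2 * ln (real n))"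
          using s1q n by (intro mult_right_mono) auto
        also have "\<dots> = 4 / \<delta> * (q * (real n + 1) * n * ln (real n)) * P n" by simp
        also have "\<dots> \<le> 4 / \<delta> * (e * t * \<delta> / 16) * P n"
          using elim(4) P0 \<delta> unfolding q_def by (intro mult_right_mono mult_left_mono) auto
        finally show ?thesis using \<delta> by simp
      qed
      have B: "p n * (1 + t) * \<kappa> * (3 * real k * C n) + - s\<^sub>2 * ln \<kappa> \<le> e * t / 2 * P n"
      proof -
        have "p n * (1 + t) * \<kappa> * (3 * real k * C n) \<le> p n * 2 * \<kappa> * (3 * real k * C n)"
          using p0 t \<kappa> by (intro mult_right_mono mult_left_mono) auto
        also have "\<dots> = 6 * real k * \<kappa> * P n" by (simp add: P_def)
        finally have "p n * (1 + t) * \<kappa> * (3 * real k * C n) \<le> 6 * real k * \<kappa> * P n" .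
        moreover have "- s\<^sub>2 * ln \<kappa> = 6 * real k / \<delta> * \<kappa> * ln (1 / \<kappa>) * P n"
          unfolding s2eq using \<kappa> by (simp add: ln_div)
        moreover have "(6 * real k * \<kappa> + 6 * real k / \<delta> * \<kappa> * ln (1 / \<kappa>)) * P n \<le> e * t / 2 * P n"
          using \<kappa>(4) P0 by (intro mult_right_mono) auto
        ultimately show ?thesis by (simp only: distrib_right)
      qed
      have D: "p n * (1 + t - 1) * ((real k - 1 + e) * C n) + - ((real k - 1 + 5 * e) * P n) * ln (1 + t) \<le> - 3 * (e * t) * P n"
      proof -
        have "(real k - 1 + 5 * e) * P n * (t - t\<^sup>2) \<le> (real k - 1 + 5 * e) * P n * ln (1 + t)"
          using ln_one_plus_pos_lower_bound[of t] t e k1 P0 by (intro mult_left_mono) auto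
        moreover have "(real k - 1 + 5 * e) * (t * (t * P n)) \<le> (real k + 5) * (t * (t * P n))"
          using e t P0 by (intro mult_right_mono) auto
        moreover have "(real k + 5) * (t * (t * P n)) = e * t * P n" using t(3) by (simp flip: mult.assoc)
        moreover have "p n * (1 + t - 1) * ((real k - 1 + e) * C n) = (real k - 1 + e) * t * P n" by (simp add: P_def)
        ultimately show ?thesis by (simp add: algebra_simps power2_eq_square)
      qed
      \<comment> \<open>Balance in multiples of \<open>e * t * P n\<close>: two quarters from the
        first round, one half from the second, and \<open>- 3\<close> from the tail bound.\<close>
      have "p n * (1 + t) * (1 / (real n)\<^sup>2) * card (middle \<eta> n) + - s\<^sub>1 * ln (1 / (real n)\<^sup>2) +
        (p n * (1 + t) * \<kappa> * (3 * real k * C n) + - s\<^sub>2 * ln \<kappa>) +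
        (p n * (1 + t - 1) * ((real k - 1 + e) * C n) + - ((real k - 1 + 5 * e) * P n) * ln (1 + t)) \<le> - (2 * e * t) * P n"
        using A1 A2 B D by argo
      moreover have "x powr y = exp (y * ln x)" if "0 < x" for x y :: real using that by (simp add: powr_def)
      ultimately show ?thesis using n \<kappa> t by (simp add: mult_exp_exp)
    qed
    finally show ?case by simp
  qed
  moreover have "(\<lambda>n. exp (- (e / 4) * P n) + exp (- (2 * e * t) * P n)) \<longlonglongrightarrow> 0 + 0"
  proof (rule tendsto_add)
    have tend: "(\<lambda>n. exp (- a * P n)) \<longlonglongrightarrow> 0" if "0 < a" for a
    proof (rule filterlim_compose[OF exp_at_bot])
      have "filterlim (\<lambda>n. a * P n) at_top sequentially"
        by (rule filterlim_tendsto_pos_mult_at_top[OF tendsto_const that P])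
      then show "filterlim (\<lambda>n. - a * P n) at_bot sequentially" by (simp add: filterlim_uminus_at_bot)
    qed
    show "(\<lambda>n. exp (- (e / 4) * P n)) \<longlonglongrightarrow> 0" by (rule tend) (use e in simp)
    show "(\<lambda>n. exp (- (2 * e * t) * P n)) \<longlonglongrightarrow> 0" by (rule tend) (use e t in simp)
  qed
  moreover have "0 \<le> ?pr n" for n unfolding prob_Pnp_eq using p by (intro sum_nonneg) (auto intro: wt_nonneg)
  ultimately have "?pr \<longlonglongrightarrow> 0"
    by (intro tendsto_sandwich[where f = "\<lambda>_. 0" and g = ?pr, OF always_eventually]) auto
  then show ?thesis unfolding P_def .
qed

text \<open>The members of the random family in \<open>k - 1\<close> levels form a free family, so a
  lower tail bound for their number suffices.\<close>

lemma lower_limit: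
  assumes p: "\<And>n. 0 \<le> p n \<and> p n \<le> 1" and pn: "filterlim (\<lambda>n. p n * real n) at_top sequentially"
  shows "(\<lambda>n. prob_Pnp n (p n) (\<lambda>R. max_free X le R < (real k - 1 - e) * (p n * C n))) \<longlonglongrightarrow> 0"
proof -
  define P where "P n = p n * C n" for n
  have P: "filterlim P at_top sequentially" unfolding P_def by (rule expected_size_at_top[OF pn])
  have Pn: "0 \<le> P n" for n unfolding P_def using p by simp
  let ?pr = "\<lambda>n. prob_Pnp n (p n) (\<lambda>R. max_free X le R < (real k - 1 - e) * P n)"
  have "?pr \<longlonglongrightarrow> 0"
  proof (cases "k = 1")
    \<comment> \<open>For \<open>k = 1\<close> the block of levels is empty, but the threshold is
      then not positive and the event is impossible.\<close>
    case True
    have "?pr n = 0" for n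
    proof -
      have "(real k - 1 - e) * P n \<le> 0" using True e Pn[of n] by (intro mult_nonpos_nonneg) auto
      then have no: "\<not> real (max_free X le R) < (real k - 1 - e) * P n" for R by (simp add: not_less order_trans)
      show ?thesis unfolding prob_Pnp_eq by (simp only: no of_bool_eq mult_zero_right sum.neutral_const)
    qed
    then show ?thesis by simp
  next
    case False
    then have k2: "2 \<le> real k" using k_pos by linarith
    \<comment> \<open>With this \<open>t\<close> the second-order term
      \<open>2 * k * t\<^sup>2\<close> coming from
      \<open>- ln (1 - t) \<le> t + 2 * t\<^sup>2\<close> equals \<open>e * t / 4\<close>, half of
      the linear gain \<open>e * t / 2\<close>.\<close>
    define t where "t = e / (8 * real k)"
    have t: "0 < t" "t \<le> 1 / 2" "2 * real k * t = e / 4" unfolding t_def using e k2 by (auto simp: field_simps)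
    \<comment> \<open>A block of \<open>k - 1\<close> levels starting at the middle: each has
      asymptotically the size of the middle level, so the block has
      \<open>(k - 1 + o(1)) * C n\<close> sets.\<close>
    define D where "D n = {x\<in>Pow {..<n}. card x \<in> {n div 2..<n div 2 + (k - 1)}}" for n
    have cD: "card (D n) = (\<Sum>j<k - 1. n choose (n div 2 + j))" for n
    proof -
      have "D n = (\<Union>j<k - 1. {x. x \<subseteq> {..<n} \<and> card x = n div 2 + j})"
      proof (intro equalityI subsetI)
        fix x assume "x \<in> D n"
        then show "x \<in> (\<Union>j<k - 1. {x. x \<subseteq> {..<n} \<and> card x = n div 2 + j})"
          unfolding D_def by (intro UN_I[of "card x - n div 2"]) auto
      qed (auto simp: D_def)
      then have "card (D n) = (\<Sum>j<k - 1. card {x. x \<subseteq> {..<n} \<and> card x = n div 2 + j})"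
        by (simp only:) (rule card_UN_disjoint, auto)
      then show ?thesis using n_subsets[of "{..<n}"] by simp
    qed
    have "(\<lambda>n. \<Sum>j<k - 1. real (n choose (n div 2 + j)) / C n) \<longlonglongrightarrow> (\<Sum>j<k - 1. 1)"
      by (intro tendsto_sum near_central_binomial)
    then have "(\<lambda>n. real (card (D n)) / C n) \<longlonglongrightarrow> real k - 1"
      using k_pos by (simp add: cD sum_divide_distrib of_nat_diff)
    then have ev: "\<forall>\<^sub>F n in sequentially. real k - 1 - e / 2 < real (card (D n)) / C n"
      using e by (intro order_tendstoD) auto
    have "\<forall>\<^sub>F n in sequentially. ?pr n \<le> exp (- (t * e / 4) * P n)"
      using ev
    proof eventually_elim
      case (elim n)
      have DB: "D n \<subseteq> boolean_lattice n" unfolding D_def boolean_lattice_def by auto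
      have "?pr n \<le> prob_Pnp n (p n) (\<lambda>R. card (R \<inter> D n) \<le> (real k - 1 - e) * P n)"
      proof (rule prob_Pnp_mono)
        fix R assume R: "R \<subseteq> boolean_lattice n" and less: "max_free X le R < (real k - 1 - e) * P n"
        have fR: "finite R" using finite_subset[OF R] by simp
        have "\<not> contains_induced X le (R \<inter> D n)"
        proof
          assume "contains_induced X le (R \<inter> D n)"
          then have "height X le \<le> card (card ` (R \<inter> D n))"
            using fR by (intro height_le_levels[OF X(2)]) (auto simp: D_def intro: finite_subset)
          also have "\<dots> \<le> card {n div 2..<n div 2 + (k - 1)}" by (intro card_mono) (auto simp: D_def)
          finally show False using k k_pos by simp
        qed
        then have "card (R \<inter> D n) \<le> max_free X le R" using max_free_bounds(1)[OF X(1) fR] by blast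
        then show "card (R \<inter> D n) \<le> (real k - 1 - e) * P n" using less by linarith
      qed (use p in auto)
      also have "\<dots> \<le> exp (p n * (1 - t - 1) * card (D n)) * (1 - t) powr (- ((real k - 1 - e) * P n))"
        by (rule prob_lower_tail) (use p DB t in auto)
      also have "\<dots> = exp (- t * (p n * card (D n)) + (real k - 1 - e) * P n * - ln (1 - t))"
        using t by (simp add: powr_def mult_exp_exp algebra_simps)
      also have "\<dots> \<le> exp (- (t * e / 4) * P n)"
      proof -
        have "(real k - 1 - e / 2) * C n \<le> card (D n)" using elim C_pos[of n] by (simp add: field_simps)
        then have "p n * ((real k - 1 - e / 2) * C n) \<le> p n * card (D n)" using p by (intro mult_left_mono) auto
        then have a: "t * ((real k - 1 - e / 2) * P n) \<le> t * (p n * card (D n))"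
          using t by (intro mult_left_mono) (auto simp: P_def mult_ac)
        have b: "(real k - 1 - e) * P n * - ln (1 - t) \<le> (real k - 1 - e) * P n * (t + 2 * t\<^sup>2)"
          using ln_one_minus_pos_lower_bound[of t] t k2 e Pn[of n] by (intro mult_left_mono) auto
        have "(real k - 1 - e) * (2 * t * (t * P n)) \<le> real k * (2 * t * (t * P n))"
          using e t Pn[of n] by (intro mult_right_mono) auto
        also have "\<dots> = (2 * real k * t) * (t * P n)" by simp
        also have "\<dots> = e / 4 * (t * P n)" unfolding t(3) ..
        finally have d: "(real k - 1 - e) * (2 * t * (t * P n)) \<le> e / 4 * (t * P n)" .
        have "- t * (p n * card (D n)) + (real k - 1 - e) * P n * - ln (1 - t) \<le>
          - (t * ((real k - 1 - e / 2) * P n)) + (real k - 1 - e) * P n * (t + 2 * t\<^sup>2)"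
          using a b by simp
        also have "\<dots> = - (e / 2 * (t * P n)) + (real k - 1 - e) * (2 * t * (t * P n))"
          by (simp add: algebra_simps power2_eq_square)
        also have "\<dots> \<le> - (t * e / 4) * P n" using d by (simp add: algebra_simps)
        finally show ?thesis by simp
      qed
      finally show ?case .
    qed
    moreover have "(\<lambda>n. exp (- (t * e / 4) * P n)) \<longlonglongrightarrow> 0"
    proof (rule filterlim_compose[OF exp_at_bot])
      have "filterlim (\<lambda>n. t * e / 4 * P n) at_top sequentially"
        by (rule filterlim_tendsto_pos_mult_at_top[OF tendsto_const _ P]) (use t e in auto)
      then show "filterlim (\<lambda>n. - (t * e / 4) * P n) at_bot sequentially" by (simp add: filterlim_uminus_at_bot)
    qed
    moreover have "0 \<le> ?pr n" for n unfolding prob_Pnp_eq using p by (intro sum_nonneg) (auto intro: wt_nonneg)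
    ultimately show ?thesis
      by (intro tendsto_sandwich[where f = "\<lambda>_. 0" and g = ?pr, OF always_eventually]) auto
  qed
  then show ?thesis unfolding P_def .
qed

end

theorem theorem1p6:
  fixes X :: "'a set" and le :: "'a \<Rightarrow> 'a \<Rightarrow> bool" and p :: "nat \<Rightarrow> real" and k :: nat
  assumes "is_tree_poset X le"
    and "k = height X le"
    and "\<forall>n. 0 \<le> p n \<and> p n \<le> 1"
    and "filterlim (\<lambda>n. p n * real n) at_top sequentially"
  shows "\<forall>\<epsilon>>0. (\<lambda>n. prob_Pnp n (p n)
            (\<lambda>F. \<bar>real (max_free X le F) - (real k - 1) * p n * real (n choose (n div 2))\<bar>
                   \<le> \<epsilon> * p n * real (n choose (n div 2)))) \<longlonglongrightarrow> 1"
proof (intro allI impI)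
  fix \<epsilon> :: real
  assume \<epsilon>: "0 < \<epsilon>"
  \<comment> \<open>The upper bound has total slack \<open>8 * e\<close>, which must not exceed
    \<open>\<epsilon>\<close>; the cap at \<open>1\<close> is an assumption of
    \<open>tree_poset_density\<close>.\<close>
  define e where "e = min 1 (\<epsilon> / 8)"
  have e_bounds: "0 < e" "e \<le> 1" "8 * e \<le> \<epsilon>" unfolding e_def using \<epsilon> by auto
  interpret tree_poset_density X le k e by unfold_locales (use assms(1,2) e_bounds in auto)
  have p': "0 \<le> p n" "p n \<le> 1" for n using assms(3) by auto
  let ?P = "\<lambda>n. p n * C n"
  let ?up = "\<lambda>n. prob_Pnp n (p n) (\<lambda>R. (real k - 1 + 8 * e) * ?P n < max_free X le R)"
  let ?lo = "\<lambda>n. prob_Pnp n (p n) (\<lambda>R. max_free X le R < (real k - 1 - e) * ?P n)"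
  let ?pr = "\<lambda>n. prob_Pnp n (p n) (\<lambda>F. \<bar>real (max_free X le F) - (real k - 1) * p n * C n\<bar> \<le> \<epsilon> * p n * C n)"
  have lim: "(\<lambda>n. 1 - (?up n + ?lo n)) \<longlonglongrightarrow> 1 - (0 + 0)"
    using assms(3,4) by (intro tendsto_intros upper_limit lower_limit) auto
  have le: "1 - (?up n + ?lo n) \<le> ?pr n" for n
  proof -
    have "1 - prob_Pnp n (p n) (\<lambda>R. (real k - 1 + 8 * e) * ?P n < max_free X le R \<or> max_free X le R < (real k - 1 - e) * ?P n) \<le> ?pr n"
    proof (rule prob_Pnp_compl[OF p'])
      fix R assume far: "\<not> \<bar>real (max_free X le R) - (real k - 1) * p n * C n\<bar> \<le> \<epsilon> * p n * C n"
      define P A E D where "P = ?P n" and "A = (real k - 1) * P" and "E = e * P" and "D = \<epsilon> * P"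
      have P: "0 \<le> P" unfolding P_def using p' by simp
      have "8 * E \<le> D" using mult_right_mono[OF e_bounds(3) P] unfolding D_def E_def by (simp add: mult.assoc)
      moreover have "0 \<le> E" unfolding E_def using e_bounds P by simp
      moreover have "(real k - 1 + 8 * e) * P = A + 8 * E" "(real k - 1 - e) * P = A - E"
        unfolding A_def E_def by (simp_all add: algebra_simps)
      moreover have "\<not> \<bar>real (max_free X le R) - A\<bar> \<le> D"
        using far unfolding A_def D_def P_def by (simp add: mult.assoc)
      ultimately have "(real k - 1 + 8 * e) * P < max_free X le R \<or> max_free X le R < (real k - 1 - e) * P"
        by linarith
      then show "(real k - 1 + 8 * e) * ?P n < max_free X le R \<or> max_free X le R < (real k - 1 - e) * ?P n"
        unfolding P_def .
    qed
    moreover have "prob_Pnp n (p n) (\<lambda>R. (real k - 1 + 8 * e) * ?P n < max_free X le R \<or> max_free X le R < (real k - 1 - e) * ?P n)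
      \<le> ?up n + ?lo n" by (rule prob_Pnp_disj[OF p'])
    ultimately show ?thesis by linarith
  qed
  show "?pr \<longlonglongrightarrow> 1"
  proof (rule tendsto_sandwich[OF always_eventually always_eventually])
    show "\<forall>n. 1 - (?up n + ?lo n) \<le> ?pr n" using le by blast
    show "\<forall>n. ?pr n \<le> 1" using prob_Pnp_le_1[OF p'] by blast
    show "(\<lambda>n. 1 - (?up n + ?lo n)) \<longlonglongrightarrow> 1" using lim by simp
  qed (rule tendsto_const)
qed

end
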